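(* Let $m\ge1$ and let $T_1,\dots,T_m:[0,1]\to[0,1]$ be $C^1$ maps with $T_i'(x)>0$ for all $x$, such that $T_i((0,1))\cap T_j((0,1))=\emptyset$ for $i\ne j$ and $\operatorname{diam}(T_{i_1}\circ\cdots\circ T_{i_n}([0,1]))\to0$ uniformly over all sequences $(i_1,i_2,\dots)$. Suppose each $T_i$ has the fixed point $x_i=\Pi(i,i,i,\dots)$, with $T_i'(x_i)\le 1$ and $0<T_i'(x)<1$ for all $x\neq x_i$. Let $\mathcal I=\{i: T_i'(x_i)=1\}$ be the (nonempty) set of indices of indifferent fixed points. Assume that for every $\epsilon>0$ there exists $\mu\in\mathcal M_\sigma(\Sigma)$ with $\lambda(\mu)>0$ and $\frac{h_\sigma(\mu)}{\lambda(\mu)}\ge\dim\Lambda-\epsilon$. Let $f:\Sigma\to\mathbb R$ be continuous, let $\alpha_i=f(i,i,i,\dots)$ for $i\in\mathcal I$ and $A=[\min_{i\in\mathcal I}\alpha_i,\max_{i\in\mathcal I}\alpha_i]$. Then for $\alpha\in[\alpha_{\min},\alpha_{\max}]\setminus A$, \[ \dim\Pi(X_\alpha)=\sup_{\mu\in\mathcal M_\sigma(\Sigma)}\left\{\frac{h_\sigma(\mu)}{\lambda(\mu)}:\int f\,d\mu=\alpha\right\}, \] and $\dim\Pi(X_\alpha)=\dim\Lambda$ for all $\alpha\in A$.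
   Context: $\Sigma=\{1,\dots,m\}^{\mathbb N}$ with shift $\sigma$; $\Pi(\omega)=\lim_{n\to\infty}T_{\omega_1}\circ\cdots\circ T_{\omega_n}(0)$; $\Lambda=\Pi(\Sigma)$. $g(\omega)=-\log T'_{\omega_1}(\Pi(\sigma\omega))$. $A_nF(\omega)=\frac1n\sum_{i=0}^{n-1}F(\sigma^i\omega)$. $X_\alpha=\{\omega:\lim_n A_nf(\omega)=\alpha\}$. $\mathcal M_\sigma(\Sigma)$ and $\mathcal E_\sigma(\Sigma)$ are the $\sigma$-invariant and $\sigma$-ergodic Borel probability measures; $h_\sigma(\mu)$ is entropy, $\lambda(\mu)=\int g\,d\mu$. $\alpha_{\min}=\inf_{\mu\in\mathcal E_\sigma(\Sigma)}\int f\,d\mu$, $\alpha_{\max}=\sup_{\mu\in\mathcal E_\sigma(\Sigma)}\int f\,d\mu$. $\dim$ is Hausdorff dimension. *)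

theory Defs
  imports "HOL-Probability.Probability"
begin

text \<open>Sigma = {1,...,m}^N; sequences are indexed from 0, so omega 0 is the first symbol.
  nat => nat carries the product topology (Function_Topology), nat the discrete one.\<close>

definition Sig :: "nat \<Rightarrow> (nat \<Rightarrow> nat) set" where
  "Sig m = {\<omega>. \<forall>k. \<omega> k \<in> {1..m}}"

definition shift :: "(nat \<Rightarrow> nat) \<Rightarrow> (nat \<Rightarrow> nat)" where
  "shift \<omega> = (\<lambda>k. \<omega> (Suc k))"

definition SigM :: "nat \<Rightarrow> (nat \<Rightarrow> nat) measure" where
  "SigM m = restrict_space borel (Sig m)"

fun compn :: "(nat \<Rightarrow> real \<Rightarrow> real) \<Rightarrow> (nat \<Rightarrow> nat) \<Rightarrow> nat \<Rightarrow> real \<Rightarrow> real" where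
  "compn T \<omega> 0 = id"
| "compn T \<omega> (Suc n) = compn T \<omega> n \<circ> T (\<omega> n)"

definition Pi_map :: "(nat \<Rightarrow> real \<Rightarrow> real) \<Rightarrow> (nat \<Rightarrow> nat) \<Rightarrow> real" where
  "Pi_map T \<omega> = lim (\<lambda>n. compn T \<omega> n 0)"

text \<open>g(omega) = - log T'_{omega_1}(Pi(sigma omega)); DT i is the derivative of T i.\<close>
definition gpot :: "(nat \<Rightarrow> real \<Rightarrow> real) \<Rightarrow> (nat \<Rightarrow> real \<Rightarrow> real) \<Rightarrow> (nat \<Rightarrow> nat) \<Rightarrow> real" where
  "gpot T DT \<omega> = - ln (DT (\<omega> 0) (Pi_map T (shift \<omega>)))"

definition lyap :: "(nat \<Rightarrow> real \<Rightarrow> real) \<Rightarrow> (nat \<Rightarrow> real \<Rightarrow> real) \<Rightarrow> (nat \<Rightarrow> nat) measure \<Rightarrow> real" where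
  "lyap T DT \<mu> = integral\<^sup>L \<mu> (gpot T DT)"

definition inv_measures :: "nat \<Rightarrow> (nat \<Rightarrow> nat) measure set" where
  "inv_measures m = {\<mu>. sets \<mu> = sets (SigM m) \<and> prob_space \<mu> \<and>
      (\<forall>A\<in>sets \<mu>. emeasure \<mu> (shift -` A \<inter> space \<mu>) = emeasure \<mu> A)}"

definition erg_measures :: "nat \<Rightarrow> (nat \<Rightarrow> nat) measure set" where
  "erg_measures m = {\<mu>\<in>inv_measures m. \<forall>A\<in>sets \<mu>.
      shift -` A \<inter> space \<mu> = A \<longrightarrow> measure \<mu> A = 0 \<or> measure \<mu> A = 1}"

definition finite_meas_partition :: "'a measure \<Rightarrow> 'a set set \<Rightarrow> bool" where
  "finite_meas_partition \<mu> P \<longleftrightarrow> finite P \<and> P \<subseteq> sets \<mu> \<and> disjoint P \<and> \<Union>P = space \<mu>"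

definition join_part :: "(nat \<Rightarrow> nat) measure \<Rightarrow> (nat \<Rightarrow> nat) set set \<Rightarrow> nat \<Rightarrow> (nat \<Rightarrow> nat) set set" where
  "join_part \<mu> P n = {space \<mu> \<inter> (\<Inter>i<n. (shift ^^ i) -` c i) | c. \<forall>i<n. c i \<in> P}"

definition part_entropy :: "'a measure \<Rightarrow> 'a set set \<Rightarrow> real" where
  "part_entropy \<mu> Q = - (\<Sum>A\<in>Q. measure \<mu> A * ln (measure \<mu> A))"

definition ent_rel :: "(nat \<Rightarrow> nat) measure \<Rightarrow> (nat \<Rightarrow> nat) set set \<Rightarrow> real" where
  "ent_rel \<mu> P = lim (\<lambda>n. part_entropy \<mu> (join_part \<mu> P n) / real n)"

definition ks_entropy :: "(nat \<Rightarrow> nat) measure \<Rightarrow> real" where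
  "ks_entropy \<mu> = Sup {ent_rel \<mu> P | P. finite_meas_partition \<mu> P}"

definition hausdorff_pre :: "real \<Rightarrow> real \<Rightarrow> real set \<Rightarrow> ennreal" where
  "hausdorff_pre s \<delta> E = (INF U \<in> {U :: nat \<Rightarrow> real set. E \<subseteq> (\<Union>i. U i) \<and>
       (\<forall>i. bounded (U i) \<and> diameter (U i) \<le> \<delta>)}. (\<Sum>i. ennreal (diameter (U i) powr s)))"

definition hausdorff_measure :: "real \<Rightarrow> real set \<Rightarrow> ennreal" where
  "hausdorff_measure s E = (SUP \<delta> \<in> {0<..}. hausdorff_pre s \<delta> E)"

definition hdim :: "real set \<Rightarrow> real" where
  "hdim E = Inf {s. 0 \<le> s \<and> hausdorff_measure s E = 0}"

definition birk_avg :: "((nat \<Rightarrow> nat) \<Rightarrow> real) \<Rightarrow> nat \<Rightarrow> (nat \<Rightarrow> nat) \<Rightarrow> real" where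
  "birk_avg f n \<omega> = (1 / real n) * (\<Sum>i<n. f ((shift ^^ i) \<omega>))"

definition level_set :: "nat \<Rightarrow> ((nat \<Rightarrow> nat) \<Rightarrow> real) \<Rightarrow> real \<Rightarrow> (nat \<Rightarrow> nat) set" where
  "level_set m f \<alpha> = {\<omega> \<in> Sig m. (\<lambda>n. birk_avg f n \<omega>) \<longlonglongrightarrow> \<alpha>}"

end

theory Submission
  imports Defs
begin

text \<open>
  Cylinder probabilities carry everything: invariant measures on the symbol space correspond to
  consistent, shift-invariant functions on finite words, integrals of continuous functions are limits
  of cylinder sums, and the entropy is the limit of the normalised cylinder entropies. The latter needs no
  conditional entropy: a finite partition is determined by nearby unions of cylinders
  together with the indicators of the symmetric differences, which have small entropy.

  Lower bound. Given an invariant measure with integral near \<open>\<alpha>\<close>, concatenate words of a fixed large length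
  independently according to their cylinder probabilities. By Chebyshev's inequality there are exponentially
  many typical concatenations, at the rate of the entropy, and on each of them the averages of \<open>f\<close> and of \<open>g\<close> are
  controlled. Concatenating such word sets whose parameters improve slowly gives a Moran set inside the level
  set, to which the mass distribution principle applies. For \<open>\<alpha>\<close> between values at
  indifferent fixed points, mixing a measure of almost maximal dimension with a point mass at such a
  fixed point changes the integral of \<open>f\<close> but not the quotient of entropy and exponent.

  Upper bound. If the cover by the cylinders of length \<open>n\<close> on which the average of \<open>f\<close> is near \<open>\<alpha>\<close> had a large
  \<open>s\<close>-sum for infinitely many \<open>n\<close>, the weights proportional to the \<open>s\<close>-th power of the
  lengths would give empirical measures whose limits are invariant measures with integral \<open>\<alpha>\<close> and
  entropy at least \<open>s\<close> times the exponent. An invariant measure of exponent zero lives on the indifferent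
  fixed points, so for \<open>\<alpha>\<close> outside the interval spanned by their values the exponent is positive.
\<close>

section \<open>Entropy of finite-valued functions\<close>

text \<open>What survives is that \<open>ln (DT i x)\<close> is uniformly continuous in
  \<open>x\<close> and that cylinders of length \<open>n\<close> shrink uniformly; this gives
  distortion at most \<open>exp (n * e)\<close> for every \<open>e > 0\<close>. Hence the
  comparisons carry an error linear in \<open>n\<close> with an arbitrarily small factor, and strict
  inequalities (\<open>s * lyap < h\<close> for the lower bound, \<open>h < s * lyap\<close> for the
  upper one) absorb it. An invariant measure need not be ergodic, so orbits typical for it may have
  averages of \<open>f\<close> far from the integral. Sampling long words independently restores
  concentration around the integral without losing entropy rate, and a variance computation takes
  the place of the ergodic theorem and of the Shannon-McMillan-Breiman theorem. Entropy and exponent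
  are compared through products as long as the exponent may vanish; quotients appear only once it is
  known to be positive, since division by zero yields zero.\<close>

definition eta :: "real \<Rightarrow> real" where
  "eta x = - (x * ln x)"

text \<open>Shannon entropy, in natural logarithms, of the partition of \<open>space M\<close> into
  the fibres of \<open>X\<close>. Indexing by values instead of sets treats partitions, words and
  vectors of indicators alike.\<close>

definition Hx :: "'a measure \<Rightarrow> ('a \<Rightarrow> 'b) \<Rightarrow> real" where
  "Hx M X = (\<Sum>x\<in>X ` space M. eta (measure M (X -` {x} \<inter> space M)))"

lemma eta_0 [simp]: "eta 0 = 0" and eta_1 [simp]: "eta 1 = 0"
  by (auto simp: eta_def)

lemma eta_nonneg: "0 \<le> x \<Longrightarrow> x \<le> 1 \<Longrightarrow> 0 \<le> eta x"
  by (cases "x = 0") (auto simp: eta_def mult_nonneg_nonpos)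

lemma information_space_exp: "prob_space M \<Longrightarrow> information_space M (exp 1)"
  by (simp add: information_space_def information_space_axioms_def)

context
  fixes M :: "'a measure"
  assumes M: "prob_space M"
begin

interpretation information_space M "exp 1"
  using M by (rule information_space_exp)

lemma Hx_eq_entropy:
  assumes "simple_function M X"
  shows "Hx M X = entropy (exp 1) (count_space (X ` space M)) X"
  using entropy_simple_distributed[OF simple_distributedI[OF assms measure_nonneg refl]]
  by (simp add: Hx_def eta_def sum_negf log_def)

lemma Hx_compose_le:
  assumes "simple_function M X"
  shows "Hx M (\<lambda>w. h (X w)) \<le> Hx M X"
  using entropy_data_processing[OF assms, of h] Hx_eq_entropy[OF assms]
    Hx_eq_entropy[OF simple_function_compose[OF assms, of h]]
  by (simp add: comp_def)

lemma Hx_pair_le: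
  assumes X: "simple_function M X" and Y: "simple_function M Y"
  shows "Hx M (\<lambda>w. (X w, Y w)) \<le> Hx M X + Hx M Y"
proof -
  have "Hx M (\<lambda>w. (X w, Y w)) = entropy (exp 1) (count_space (X ` space M)) X + conditional_entropy (exp 1) (count_space (Y ` space M)) (count_space (X ` space M)) Y X"
    using entropy_chain_rule[OF X Y] Hx_eq_entropy[OF simple_function_Pair[OF X Y]] by simp
  then show ?thesis
    using conditional_entropy_less_eq_entropy[OF Y X] Hx_eq_entropy[OF X] Hx_eq_entropy[OF Y] by simp
qed

lemma Hx_le_ln_card:
  assumes X: "simple_function M X"
  shows "Hx M X \<le> ln (card (X ` space M))"
  using entropy_le_card[OF simple_distributedI[OF X measure_nonneg refl]] Hx_eq_entropy[OF X]
  by (simp add: log_def)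

lemma Hx_nonneg: "0 \<le> Hx M X"
  unfolding Hx_def by (intro sum_nonneg eta_nonneg) auto

end

text \<open>Values that are not attained contribute \<open>eta 0 = 0\<close>. This lets entropies be
  written as sums over all words of a given length.\<close>

lemma Hx_superset:
  assumes "finite S" "X ` space M \<subseteq> S"
  shows "Hx M X = (\<Sum>x\<in>S. eta (measure M (X -` {x} \<inter> space M)))"
  unfolding Hx_def
proof (rule sum.mono_neutral_left)
  show "\<forall>i\<in>S - X ` space M. eta (measure M (X -` {i} \<inter> space M)) = 0"
  proof
    fix i assume "i \<in> S - X ` space M"
    then have "X -` {i} \<inter> space M = {}" by auto
    then show "eta (measure M (X -` {i} \<inter> space M)) = 0" by simp
  qed
qed (use assms in auto)

lemma simple_function_map:
  assumes "\<And>i. i \<in> set is \<Longrightarrow> simple_function M (X i)"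
  shows "simple_function M (\<lambda>w. map (\<lambda>i. X i w) is)"
  using assms
proof (induction "is")
  case (Cons i js)
  have "simple_function M ((\<lambda>(a, b). a # b) \<circ> (\<lambda>w. (X i w, map (\<lambda>i. X i w) js)))"
    using Cons by (intro simple_function_compose simple_function_Pair) auto
  then show ?case by (simp add: comp_def)
qed simp

lemma Hx_map_append_le:
  assumes M: "prob_space M"
  assumes "\<And>i. i \<in> set is \<union> set js \<Longrightarrow> simple_function M (X i)"
  shows "Hx M (\<lambda>w. map (\<lambda>i. X i w) (is @ js)) \<le> Hx M (\<lambda>w. map (\<lambda>i. X i w) is) + Hx M (\<lambda>w. map (\<lambda>i. X i w) js)"
proof -
  have s: "simple_function M (\<lambda>w. map (\<lambda>i. X i w) is)" "simple_function M (\<lambda>w. map (\<lambda>i. X i w) js)"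
    using assms by (auto intro!: simple_function_map)
  have "Hx M (\<lambda>w. map (\<lambda>i. X i w) (is @ js)) \<le> Hx M (\<lambda>w. (map (\<lambda>i. X i w) is, map (\<lambda>i. X i w) js))"
    using Hx_compose_le[OF M simple_function_Pair[OF s], of "\<lambda>(a, b). a @ b"] by simp
  also have "\<dots> \<le> Hx M (\<lambda>w. map (\<lambda>i. X i w) is) + Hx M (\<lambda>w. map (\<lambda>i. X i w) js)"
    using Hx_pair_le[OF M s] .
  finally show ?thesis .
qed

lemma Hx_map_le_sum:
  assumes M: "prob_space M"
  assumes "\<And>i. i \<in> set is \<Longrightarrow> simple_function M (X i)"
  shows "Hx M (\<lambda>w. map (\<lambda>i. X i w) is) \<le> (\<Sum>i\<leftarrow>is. Hx M (X i))"
  using assms(2)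
proof (induction "is")
  case Nil
  have "Hx M (\<lambda>w. []::'c list) \<le> ln (card ((\<lambda>w. []::'c list) ` space M))"
    by (rule Hx_le_ln_card[OF M]) simp
  also have "\<dots> = 0"
  proof -
    have "space M \<noteq> {}" using M prob_space.not_empty by blast
    then have "(\<lambda>w. []::'c list) ` space M = {[]}" by auto
    then show ?thesis by simp
  qed
  finally show ?case by simp
next
  case (Cons i js)
  have "Hx M (\<lambda>w. map (\<lambda>i. X i w) [i]) \<le> Hx M (X i)"
    using Hx_compose_le[OF M, of "X i" "\<lambda>a. [a]"] Cons.prems by simp
  moreover have "Hx M (\<lambda>w. map (\<lambda>i. X i w) ([i] @ js)) \<le> Hx M (\<lambda>w. map (\<lambda>i. X i w) [i]) + Hx M (\<lambda>w. map (\<lambda>i. X i w) js)"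
    by (rule Hx_map_append_le[OF M]) (use Cons.prems in auto)
  ultimately show ?case using Cons by simp
qed

text \<open>Division with remainder by a \<open>k\<close> for which \<open>a k / k\<close> is nearly
  minimal: the remainders contribute a bounded amount, which disappears after division by
  \<open>n\<close>. The limit is the infimum, whence the second conclusion, which bounds every term
  and not only the limit. Nonnegativity bounds the infimum below and lets \<open>n div k\<close> be
  replaced by \<open>n / k\<close>.\<close>

lemma fekete:
  fixes a :: "nat \<Rightarrow> real"
  assumes sub: "\<And>n k. a (n + k) \<le> a n + a k" and nn: "\<And>n. 0 \<le> a n"
  obtains L where "(\<lambda>n. a n / n) \<longlonglongrightarrow> L" "\<And>n. n \<ge> 1 \<Longrightarrow> L \<le> a n / n"
proof -
  define S where "S = (\<lambda>n. a n / real n) ` {1..}"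
  define L where "L = Inf S"
  have bdd: "bdd_below S" unfolding S_def by (rule bdd_belowI2[of _ 0]) (use nn in auto)
  have lower: "L \<le> a n / n" if "n \<ge> 1" for n
    unfolding L_def by (rule cInf_lower) (use that bdd in \<open>auto simp: S_def\<close>)
  have mul: "a (q * n + r) \<le> q * a n + a r" for q n r
  proof (induction q)
    case (Suc q)
    have "a (Suc q * n + r) = a (n + (q * n + r))" by (simp add: algebra_simps)
    also have "\<dots> \<le> a n + a (q * n + r)" by (rule sub)
    also have "\<dots> \<le> Suc q * a n + a r" using Suc by (simp add: algebra_simps)
    finally show ?case .
  qed simp
  have "(\<lambda>n. a n / n) \<longlonglongrightarrow> L"
  proof (rule LIMSEQ_I)
    fix e :: real assume e: "e > 0"
    have "S \<noteq> {}" by (auto simp: S_def)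
    then obtain k where k: "k \<ge> 1" "a k / k < L + e / 2"
      using cInf_less_iff[OF _ bdd, of "L + e/2"] e by (auto simp: L_def S_def)
    define C where "C = Max (a ` {..<k})"
    have C: "a r \<le> C" if "r < k" for r unfolding C_def using that by (intro Max_ge) auto
    obtain N :: nat where N: "real N > 2 * C / e" using reals_Archimedean2 by blast
    have "norm (a n / n - L) < e" if n: "n \<ge> max N 1" for n
    proof -
      have n0: "real n > 0" "n \<ge> 1" using n by auto
      have "a n = a ((n div k) * k + n mod k)" by simp
      also have "\<dots> \<le> (n div k) * a k + a (n mod k)" by (rule mul)
      also have "\<dots> \<le> (n div k) * a k + C" using C[of "n mod k"] k by simp
      also have "real (n div k) * a k \<le> real n / k * a k"
        by (rule mult_right_mono[OF of_nat_div_le_of_nat nn])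
      finally have "a n \<le> real n * (a k / k) + C" by simp
      then have "a n / n \<le> a k / k + C / n"
        using n0 by (simp add: field_simps)
      moreover have "C / n < e / 2"
      proof -
        have "real N \<le> n" using n by simp
        then have "2 * C / e < n" using N by linarith
        then show ?thesis using e n0 by (simp add: field_simps)
      qed
      ultimately have "a n / n < L + e" using k by linarith
      moreover have "L \<le> a n / n" using lower n0 by simp
      ultimately show ?thesis by simp
    qed
    then show "\<exists>no. \<forall>n\<ge>no. norm (a n / real n - L) < e" by blast
  qed
  then show thesis using lower that by blast
qed

section \<open>Words and cylinders\<close>

definition words :: "nat \<Rightarrow> nat \<Rightarrow> nat list set" where
  "words m n = {w. set w \<subseteq> {1..m} \<and> length w = n}"

definition pref :: "nat \<Rightarrow> (nat \<Rightarrow> nat) \<Rightarrow> nat list" where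
  "pref n \<omega> = map \<omega> [0..<n]"

definition cyl :: "nat \<Rightarrow> nat list \<Rightarrow> (nat \<Rightarrow> nat) set" where
  "cyl m w = {\<omega> \<in> Sig m. pref (length w) \<omega> = w}"

definition Hn :: "nat \<Rightarrow> (nat list \<Rightarrow> real) \<Rightarrow> nat \<Rightarrow> real" where
  "Hn m p n = (\<Sum>w\<in>words m n. eta (p w))"

lemma finite_words [simp]: "finite (words m n)"
  unfolding words_def by (rule finite_lists_length_eq) simp

lemma words_0 [simp]: "words m 0 = {[]}"
  by (auto simp: words_def)

lemma card_words: "card (words m n) = m ^ n"
  unfolding words_def by (subst card_lists_length_eq) auto

lemma length_pref [simp]: "length (pref n \<omega>) = n"
  by (simp add: pref_def)

lemma nth_pref [simp]: "i < n \<Longrightarrow> pref n \<omega> ! i = \<omega> i"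
  by (simp add: pref_def)

lemma pref_eq_iff: "pref n \<omega> = pref n \<omega>' \<longleftrightarrow> (\<forall>i<n. \<omega> i = \<omega>' i)"
  by (auto simp: list_eq_iff_nth_eq)

lemma pref_in_words: "\<omega> \<in> Sig m \<Longrightarrow> pref n \<omega> \<in> words m n"
  unfolding words_def pref_def Sig_def by fastforce

lemma take_pref: "k \<le> n \<Longrightarrow> take k (pref n \<omega>) = pref k \<omega>"
  by (auto simp: list_eq_iff_nth_eq)

lemma shift_pow: "(shift ^^ i) \<omega> = (\<lambda>k. \<omega> (k + i))"
  by (induction i arbitrary: \<omega>) (auto simp: shift_def)

lemma shift_pow_Sig: "\<omega> \<in> Sig m \<Longrightarrow> (shift ^^ i) \<omega> \<in> Sig m"
  by (simp add: shift_pow Sig_def)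

lemma shift_Sig: "\<omega> \<in> Sig m \<Longrightarrow> shift \<omega> \<in> Sig m"
  by (simp add: shift_def Sig_def)

lemma pref_append: "pref (n + k) \<omega> = pref n \<omega> @ pref k ((shift ^^ n) \<omega>)"
  by (auto simp: list_eq_iff_nth_eq nth_append shift_pow)

lemma in_cyl_pref: "\<omega> \<in> Sig m \<Longrightarrow> \<omega> \<in> cyl m (pref n \<omega>)"
  by (simp add: cyl_def)

text \<open>A basic open set of the product topology restricts only finitely many coordinates;
  \<open>K\<close> lies beyond all of them.\<close>

lemma open_agree:
  fixes U :: "(nat \<Rightarrow> nat) set"
  assumes "open U" "\<omega> \<in> U"
  obtains K where "\<And>\<omega>'. pref K \<omega>' = pref K \<omega> \<Longrightarrow> \<omega>' \<in> U"
proof -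
  have "openin (product_topology (\<lambda>_. euclidean) UNIV) U"
    using assms(1) by (simp add: open_fun_def)
  from product_topology_open_contains_basis[OF this assms(2)]
  obtain X where X: "\<omega> \<in> Pi\<^sub>E UNIV X" "finite {i. X i \<noteq> UNIV}" "Pi\<^sub>E UNIV X \<subseteq> U"
    by auto
  obtain K where K: "\<And>i. X i \<noteq> UNIV \<Longrightarrow> i < K"
    using X(2) finite_nat_set_iff_bounded by auto
  show thesis
  proof (rule that)
    fix \<omega>' :: "nat \<Rightarrow> nat" assume a: "pref K \<omega>' = pref K \<omega>"
    have "\<omega>' i \<in> X i" for i
      using a K[of i] X(1) by (cases "X i = UNIV") (auto simp: pref_eq_iff PiE_iff)
    then show "\<omega>' \<in> U" using X(3) by (auto simp: PiE_iff)
  qed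
qed

lemma open_pref_vimage: "open {\<omega>::nat \<Rightarrow> nat. pref n \<omega> \<in> S}"
proof -
  have "open {\<omega>::nat \<Rightarrow> nat. pref n \<omega> = w}" for w
  proof (cases "length w = n")
    case True
    have "{\<omega>::nat \<Rightarrow> nat. pref n \<omega> = w} = (\<Inter>i\<in>{..<n}. (\<lambda>\<omega>. \<omega> i) -` {w ! i})"
      using True by (auto simp: list_eq_iff_nth_eq)
    moreover have "open (\<Inter>i\<in>{..<n}. (\<lambda>\<omega>::nat \<Rightarrow> nat. \<omega> i) -` {w ! i})"
      by (intro open_INT ballI finite_lessThan open_vimage continuous_on_product_coordinates discrete_topology_class.open_discrete)
    ultimately show ?thesis by simp
  next
    case False
    then have "{\<omega>::nat \<Rightarrow> nat. pref n \<omega> = w} = {}" by auto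
    then show ?thesis by simp
  qed
  then have "open (\<Union>w\<in>S. {\<omega>::nat \<Rightarrow> nat. pref n \<omega> = w})" by blast
  also have "(\<Union>w\<in>S. {\<omega>::nat \<Rightarrow> nat. pref n \<omega> = w}) = {\<omega>. pref n \<omega> \<in> S}" by auto
  finally show ?thesis .
qed

lemma compact_Sig: "compact (Sig m)"
proof -
  have "Sig m = Pi\<^sub>E UNIV (\<lambda>_. {1..m})" by (auto simp: Sig_def)
  moreover have "compactin (product_topology (\<lambda>_::nat. euclidean) UNIV) (Pi\<^sub>E UNIV (\<lambda>_. {1..m}))"
    by (subst compactin_PiE) (auto simp: compactin_euclidean_iff intro: finite_imp_compact)
  ultimately show ?thesis
    by (metis compactin_euclidean_iff euclidean_product_topology)
qed

section \<open>Uniformly continuous functions on the symbol space\<close>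

text \<open>Uniform continuity for the metric in which small balls are cylinders. It is the only
  form in which continuity is used from here on: it gives the level at which a function may be
  replaced by one constant on cylinders.\<close>

definition UC :: "nat \<Rightarrow> ((nat \<Rightarrow> nat) \<Rightarrow> real) \<Rightarrow> bool" where
  "UC m \<phi> \<longleftrightarrow> (\<forall>e>0. \<exists>K. \<forall>\<omega>\<in>Sig m. \<forall>\<omega>'\<in>Sig m. pref K \<omega> = pref K \<omega>' \<longrightarrow> \<bar>\<phi> \<omega> - \<phi> \<omega>'\<bar> < e)"

lemma UC_obtain:
  assumes "UC m \<phi>" "e > 0"
  shows "\<exists>K. \<forall>\<omega> \<omega>'. \<omega> \<in> Sig m \<longrightarrow> \<omega>' \<in> Sig m \<longrightarrow> pref K \<omega> = pref K \<omega>' \<longrightarrow> \<bar>\<phi> \<omega> - \<phi> \<omega>'\<bar> < e"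
  using assms unfolding UC_def by blast

text \<open>Heine-Cantor: finitely many cylinders on which the function varies little cover the
  compact space, and the longest of their words gives a uniform length. The half of \<open>e\<close>
  is spent twice because two points are compared through the centre of a common cylinder.\<close>

lemma UC_continuous:
  assumes "continuous_on (Sig m) \<phi>"
  shows "UC m \<phi>"
  unfolding UC_def
proof (intro allI impI)
  fix e :: real assume e: "e > 0"
  have "\<exists>K. \<forall>\<omega>'\<in>Sig m. pref K \<omega>' = pref K \<omega> \<longrightarrow> \<bar>\<phi> \<omega>' - \<phi> \<omega>\<bar> < e / 2" if \<omega>: "\<omega> \<in> Sig m" for \<omega>
  proof -
    have "\<exists>A. open A \<and> A \<inter> Sig m = \<phi> -` ball (\<phi> \<omega>) (e/2) \<inter> Sig m"
      using assms continuous_on_open_invariant open_ball by blast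
    then obtain A where A: "open A" "A \<inter> Sig m = \<phi> -` ball (\<phi> \<omega>) (e/2) \<inter> Sig m" by auto
    have "\<omega> \<in> A" using A(2) \<omega> e by auto
    from open_agree[OF A(1) this] obtain K where K: "\<And>\<omega>'. pref K \<omega>' = pref K \<omega> \<Longrightarrow> \<omega>' \<in> A" by auto
    show ?thesis
    proof (intro exI[of _ K] ballI impI)
      fix \<omega>' assume "\<omega>' \<in> Sig m" "pref K \<omega>' = pref K \<omega>"
      with K A(2) have "\<omega>' \<in> \<phi> -` ball (\<phi> \<omega>) (e/2)" by blast
      then show "\<bar>\<phi> \<omega>' - \<phi> \<omega>\<bar> < e / 2" by (simp add: dist_real_def abs_minus_commute)
    qed
  qed
  then obtain K where K: "\<And>\<omega> \<omega>'. \<omega> \<in> Sig m \<Longrightarrow> \<omega>' \<in> Sig m \<Longrightarrow> pref (K \<omega>) \<omega>' = pref (K \<omega>) \<omega> \<Longrightarrow> \<bar>\<phi> \<omega>' - \<phi> \<omega>\<bar> < e / 2"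
    by metis
  define U where "U \<omega> = {\<omega>'. pref (K \<omega>) \<omega>' \<in> {pref (K \<omega>) \<omega>}}" for \<omega>
  have "Sig m \<subseteq> (\<Union>\<omega>\<in>Sig m. U \<omega>)" by (auto simp: U_def)
  moreover have "open (U \<omega>)" for \<omega> unfolding U_def by (rule open_pref_vimage)
  ultimately obtain F where F: "F \<subseteq> Sig m" "finite F" "Sig m \<subseteq> (\<Union>\<omega>\<in>F. U \<omega>)"
    using compactE_image[OF compact_Sig, of "Sig m" U] by metis
  define N where "N = Max (insert 0 (K ` F))"
  have N: "K \<omega> \<le> N" if "\<omega> \<in> F" for \<omega> unfolding N_def using that F(2) by auto
  show "\<exists>N. \<forall>\<omega>\<in>Sig m. \<forall>\<omega>'\<in>Sig m. pref N \<omega> = pref N \<omega>' \<longrightarrow> \<bar>\<phi> \<omega> - \<phi> \<omega>'\<bar> < e"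
  proof (intro exI ballI impI)
    fix \<omega> \<omega>' assume *: "\<omega> \<in> Sig m" "\<omega>' \<in> Sig m" "pref N \<omega> = pref N \<omega>'"
    obtain x where x: "x \<in> F" "pref (K x) \<omega> = pref (K x) x" using F(3) * by (auto simp: U_def)
    have "pref (K x) \<omega>' = pref (K x) x"
      using x N[OF x(1)] *(3) by (auto simp: pref_eq_iff)
    then have "\<bar>\<phi> \<omega>' - \<phi> x\<bar> < e / 2" "\<bar>\<phi> \<omega> - \<phi> x\<bar> < e / 2"
      using K x F(1) * by auto
    then show "\<bar>\<phi> \<omega> - \<phi> \<omega>'\<bar> < e" by linarith
  qed
qed

lemma UC_bounded:
  assumes "UC m \<phi>"
  obtains B where "B > 0" "\<And>\<omega>. \<omega> \<in> Sig m \<Longrightarrow> \<bar>\<phi> \<omega>\<bar> \<le> B"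
proof -
  obtain K where K: "\<And>\<omega> \<omega>'. \<omega> \<in> Sig m \<Longrightarrow> \<omega>' \<in> Sig m \<Longrightarrow> pref K \<omega> = pref K \<omega>' \<Longrightarrow> \<bar>\<phi> \<omega> - \<phi> \<omega>'\<bar> < 1"
    using UC_obtain[OF assms zero_less_one] by auto
  define pt where "pt w = (SOME \<omega>. \<omega> \<in> cyl m w)" for w
  \<comment> \<open>One sample value per word of length \<open>K\<close> suffices; the inserted 0
    keeps \<open>Max\<close> defined when there are no words.\<close>
  define B where "B = 1 + Max (insert 0 ((\<lambda>w. \<bar>\<phi> (pt w)\<bar>) ` words m K))"
  have "\<bar>\<phi> \<omega>\<bar> \<le> B" if \<omega>: "\<omega> \<in> Sig m" for \<omega>
  proof -
    have "pt (pref K \<omega>) \<in> cyl m (pref K \<omega>)" unfolding pt_def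
      using someI[of "\<lambda>x. x \<in> cyl m (pref K \<omega>)", OF in_cyl_pref[OF \<omega>]] .
    then have "\<bar>\<phi> \<omega> - \<phi> (pt (pref K \<omega>))\<bar> < 1"
      using K[OF \<omega>] by (auto simp: cyl_def)
    moreover have "\<bar>\<phi> (pt (pref K \<omega>))\<bar> \<le> B - 1" unfolding B_def
      using pref_in_words[OF \<omega>] by (simp add: Max_ge)
    ultimately show ?thesis by linarith
  qed
  moreover have "B > 0" unfolding B_def by (simp add: Max_ge add_pos_nonneg)
  ultimately show thesis using that by blast
qed

text \<open>The pattern of every comparison along two orbits with a common beginning: the term at
  time \<open>i\<close> is small while more than \<open>K\<close> common symbols remain ahead, and
  only the last \<open>K\<close> terms need the crude bound \<open>B\<close>.\<close>

lemma sum_le_early: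
  fixes d :: "nat \<Rightarrow> real"
  assumes "\<And>i. i < n - K \<Longrightarrow> d i \<le> e / 2" "\<And>i. i < n \<Longrightarrow> d i \<le> B"
    and "0 \<le> e" "0 \<le> B" "K * B \<le> n * (e / 2)"
  shows "(\<Sum>i<n. d i) \<le> n * e"
proof -
  have "(\<Sum>i<n. d i) \<le> (\<Sum>i<n. e / 2 + (if i \<in> {n - K..<n} then B else 0))"
  proof (rule sum_mono)
    fix i assume "i \<in> {..<n}"
    then show "d i \<le> e / 2 + (if i \<in> {n - K..<n} then B else 0)"
      using assms(1)[of i] assms(2)[of i] assms(3,4) by (cases "i < n - K") auto
  qed
  also have "\<dots> = n * (e / 2) + (\<Sum>i\<in>{..<n} \<inter> {n - K..<n}. B)"
    by (simp only: sum.distrib sum.inter_restrict[symmetric, OF finite_lessThan]) simp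
  also have "(\<Sum>i\<in>{..<n} \<inter> {n - K..<n}. B) \<le> K * B"
  proof -
    have "card ({..<n} \<inter> {n - K..<n}) \<le> card {n - K..<n}" by (rule card_mono) auto
    also have "\<dots> \<le> K" by simp
    finally show ?thesis using assms(4) by (simp add: mult_right_mono)
  qed
  finally show ?thesis using assms(5) by (simp add: mult.commute)
qed

text \<open>Mere continuity gives no summable variations, so Birkhoff sums on a cylinder agree only
  up to a small multiple of \<open>n\<close>, not up to a constant.\<close>

lemma UC_shift_sum:
  fixes e :: real
  assumes "UC m \<phi>" "e > 0"
  obtains N where "\<And>n \<omega> \<omega>'. n \<ge> N \<Longrightarrow> \<omega> \<in> Sig m \<Longrightarrow> \<omega>' \<in> Sig m \<Longrightarrow> pref n \<omega> = pref n \<omega>' \<Longrightarrow>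
     \<bar>(\<Sum>i<n. \<phi> ((shift ^^ i) \<omega>)) - (\<Sum>i<n. \<phi> ((shift ^^ i) \<omega>'))\<bar> \<le> n * e"
proof -
  obtain B where B: "B > 0" "\<And>\<omega>. \<omega> \<in> Sig m \<Longrightarrow> \<bar>\<phi> \<omega>\<bar> \<le> B" using UC_bounded[OF assms(1)] by auto
  obtain K where K: "\<And>\<omega> \<omega>'. \<omega> \<in> Sig m \<Longrightarrow> \<omega>' \<in> Sig m \<Longrightarrow> pref K \<omega> = pref K \<omega>' \<Longrightarrow> \<bar>\<phi> \<omega> - \<phi> \<omega>'\<bar> < e / 2"
    using UC_obtain[OF assms(1) half_gt_zero[OF assms(2)]] by auto
  obtain N :: nat where N: "real N > K * (2 * B) / (e / 2)" using reals_Archimedean2[of "K * (2 * B) / (e / 2)"] by blast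
  have "\<bar>(\<Sum>i<n. \<phi> ((shift ^^ i) \<omega>)) - (\<Sum>i<n. \<phi> ((shift ^^ i) \<omega>'))\<bar> \<le> n * e"
    if n: "n \<ge> N" and w: "\<omega> \<in> Sig m" "\<omega>' \<in> Sig m" "pref n \<omega> = pref n \<omega>'" for n \<omega> \<omega>'
  proof -
    let ?d = "\<lambda>i. \<bar>\<phi> ((shift ^^ i) \<omega>) - \<phi> ((shift ^^ i) \<omega>')\<bar>"
    have "\<bar>(\<Sum>i<n. \<phi> ((shift ^^ i) \<omega>)) - (\<Sum>i<n. \<phi> ((shift ^^ i) \<omega>'))\<bar> \<le> (\<Sum>i<n. ?d i)"
      unfolding sum_subtractf[symmetric] by (rule sum_abs)
    also have "\<dots> \<le> n * e"
    proof (rule sum_le_early[where K = K and B = "2 * B"])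
      fix i assume i: "i < n - K"
      have "pref K ((shift ^^ i) \<omega>) = pref K ((shift ^^ i) \<omega>')"
        using w(3) i by (auto simp: pref_eq_iff shift_pow)
      from K[OF shift_pow_Sig[OF w(1)] shift_pow_Sig[OF w(2)] this] show "?d i \<le> e / 2" by (rule less_imp_le)
    next
      fix i
      show "?d i \<le> 2 * B"
        using B(2)[OF shift_pow_Sig[OF w(1)], of i] B(2)[OF shift_pow_Sig[OF w(2)], of i] by linarith
    next
      have "K * (2 * B) / (e / 2) \<le> n" using N n by linarith
      then show "K * (2 * B) \<le> n * (e / 2)" using \<open>e > 0\<close> by (simp add: field_simps)
    qed (use B \<open>e > 0\<close> in auto)
    finally show ?thesis .
  qed
  then show thesis using that by blast
qed

section \<open>Entropy of invariant measures via cylinders\<close>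

lemma inv_measuresD:
  assumes "\<mu> \<in> inv_measures m"
  shows "prob_space \<mu>" "sets \<mu> = sets (SigM m)" "space \<mu> = Sig m"
    "\<And>A. A \<in> sets \<mu> \<Longrightarrow> measure \<mu> (shift -` A \<inter> space \<mu>) = measure \<mu> A"
proof -
  show "prob_space \<mu>" and s: "sets \<mu> = sets (SigM m)" using assms by (auto simp: inv_measures_def)
  show "space \<mu> = Sig m" using sets_eq_imp_space_eq[OF s] by (simp add: SigM_def space_restrict_space)
  show "\<And>A. A \<in> sets \<mu> \<Longrightarrow> measure \<mu> (shift -` A \<inter> space \<mu>) = measure \<mu> A"
    using assms unfolding inv_measures_def measure_def by simp
qed

lemma space_SigM [simp]: "space (SigM m) = Sig m"
  by (simp add: SigM_def space_restrict_space)

lemma pref_set_SigM: "{\<omega> \<in> Sig m. pref n \<omega> \<in> S} \<in> sets (SigM m)"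
proof -
  have "{\<omega> \<in> Sig m. pref n \<omega> \<in> S} = Sig m \<inter> {\<omega>. pref n \<omega> \<in> S}" by auto
  moreover have "{\<omega>. pref n \<omega> \<in> S} \<in> sets borel" using open_pref_vimage by simp
  ultimately show ?thesis unfolding SigM_def sets_restrict_space by blast
qed

lemma cyl_SigM: "cyl m w \<in> sets (SigM m)"
  using pref_set_SigM[of m "length w" "{w}"] by (simp add: cyl_def)

lemma measurable_shift: "shift \<in> measurable (SigM m) (SigM m)"
proof -
  have "continuous_on UNIV shift"
    unfolding shift_def
    by (rule continuous_on_coordinatewise_then_product) (rule continuous_on_product_coordinates)
  then have "shift \<in> borel_measurable borel"
    by (rule borel_measurable_continuous_onI)
  then show ?thesis unfolding SigM_def
    by (intro measurable_restrict_space3) (auto simp: shift_Sig)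
qed

lemma measurable_shift_pow: "shift ^^ i \<in> measurable (SigM m) (SigM m)"
proof (induction i)
  case (Suc i)
  then show ?case using measurable_comp[OF Suc measurable_shift] by (simp add: comp_def)
qed (simp add: id_def)

lemma inv_shift_pow:
  assumes "\<mu> \<in> inv_measures m" "A \<in> sets \<mu>"
  shows "measure \<mu> ((shift ^^ i) -` A \<inter> Sig m) = measure \<mu> A"
  using assms(2)
proof (induction i arbitrary: A)
  case 0
  then have "A \<subseteq> Sig m" using sets.sets_into_space inv_measuresD(3)[OF assms(1)] by blast
  then show ?case by (simp add: Int_absorb2)
next
  case (Suc i)
  note D = inv_measuresD[OF assms(1)]
  have "shift -` A \<inter> Sig m \<in> sets \<mu>"
    using measurable_sets[OF measurable_shift, of A m] Suc.prems D by simp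
  from Suc.IH[OF this] have "measure \<mu> ((shift ^^ i) -` (shift -` A \<inter> Sig m) \<inter> Sig m) = measure \<mu> A"
    using D(4)[OF Suc.prems] D(3) by simp
  moreover have "(shift ^^ i) -` (shift -` A \<inter> Sig m) \<inter> Sig m = (shift ^^ Suc i) -` A \<inter> Sig m"
    using shift_pow_Sig by auto
  ultimately show ?case by (simp add: comp_def)
qed

lemma simple_pref:
  assumes "sets M = sets (SigM m)"
  shows "simple_function M (pref n)"
proof -
  have sp: "space M = Sig m" using sets_eq_imp_space_eq[OF assms] by simp
  show ?thesis
  proof (unfold simple_function_def, intro conjI ballI)
    show "finite (pref n ` space M)"
      unfolding sp using finite_subset[of "pref n ` Sig m" "words m n"] pref_in_words by auto
    fix x assume "x \<in> pref n ` space M"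
    show "pref n -` {x} \<inter> space M \<in> sets M"
      unfolding sp assms using pref_set_SigM[of m n "{x}"] by (simp add: vimage_def Int_def conj_commute)
  qed
qed

lemma Hx_pref:
  assumes "sets M = sets (SigM m)"
  shows "Hx M (pref n) = Hn m (\<lambda>w. measure M (cyl m w)) n"
proof -
  have sp: "space M = Sig m" using sets_eq_imp_space_eq[OF assms] by simp
  have "Hx M (pref n) = (\<Sum>x\<in>words m n. eta (measure M (pref n -` {x} \<inter> space M)))"
    by (rule Hx_superset) (use sp pref_in_words in auto)
  also have "\<dots> = Hn m (\<lambda>w. measure M (cyl m w)) n"
    unfolding Hn_def sp by (intro sum.cong arg_cong[where f=eta] arg_cong[where f="measure M"])
      (auto simp: cyl_def words_def)
  finally show ?thesis .
qed

text \<open>If \<open>Y\<close> determines \<open>X\<close>, then \<open>X\<close> factors through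
  \<open>Y\<close> by a function obtained by choice on the fibres, and data processing
  applies.\<close>

lemma Hx_mono:
  assumes M: "prob_space M" and s: "simple_function M Y"
    and d: "\<And>w w'. w \<in> space M \<Longrightarrow> w' \<in> space M \<Longrightarrow> Y w = Y w' \<Longrightarrow> X w = X w'"
  shows "Hx M X \<le> Hx M Y"
proof -
  define h where "h y = X (SOME w. w \<in> space M \<and> Y w = y)" for y
  have h: "X w = h (Y w)" if "w \<in> space M" for w
  proof -
    have "(SOME v. v \<in> space M \<and> Y v = Y w) \<in> space M \<and> Y (SOME v. v \<in> space M \<and> Y v = Y w) = Y w"
      by (rule someI[of "\<lambda>v. v \<in> space M \<and> Y v = Y w" w]) (use that in simp)
    from d[OF conjunct1[OF this] that conjunct2[OF this]] show ?thesis by (simp add: h_def)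
  qed
  have "X ` space M = (\<lambda>w. h (Y w)) ` space M" using h by auto
  moreover have "X -` {x} \<inter> space M = (\<lambda>w. h (Y w)) -` {x} \<inter> space M" for x using h by auto
  ultimately have "Hx M X = Hx M (\<lambda>w. h (Y w))" unfolding Hx_def by simp
  then show ?thesis using Hx_compose_le[OF M s, of h] by simp
qed

lemma Hx_shift:
  assumes \<mu>: "\<mu> \<in> inv_measures m" and X: "simple_function \<mu> X"
  shows "Hx \<mu> (\<lambda>\<omega>. X ((shift ^^ i) \<omega>)) = Hx \<mu> X"
proof -
  note D = inv_measuresD[OF \<mu>]
  have "Hx \<mu> (\<lambda>\<omega>. X ((shift ^^ i) \<omega>)) = (\<Sum>x\<in>X ` space \<mu>. eta (measure \<mu> ((\<lambda>\<omega>. X ((shift ^^ i) \<omega>)) -` {x} \<inter> space \<mu>)))"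
    by (rule Hx_superset) (use X D(3) shift_pow_Sig in \<open>auto simp: simple_function_def\<close>)
  also have "\<dots> = Hx \<mu> X" unfolding Hx_def
  proof (intro sum.cong refl arg_cong[where f=eta])
    fix x
    assume "x \<in> X ` space \<mu>"
    then have A: "X -` {x} \<inter> space \<mu> \<in> sets \<mu>" using X by (auto simp: simple_function_def)
    have "(\<lambda>\<omega>. X ((shift ^^ i) \<omega>)) -` {x} \<inter> space \<mu> = (shift ^^ i) -` (X -` {x} \<inter> space \<mu>) \<inter> Sig m"
      using D(3) shift_pow_Sig by auto
    then show "measure \<mu> ((\<lambda>\<omega>. X ((shift ^^ i) \<omega>)) -` {x} \<inter> space \<mu>) = measure \<mu> (X -` {x} \<inter> space \<mu>)"
      using inv_shift_pow[OF \<mu> A] by simp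
  qed
  finally show ?thesis .
qed

lemma simple_shift:
  assumes \<mu>: "\<mu> \<in> inv_measures m" and X: "simple_function \<mu> X"
  shows "simple_function \<mu> (\<lambda>\<omega>. X ((shift ^^ i) \<omega>))"
proof (unfold simple_function_def, intro conjI ballI)
  note D = inv_measuresD[OF \<mu>]
  have sub: "(\<lambda>\<omega>. X ((shift ^^ i) \<omega>)) ` space \<mu> \<subseteq> X ` space \<mu>" using D(3) shift_pow_Sig by auto
  then show "finite ((\<lambda>\<omega>. X ((shift ^^ i) \<omega>)) ` space \<mu>)"
    using X finite_subset by (auto simp: simple_function_def)
  fix x assume "x \<in> (\<lambda>\<omega>. X ((shift ^^ i) \<omega>)) ` space \<mu>"
  then have "X -` {x} \<inter> space \<mu> \<in> sets \<mu>" using X sub by (auto simp: simple_function_def)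
  then have "(shift ^^ i) -` (X -` {x} \<inter> space \<mu>) \<inter> Sig m \<in> sets \<mu>"
    using measurable_sets[OF measurable_shift_pow, of "X -` {x} \<inter> space \<mu>" m i] D(2) by simp
  moreover have "(\<lambda>\<omega>. X ((shift ^^ i) \<omega>)) -` {x} \<inter> space \<mu> = (shift ^^ i) -` (X -` {x} \<inter> space \<mu>) \<inter> Sig m"
    using D(3) shift_pow_Sig by auto
  ultimately show "(\<lambda>\<omega>. X ((shift ^^ i) \<omega>)) -` {x} \<inter> space \<mu> \<in> sets \<mu>" by simp
qed

text \<open>The itinerary of a point with respect to \<open>X\<close>. For the labelling of a
  partition its fibres are the nonempty atoms of the \<open>n\<close>-fold join; for the zeroth
  coordinate it is \<open>pref n\<close>.\<close>

definition blk :: "((nat \<Rightarrow> nat) \<Rightarrow> 'b) \<Rightarrow> nat \<Rightarrow> (nat \<Rightarrow> nat) \<Rightarrow> 'b list" where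
  "blk X n \<omega> = map (\<lambda>i. X ((shift ^^ i) \<omega>)) [0..<n]"

lemma simple_blk:
  assumes "\<mu> \<in> inv_measures m" "simple_function \<mu> X"
  shows "simple_function \<mu> (blk X n)"
  unfolding blk_def by (rule simple_function_map) (rule simple_shift[OF assms])

lemma Hx_blk_subadd:
  assumes \<mu>: "\<mu> \<in> inv_measures m" and X: "simple_function \<mu> X"
  shows "Hx \<mu> (blk X (n + k)) \<le> Hx \<mu> (blk X n) + Hx \<mu> (blk X k)"
proof -
  note D = inv_measuresD[OF \<mu>]
  have e: "[0..<n + k] = [0..<n] @ [n..<n + k]" by (rule upt_add_eq_append) simp
  have "Hx \<mu> (blk X (n + k)) \<le> Hx \<mu> (blk X n) + Hx \<mu> (\<lambda>\<omega>. map (\<lambda>i. X ((shift ^^ i) \<omega>)) [n..<n + k])"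
    unfolding blk_def e using simple_shift[OF assms] by (intro Hx_map_append_le D(1)) auto
  also have "(\<lambda>\<omega>. map (\<lambda>i. X ((shift ^^ i) \<omega>)) [n..<n + k]) = (\<lambda>\<omega>. blk X k ((shift ^^ n) \<omega>))"
    by (auto simp: blk_def list_eq_iff_nth_eq shift_pow add.commute add.left_commute)
  also have "Hx \<mu> (\<lambda>\<omega>. blk X k ((shift ^^ n) \<omega>)) = Hx \<mu> (blk X k)"
    by (rule Hx_shift[OF \<mu> simple_blk[OF assms]])
  finally show ?thesis .
qed

lemma ent_blk:
  assumes "\<mu> \<in> inv_measures m" "simple_function \<mu> X"
  obtains L where "(\<lambda>n. Hx \<mu> (blk X n) / n) \<longlonglongrightarrow> L" "\<And>n. n \<ge> 1 \<Longrightarrow> L \<le> Hx \<mu> (blk X n) / n"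
  using fekete[of "\<lambda>n. Hx \<mu> (blk X n)"] Hx_blk_subadd[OF assms] Hx_nonneg[OF inv_measuresD(1)[OF assms(1)]]
  by metis

text \<open>A join may contain the empty set, which adds nothing to the entropy. Apart from it,
  attained values and fibres correspond one to one, so summing over sets and summing over values
  agree.\<close>

lemma part_entropy_eq_Hx:
  assumes "simple_function M F" "Q - {{}} = (\<lambda>x. F -` {x} \<inter> space M) ` F ` space M"
  shows "part_entropy M Q = Hx M F"
proof -
  have "finite (Q - {{}})" using assms by (simp add: simple_function_def)
  then have fin: "finite Q" by simp
  have "part_entropy M Q = (\<Sum>A\<in>Q. eta (measure M A))"
    by (simp add: part_entropy_def eta_def sum_negf)
  also have "\<dots> = (\<Sum>A\<in>Q - {{}}. eta (measure M A))"
    by (rule sum.mono_neutral_right[OF fin]) auto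
  also have "\<dots> = Hx M F" unfolding assms(2) Hx_def
    by (subst sum.reindex) (auto simp: inj_on_def)
  finally show ?thesis .
qed

section \<open>Finite partitions as finite-valued functions\<close>

definition part_label :: "'a set set \<Rightarrow> 'a \<Rightarrow> 'a set" where
  "part_label P x = (THE A. A \<in> P \<and> x \<in> A)"

lemma part_label:
  assumes "finite_meas_partition M P" "x \<in> space M"
  shows "part_label P x \<in> P" "x \<in> part_label P x" "A \<in> P \<Longrightarrow> x \<in> A \<Longrightarrow> part_label P x = A"
proof -
  have ex: "\<exists>A. A \<in> P \<and> x \<in> A"
    using assms by (auto simp: finite_meas_partition_def)
  have un: "A = B" if "A \<in> P \<and> x \<in> A" "B \<in> P \<and> x \<in> B" for A B
    using assms(1) that disjointD[of P A B] by (auto simp: finite_meas_partition_def)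
  from theI'[of "\<lambda>A. A \<in> P \<and> x \<in> A"] ex un
  have *: "part_label P x \<in> P \<and> x \<in> part_label P x" unfolding part_label_def by metis
  then show "part_label P x \<in> P" "x \<in> part_label P x" by auto
  show "part_label P x = A" if "A \<in> P" "x \<in> A"
    using un[OF *] that by simp
qed

lemma part_label_vimage:
  assumes "finite_meas_partition M P" "A \<in> P"
  shows "part_label P -` {A} \<inter> space M = A"
proof (intro equalityI subsetI)
  fix x assume "x \<in> part_label P -` {A} \<inter> space M"
  then show "x \<in> A" using part_label(2)[OF assms(1), of x] by simp
next
  fix x assume x: "x \<in> A"
  then have "x \<in> space M" using assms unfolding finite_meas_partition_def by blast
  then show "x \<in> part_label P -` {A} \<inter> space M"
    using part_label(3)[OF assms(1) _ assms(2) x] by simp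
qed

lemma simple_part_label:
  assumes "finite_meas_partition M P"
  shows "simple_function M (part_label P)"
proof (unfold simple_function_def, intro conjI ballI)
  have "part_label P ` space M \<subseteq> P" using part_label[OF assms] by auto
  then show "finite (part_label P ` space M)"
    using assms finite_subset[of _ P] unfolding finite_meas_partition_def by simp
  fix A assume "A \<in> part_label P ` space M"
  then have "A \<in> P" using part_label[OF assms] by auto
  then show "part_label P -` {A} \<inter> space M \<in> sets M"
    using part_label_vimage[OF assms] assms unfolding finite_meas_partition_def by auto
qed

lemma part_entropy_join:
  assumes \<mu>: "\<mu> \<in> inv_measures m" and P: "finite_meas_partition \<mu> P"
  shows "part_entropy \<mu> (join_part \<mu> P n) = Hx \<mu> (blk (part_label P) n)"
proof (rule part_entropy_eq_Hx)
  note D = inv_measuresD[OF \<mu>]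
  let ?X = "part_label P"
  show "simple_function \<mu> (blk ?X n)" by (rule simple_blk[OF \<mu> simple_part_label[OF P]])
  have X: "?X ((shift ^^ i) \<omega>) = A \<longleftrightarrow> (shift ^^ i) \<omega> \<in> A" if "\<omega> \<in> space \<mu>" "A \<in> P" for \<omega> A i
  proof -
    have sp: "(shift ^^ i) \<omega> \<in> space \<mu>" using that shift_pow_Sig D(3) by simp
    show ?thesis using part_label(2)[OF P sp] part_label(3)[OF P sp that(2)] by metis
  qed
  have XP: "?X ((shift ^^ i) \<omega>) \<in> P" if "\<omega> \<in> space \<mu>" for \<omega> i
    using part_label(1)[OF P, of "(shift ^^ i) \<omega>"] that shift_pow_Sig[of \<omega> m i] D(3) by simp
  have eq: "space \<mu> \<inter> (\<Inter>i<n. (shift ^^ i) -` c i) = {\<omega> \<in> space \<mu>. \<forall>i<n. ?X ((shift ^^ i) \<omega>) = c i}"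
    if c: "\<forall>i<n. c i \<in> P" for c
  proof -
    have "(\<forall>i<n. (shift ^^ i) \<omega> \<in> c i) = (\<forall>i<n. ?X ((shift ^^ i) \<omega>) = c i)" if "\<omega> \<in> space \<mu>" for \<omega>
      using X[OF that] c by metis
    then show ?thesis by auto
  qed
  show "join_part \<mu> P n - {{}} = (\<lambda>x. blk ?X n -` {x} \<inter> space \<mu>) ` blk ?X n ` space \<mu>"
  proof (intro equalityI subsetI)
    fix A assume A: "A \<in> join_part \<mu> P n - {{}}"
    then obtain c where c: "\<forall>i<n. c i \<in> P" "A = space \<mu> \<inter> (\<Inter>i<n. (shift ^^ i) -` c i)"
      by (auto simp: join_part_def)
    obtain \<omega> where "\<omega> \<in> A" using A by auto
    then have \<omega>: "\<omega> \<in> space \<mu>" "\<forall>i<n. ?X ((shift ^^ i) \<omega>) = c i" using c eq by auto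
    have "A = blk ?X n -` {blk ?X n \<omega>} \<inter> space \<mu>"
      unfolding c(2) eq[OF c(1)] using \<omega>(2) by (auto simp: blk_def)
    then show "A \<in> (\<lambda>x. blk ?X n -` {x} \<inter> space \<mu>) ` blk ?X n ` space \<mu>" using \<omega>(1) by blast
  next
    fix A assume "A \<in> (\<lambda>x. blk ?X n -` {x} \<inter> space \<mu>) ` blk ?X n ` space \<mu>"
    then obtain \<omega> where \<omega>: "\<omega> \<in> space \<mu>" "A = blk ?X n -` {blk ?X n \<omega>} \<inter> space \<mu>" by auto
    define c where "c i = ?X ((shift ^^ i) \<omega>)" for i
    have cP: "\<forall>i<n. c i \<in> P" using XP \<omega>(1) by (simp add: c_def)
    have "A = space \<mu> \<inter> (\<Inter>i<n. (shift ^^ i) -` c i)"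
      unfolding eq[OF cP] \<omega>(2) by (auto simp: blk_def c_def)
    then show "A \<in> join_part \<mu> P n - {{}}" using cP \<omega> by (auto simp: join_part_def)
  qed
qed

lemma ent_rel_eq_lim:
  assumes "\<mu> \<in> inv_measures m" "finite_meas_partition \<mu> P"
  shows "(\<lambda>n. Hx \<mu> (blk (part_label P) n) / n) \<longlonglongrightarrow> ent_rel \<mu> P"
proof -
  obtain L where L: "(\<lambda>n. Hx \<mu> (blk (part_label P) n) / n) \<longlonglongrightarrow> L"
    using ent_blk[OF assms(1) simple_part_label[OF assms(2)]] by metis
  then show ?thesis unfolding ent_rel_def part_entropy_join[OF assms] by (simp add: limI)
qed

text \<open>This is \<open>ln y \<le> y - 1\<close> at \<open>y = 1 / sqrt x\<close>. It settles
  continuity of \<open>eta\<close> at 0, where the product \<open>x * ln x\<close> is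
  indeterminate.\<close>

lemma eta_le_sqrt:
  assumes "0 \<le> x" "x \<le> 1"
  shows "eta x \<le> 2 * sqrt x"
proof (cases "x = 0")
  case False
  then have x: "x > 0" using assms by simp
  have "ln (1 / sqrt x) \<le> 1 / sqrt x - 1" by (rule ln_le_minus_one) (use x in simp)
  also have "\<dots> \<le> 1 / sqrt x" by simp
  finally have "- ln x / 2 \<le> 1 / sqrt x" using x by (simp add: ln_div ln_sqrt)
  then have "x * (- ln x / 2) \<le> x * (1 / sqrt x)" using x by (intro mult_left_mono) auto
  also have "x * (1 / sqrt x) = sqrt x" using x by (simp add: real_div_sqrt)
  finally show ?thesis by (simp add: eta_def)
qed simp

lemma continuous_on_eta: "continuous_on {0..1} eta"
  unfolding continuous_on
proof
  fix x :: real assume x: "x \<in> {0..1}"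
  show "(eta \<longlongrightarrow> eta x) (at x within {0..1})"
  proof (cases "x = 0")
    case False
    then have "isCont eta x" using x unfolding eta_def by (intro continuous_intros) auto
    then show ?thesis unfolding isCont_def using tendsto_within_subset by blast
  next
    case True
    have s: "((\<lambda>x. 2 * sqrt x) \<longlongrightarrow> 2 * sqrt 0) (at 0 within {0..1})"
      by (intro tendsto_intros)
    have "(eta \<longlongrightarrow> 0) (at 0 within {0..1})"
    proof (rule tendsto_sandwich[of "\<lambda>_. 0" eta _ "\<lambda>x. 2 * sqrt x"])
      show "\<forall>\<^sub>F n in at 0 within {0..1}. 0 \<le> eta n"
        unfolding eventually_at_filter by (rule always_eventually) (auto intro: eta_nonneg)
      show "\<forall>\<^sub>F n in at 0 within {0..1}. eta n \<le> 2 * sqrt n"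
        unfolding eventually_at_filter by (rule always_eventually) (auto intro: eta_le_sqrt)
    qed (use s in auto)
    then show ?thesis using True by simp
  qed
qed

text \<open>Continuity at 0 of the binary entropy function. The bound \<open>d\<close> depends on
  \<open>e\<close> alone, not on the measure or the set.\<close>

lemma Hx_ind_small:
  assumes e: "e > 0"
  obtains d where "d > 0" "\<And>M D. prob_space M \<Longrightarrow> D \<in> sets M \<Longrightarrow> measure M D < d \<Longrightarrow> Hx M (\<lambda>w. w \<in> D) \<le> e"
proof -
  let ?f = "\<lambda>x. eta x + eta (1 - x)"
  have "continuous_on {0..1} ?f"
    by (intro continuous_on_add continuous_on_eta continuous_on_compose2[OF continuous_on_eta] continuous_intros) auto
  then obtain d where d: "d > 0" "\<And>x. x \<in> {0..1} \<Longrightarrow> dist x 0 < d \<Longrightarrow> dist (?f x) (?f 0) < e"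
    unfolding continuous_on_iff using e by (metis atLeastAtMost_iff order_refl zero_le_one)
  have "Hx M (\<lambda>w. w \<in> D) \<le> e" if M: "prob_space M" and D: "D \<in> sets M" "measure M D < d" for M and D :: "'a set"
  proof -
    interpret prob_space M by (rule M)
    have sub: "D \<subseteq> space M" using D(1) by (rule sets.sets_into_space)
    have "Hx M (\<lambda>w. w \<in> D) = (\<Sum>x\<in>UNIV. eta (measure M ((\<lambda>w. w \<in> D) -` {x} \<inter> space M)))"
      by (rule Hx_superset) auto
    also have "\<dots> = eta (measure M ((\<lambda>w. w \<in> D) -` {True} \<inter> space M)) + eta (measure M ((\<lambda>w. w \<in> D) -` {False} \<inter> space M))"
      by (simp add: UNIV_bool)
    also have "(\<lambda>w. w \<in> D) -` {True} \<inter> space M = D" using sub by auto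
    also have "(\<lambda>w. w \<in> D) -` {False} \<inter> space M = space M - D" by auto
    also have "measure M (space M - D) = 1 - measure M D" using D(1) by (rule prob_compl)
    finally have *: "Hx M (\<lambda>w. w \<in> D) = ?f (measure M D)" .
    have "dist (?f (measure M D)) (?f 0) < e"
      by (rule d(2)) (use D(2) in \<open>auto simp: dist_real_def\<close>)
    then show ?thesis using * by (simp add: dist_real_def)
  qed
  then show thesis using that d(1) by blast
qed

text \<open>The sets that can be approximated in measure by sets depending on finitely many
  coordinates form a sigma-algebra containing the open sets. An open set is the increasing union of
  the cylinders of length \<open>k\<close> inside it; complements leave the symmetric difference
  unchanged; a countable union is first cut to a finite one.\<close>

lemma cylinder_approximation:
  assumes M: "prob_space M" and sM: "sets M = sets (SigM m)" and A: "A \<in> sets M" and e: "e > 0"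
  shows "\<exists>k S. measure M (sym_diff A {\<omega> \<in> Sig m. pref k \<omega> \<in> S}) < e"
proof -
  interpret prob_space M by (rule M)
  define C where "C k S = {\<omega> \<in> Sig m. pref k \<omega> \<in> S}" for k S
  have sp: "space M = Sig m" using sets_eq_imp_space_eq[OF sM] by simp
  have CM [simp, intro]: "C k S \<in> sets M" for k S unfolding C_def sM by (rule pref_set_SigM)
  have SM: "Sig m \<inter> B \<in> sets M" if "B \<in> sets borel" for B
    unfolding sM SigM_def sets_restrict_space using that by blast
  obtain B where B: "B \<in> sets borel" "A = Sig m \<inter> B"
    using A unfolding sM SigM_def sets_restrict_space by blast
  have "B \<in> sigma_sets UNIV {S. open S}" using B(1) by (simp add: borel_def)
  then have "\<forall>e>0. \<exists>k S. measure M (sym_diff (Sig m \<inter> B) (C k S)) < e"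
  proof (induction rule: sigma_sets.induct)
    case (Basic B)
    then have op: "open B" by simp
    let ?A = "Sig m \<inter> B"
    define S where "S k = {w. length w = k \<and> cyl m w \<subseteq> B}" for k
    have memC: "\<omega> \<in> C k (S k) \<longleftrightarrow> \<omega> \<in> Sig m \<and> cyl m (pref k \<omega>) \<subseteq> B" for \<omega> k
      by (auto simp: C_def S_def)
    have inc: "incseq (\<lambda>k. C k (S k))"
    proof (rule incseq_SucI, rule subsetI)
      fix k \<omega> assume "\<omega> \<in> C k (S k)"
      then have *: "\<omega> \<in> Sig m" "cyl m (pref k \<omega>) \<subseteq> B" by (simp_all add: memC)
      have "cyl m (pref (Suc k) \<omega>) \<subseteq> cyl m (pref k \<omega>)" by (auto simp: cyl_def pref_eq_iff)
      with * show "\<omega> \<in> C (Suc k) (S (Suc k))" unfolding memC by blast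
    qed
    have un: "(\<Union>k. C k (S k)) = ?A"
    proof (intro equalityI subsetI)
      fix \<omega> assume "\<omega> \<in> (\<Union>k. C k (S k))"
      then obtain k where "\<omega> \<in> Sig m" "cyl m (pref k \<omega>) \<subseteq> B" by (auto simp: memC)
      then show "\<omega> \<in> ?A" using in_cyl_pref by blast
    next
      fix \<omega> assume \<omega>: "\<omega> \<in> ?A"
      then obtain K where K: "\<And>\<omega>'. pref K \<omega>' = pref K \<omega> \<Longrightarrow> \<omega>' \<in> B" using open_agree[OF op] by blast
      have "cyl m (pref K \<omega>) \<subseteq> B" using K by (auto simp: cyl_def)
      then show "\<omega> \<in> (\<Union>k. C k (S k))" using \<omega> memC by blast
    qed
    have "(\<lambda>k. measure M (C k (S k))) \<longlonglongrightarrow> measure M (\<Union>k. C k (S k))"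
      by (rule finite_Lim_measure_incseq) (use inc in auto)
    then have lim: "(\<lambda>k. measure M (C k (S k))) \<longlonglongrightarrow> measure M ?A" unfolding un .
    show ?case
    proof (intro allI impI)
      fix e :: real assume "e > 0"
      from LIMSEQ_D[OF lim this] obtain k where k: "norm (measure M (C k (S k)) - measure M ?A) < e" by blast
      have sub: "C k (S k) \<subseteq> ?A" using un by blast
      then have "sym_diff ?A (C k (S k)) = ?A - C k (S k)" by blast
      moreover have "measure M (?A - C k (S k)) = measure M ?A - measure M (C k (S k))"
        by (rule finite_measure_Diff) (use sub op SM in auto)
      ultimately have "measure M (sym_diff ?A (C k (S k))) < e" using k by simp
      then show "\<exists>k S. measure M (sym_diff ?A (C k S)) < e" by blast
    qed
  next
    case Empty
    have "sym_diff (Sig m \<inter> {}) (C 0 {}) = {}" by (auto simp: C_def)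
    then show ?case by (metis measure_empty)
  next
    case (Compl B)
    have "sym_diff (Sig m \<inter> (UNIV - B)) (C k (- S)) = sym_diff (Sig m \<inter> B) (C k S)" for k S
      by (auto simp: C_def)
    then show ?case using Compl.IH by metis
  next
    case (Union B)
    let ?A = "\<lambda>i::nat. Sig m \<inter> B i"
    have Bm: "B i \<in> sets borel" for i using Union.hyps by (simp add: borel_def)
    have Am: "?A i \<in> sets M" for i by (rule SM[OF Bm])
    show ?case
    proof (intro allI impI)
      fix e :: real assume e: "e > 0"
      let ?U = "\<lambda>n. \<Union>i<n. ?A i"
      have Um: "?U n \<in> sets M" for n by (rule sets.finite_UN) (use Am in auto)
      have Vm: "(\<Union>i. ?A i) \<in> sets M" by (rule sets.countable_UN) (use Am in auto)
      have "incseq ?U" unfolding incseq_def by (intro allI impI UN_mono) auto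
      with Um have "(\<lambda>n. measure M (?U n)) \<longlonglongrightarrow> measure M (\<Union>n. ?U n)"
        by (intro finite_Lim_measure_incseq image_subsetI)
      moreover have "(\<Union>n. ?U n) = (\<Union>i. ?A i)" by auto
      ultimately have lim: "(\<lambda>n. measure M (?U n)) \<longlonglongrightarrow> measure M (\<Union>i. ?A i)" by simp
      obtain n where n: "norm (measure M (?U n) - measure M (\<Union>i. ?A i)) < e / 2"
        using LIMSEQ_D[OF lim half_gt_zero[OF e]] by blast
      have d1: "measure M ((\<Union>i. ?A i) - ?U n) < e / 2"
      proof -
        have "measure M ((\<Union>i. ?A i) - ?U n) = measure M (\<Union>i. ?A i) - measure M (?U n)"
          by (rule finite_measure_Diff[OF Vm Um]) blast
        then show ?thesis using n unfolding real_norm_def by linarith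
      qed
      \<comment> \<open>The errors of \<open>n\<close> approximations add up to at most
        \<open>e / 2\<close>; the other half is spent on the truncation. The summand 1 covers
        \<open>n = 0\<close>.\<close>
      have e': "e / (2 * (real n + 1)) > 0" using e by simp
      have "\<exists>k S. measure M (sym_diff (?A i) (C k S)) < e / (2 * (real n + 1))" for i
        using Union.IH[of i] e' by blast
      then obtain k S where kS: "\<And>i. measure M (sym_diff (?A i) (C (k i) (S i))) < e / (2 * (real n + 1))"
        by metis
      define K where "K = Max (insert 0 (k ` {..<n}))"
      have K: "k i \<le> K" if "i < n" for i unfolding K_def using that by simp
      \<comment> \<open>Approximations of different lengths \<open>k i\<close> are rewritten at the
        common length \<open>K\<close> by looking at initial segments only.\<close>
      define R where "R = {w. \<exists>i<n. take (k i) w \<in> S i}"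
      have CR: "C K R = (\<Union>i<n. C (k i) (S i))"
        using K by (auto simp: C_def R_def take_pref)
      let ?D = "\<lambda>i. sym_diff (?A i) (C (k i) (S i))"
      have Dm: "?D i \<in> sets M" for i using Am CM by (intro sets.Un sets.Diff)
      have DUm: "(\<Union>i<n. ?D i) \<in> sets M" by (rule sets.finite_UN) (use Dm in auto)
      have VUm: "(\<Union>i. ?A i) - ?U n \<in> sets M" using Vm Um by (rule sets.Diff)
      have "sym_diff (Sig m \<inter> (\<Union>i. B i)) (C K R) \<subseteq> ((\<Union>i. ?A i) - ?U n) \<union> (\<Union>i<n. ?D i)"
        unfolding CR by blast
      then have "measure M (sym_diff (Sig m \<inter> (\<Union>i. B i)) (C K R)) \<le> measure M (((\<Union>i. ?A i) - ?U n) \<union> (\<Union>i<n. ?D i))"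
        by (rule finite_measure_mono) (rule sets.Un[OF VUm DUm])
      also have "\<dots> \<le> measure M ((\<Union>i. ?A i) - ?U n) + measure M (\<Union>i<n. ?D i)"
        by (rule measure_Un_le[OF VUm DUm])
      also have "measure M (\<Union>i<n. ?D i) \<le> (\<Sum>i<n. measure M (?D i))"
        by (rule finite_measure_subadditive_finite) (use Dm in auto)
      also have "\<dots> \<le> (\<Sum>i<n. e / (2 * (real n + 1)))"
        by (rule sum_mono) (use kS less_imp_le in blast)
      also have "\<dots> \<le> e / 2" using e by (simp add: field_simps)
      finally have "measure M (sym_diff (Sig m \<inter> (\<Union>i. B i)) (C K R)) < e" using d1 by linarith
      then show "\<exists>k S. measure M (sym_diff (Sig m \<inter> (\<Union>i. B i)) (C k S)) < e" by blast
    qed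
  qed
  then show ?thesis using e B(2) unfolding C_def by blast
qed

definition law :: "nat \<Rightarrow> (nat \<Rightarrow> nat) measure \<Rightarrow> nat list \<Rightarrow> real" where
  "law m \<mu> w = measure \<mu> (cyl m w)"

lemma pref_blk: "pref n = blk (\<lambda>\<omega>. \<omega> 0) n"
  by (auto simp: fun_eq_iff pref_def blk_def shift_pow)

lemma simple_coord:
  assumes "sets M = sets (SigM m)"
  shows "simple_function M (\<lambda>\<omega>. \<omega> 0)"
  using simple_function_compose[OF simple_pref[OF assms, of 1], of hd] by (simp add: comp_def pref_def)

lemma Hx_pref_law:
  assumes "\<mu> \<in> inv_measures m"
  shows "Hx \<mu> (pref n) = Hn m (law m \<mu>) n"
  unfolding law_def[abs_def] by (rule Hx_pref[OF inv_measuresD(2)[OF assms]])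

lemma blk_cong:
  assumes "\<And>i. i < n \<Longrightarrow> X ((shift ^^ i) \<omega>) = Y ((shift ^^ i) \<omega>')"
  shows "blk X n \<omega> = blk Y n \<omega>'"
  using assms by (simp add: blk_def)

lemma blk_nth: "i < n \<Longrightarrow> blk X n \<omega> ! i = X ((shift ^^ i) \<omega>)"
  by (simp add: blk_def)

text \<open>The atom visited at time \<open>i\<close> can be read off from the symbols at times
  \<open>i\<close> to \<open>i + K - 1\<close> and the membership of the \<open>i\<close>-th iterate
  in the error sets \<open>E A\<close>. So \<open>n\<close> labels are determined by
  \<open>n + K\<close> symbols and \<open>n\<close> times \<open>N\<close> indicators; the
  \<open>K\<close> extra symbols cost a constant, and invariance makes the indicator costs
  independent of time.\<close>

lemma ent_rel_le:
  assumes \<mu>: "\<mu> \<in> inv_measures m" and P: "finite_meas_partition \<mu> P"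
    and L: "(\<lambda>n. Hn m (law m \<mu>) n / n) \<longlonglongrightarrow> L"
  shows "ent_rel \<mu> P \<le> L"
proof (rule field_le_epsilon)
  fix e :: real assume e: "e > 0"
  note D = inv_measuresD[OF \<mu>]
  interpret prob_space \<mu> by (rule D(1))
  let ?X = "part_label P"
  let ?H = "\<lambda>n. Hx \<mu> (pref n)"
  have "finite P" using P by (simp add: finite_meas_partition_def)
  then obtain Ps where Ps: "set Ps = P" "distinct Ps" using finite_distinct_list by blast
  define N where "N = length Ps"
  \<comment> \<open>There are \<open>N\<close> indicators per unit of time, so this share for each
    keeps the total at most \<open>e\<close> per symbol, also when \<open>N = 0\<close>.\<close>
  have e': "e / (real N + 1) > 0" using e by simp
  obtain d where d: "d > 0" "\<And>M D. prob_space M \<Longrightarrow> D \<in> sets M \<Longrightarrow> measure M D < d \<Longrightarrow> Hx (M :: (nat \<Rightarrow> nat) measure) (\<lambda>w. w \<in> D) \<le> e / (real N + 1)"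
    using Hx_ind_small[OF e'] by metis
  define C where "C k S = {\<omega> \<in> Sig m. pref k \<omega> \<in> S}" for k S
  have Pm: "A \<in> sets \<mu>" if "A \<in> P" for A using P that by (auto simp: finite_meas_partition_def)
  have "\<forall>A\<in>P. \<exists>k S. measure \<mu> (sym_diff A (C k S)) < d"
    unfolding C_def using cylinder_approximation[OF D(1,2) Pm d(1)] by simp
  then obtain k S where kS: "\<And>A. A \<in> P \<Longrightarrow> measure \<mu> (sym_diff A (C (k A) (S A))) < d" by metis
  define K where "K = Max (insert 0 (k ` P))"
  have K: "k A \<le> K" if "A \<in> P" for A unfolding K_def using that \<open>finite P\<close> by simp
  define E where "E A = sym_diff A (C (k A) (S A))" for A
  have Em: "E A \<in> sets \<mu>" if "A \<in> P" for A
    unfolding E_def C_def using Pm[OF that] pref_set_SigM D(2) by (intro sets.Un sets.Diff) auto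
  have simE: "simple_function \<mu> (\<lambda>\<omega>. \<omega> \<in> E A)" if "A \<in> P" for A
    unfolding simple_function_def
  proof (intro conjI ballI)
    show "finite ((\<lambda>\<omega>. \<omega> \<in> E A) ` space \<mu>)" by (rule finite_subset[of _ UNIV]) auto
    fix x
    have "(\<lambda>\<omega>. \<omega> \<in> E A) -` {x} \<inter> space \<mu> = (if x then E A \<inter> space \<mu> else space \<mu> - E A)" by auto
    then show "(\<lambda>\<omega>. \<omega> \<in> E A) -` {x} \<inter> space \<mu> \<in> sets \<mu>" using Em[OF that] by auto
  qed
  have bound: "Hx \<mu> (blk ?X n) \<le> ?H n + ?H K + n * e" for n
  proof -
    let ?is = "List.product [0..<n] Ps"
    let ?Z = "\<lambda>p \<omega>. (shift ^^ fst p) \<omega> \<in> E (snd p)"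
    have simZ: "simple_function \<mu> (?Z p)" if "p \<in> set ?is" for p
      using simple_shift[OF \<mu> simE, of "snd p" "fst p"] that Ps by auto
    have s1: "simple_function \<mu> (pref (n + K))" by (rule simple_pref[OF D(2)])
    have s2: "simple_function \<mu> (\<lambda>\<omega>. map (\<lambda>p. ?Z p \<omega>) ?is)" by (rule simple_function_map) (rule simZ)
    have "Hx \<mu> (blk ?X n) \<le> Hx \<mu> (\<lambda>\<omega>. (pref (n + K) \<omega>, map (\<lambda>p. ?Z p \<omega>) ?is))"
    proof (rule Hx_mono[OF D(1) simple_function_Pair[OF s1 s2]])
      fix \<omega> \<omega>' assume w: "\<omega> \<in> space \<mu>" "\<omega>' \<in> space \<mu>"
        and "(pref (n + K) \<omega>, map (\<lambda>p. ?Z p \<omega>) ?is) = (pref (n + K) \<omega>', map (\<lambda>p. ?Z p \<omega>') ?is)"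
      then have eq1: "pref (n + K) \<omega> = pref (n + K) \<omega>'" and eq2: "\<And>p. p \<in> set ?is \<Longrightarrow> ?Z p \<omega> = ?Z p \<omega>'" by auto
      show "blk ?X n \<omega> = blk ?X n \<omega>'"
      proof (rule blk_cong)
        fix i assume i: "i < n"
        let ?u = "(shift ^^ i) \<omega>" and ?v = "(shift ^^ i) \<omega>'"
        have uv: "?u \<in> Sig m" "?v \<in> Sig m" "?u \<in> space \<mu>" "?v \<in> space \<mu>" using w D(3) shift_pow_Sig by auto
        define A where "A = ?X ?u"
        have A: "A \<in> P" "?u \<in> A" unfolding A_def using part_label(1,2)[OF P uv(3)] by auto
        have "pref (k A) ?u = pref (k A) ?v"
          using eq1 K[OF A(1)] i by (auto simp: pref_eq_iff shift_pow)
        then have "?u \<in> C (k A) (S A) \<longleftrightarrow> ?v \<in> C (k A) (S A)" using uv by (simp add: C_def)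
        moreover have "?u \<in> E A \<longleftrightarrow> ?v \<in> E A" using eq2[of "(i, A)"] i A(1) Ps(1) by simp
        \<comment> \<open>\<open>A\<close> is the symmetric difference of its cylinder approximation
          and its error set, so membership in both decides membership in \<open>A\<close>.\<close>
        ultimately have "?v \<in> A" using A(2) unfolding E_def by blast
        then show "?X ?u = ?X ?v" using part_label(3)[OF P uv(4) A(1)] A_def by simp
      qed
    qed
    also have "\<dots> \<le> ?H (n + K) + Hx \<mu> (\<lambda>\<omega>. map (\<lambda>p. ?Z p \<omega>) ?is)"
      by (rule Hx_pair_le[OF D(1) s1 s2])
    also have "?H (n + K) \<le> ?H n + ?H K"
      unfolding pref_blk by (rule Hx_blk_subadd[OF \<mu> simple_coord[OF D(2)]])
    also have "Hx \<mu> (\<lambda>\<omega>. map (\<lambda>p. ?Z p \<omega>) ?is) \<le> (\<Sum>p\<leftarrow>?is. Hx \<mu> (?Z p))"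
      by (rule Hx_map_le_sum[OF D(1) simZ])
    also have "\<dots> \<le> (\<Sum>p\<leftarrow>?is. e / (real N + 1))"
    proof (rule sum_list_mono)
      fix p assume p: "p \<in> set ?is"
      then have sp: "snd p \<in> P" using Ps by auto
      have "Hx \<mu> (?Z p) = Hx \<mu> (\<lambda>\<omega>. \<omega> \<in> E (snd p))"
        using Hx_shift[OF \<mu> simE[OF sp], of "fst p"] by simp
      also have "\<dots> \<le> e / (real N + 1)"
        using d(2)[OF D(1) Em[OF sp]] kS[OF sp] by (simp add: E_def)
      finally show "Hx \<mu> (?Z p) \<le> e / (real N + 1)" .
    qed
    also have "\<dots> = n * (N * (e / (real N + 1)))" by (simp add: sum_list_triv N_def)
    also have "\<dots> \<le> n * e"
      by (rule mult_left_mono) (use e in \<open>auto simp: field_simps\<close>)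
    finally show ?thesis by simp
  qed
  have "ent_rel \<mu> P \<le> L + 0 + e"
  proof (rule LIMSEQ_le[OF ent_rel_eq_lim[OF \<mu> P]])
    have "(\<lambda>n. ?H K / real n) \<longlonglongrightarrow> 0" by (rule lim_const_over_n)
    then show "(\<lambda>n. Hn m (law m \<mu>) n / n + ?H K / n + e) \<longlonglongrightarrow> L + 0 + e"
      by (intro tendsto_add L tendsto_const)
    have "Hx \<mu> (blk ?X n) / n \<le> Hn m (law m \<mu>) n / n + ?H K / n + e" if "n \<ge> 1" for n :: nat
    proof -
      have "Hx \<mu> (blk ?X n) / n \<le> (?H n + ?H K + n * e) / n"
        by (rule divide_right_mono[OF bound]) simp
      also have "\<dots> = ?H n / n + ?H K / n + e" using that by (simp add: add_divide_distrib)
      finally show ?thesis unfolding Hx_pref_law[OF \<mu>] .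
    qed
    then show "\<exists>N. \<forall>n\<ge>N. Hx \<mu> (blk ?X n) / n \<le> Hn m (law m \<mu>) n / n + ?H K / n + e" by blast
  qed
  then show "ent_rel \<mu> P \<le> L + e" by simp
qed

lemma cyl1: "cyl m [a] = {\<omega> \<in> Sig m. \<omega> 0 = a}"
  by (auto simp: cyl_def pref_def)

text \<open>The partition by the first symbol has the same block entropies as the words, and
  \<open>ent_rel_le\<close> says that no finite partition exceeds it; the supremum is therefore a
  maximum. The lower bound on each \<open>Hn\<close> is the infimum property in
  \<open>fekete\<close>, and it is what makes blocks of one fixed length rich enough later.\<close>

lemma ks_entropy_cylinders:
  assumes \<mu>: "\<mu> \<in> inv_measures m"
  shows "(\<lambda>n. Hn m (law m \<mu>) n / n) \<longlonglongrightarrow> ks_entropy \<mu>"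
    and "n \<ge> 1 \<Longrightarrow> ks_entropy \<mu> \<le> Hn m (law m \<mu>) n / n"
proof -
  note D = inv_measuresD[OF \<mu>]
  obtain L where L: "(\<lambda>n. Hn m (law m \<mu>) n / n) \<longlonglongrightarrow> L" "\<And>n. n \<ge> 1 \<Longrightarrow> L \<le> Hn m (law m \<mu>) n / n"
    using ent_blk[OF \<mu> simple_coord[OF D(2)]] unfolding pref_blk[symmetric] Hx_pref_law[OF \<mu>] by metis
  define P where "P = (\<lambda>a. cyl m [a]) ` {1..m}"
  have P: "finite_meas_partition \<mu> P"
    unfolding finite_meas_partition_def
  proof (intro conjI)
    show "finite P" by (simp add: P_def)
    show "P \<subseteq> sets \<mu>" using cyl_SigM D(2) by (auto simp: P_def)
    show "disjoint P" by (rule disjointI) (auto simp: P_def cyl1)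
    show "\<Union> P = space \<mu>" unfolding D(3) by (auto simp: P_def cyl1 Sig_def)
  qed
  have lab: "part_label P \<omega> = cyl m [\<omega> 0]" if "\<omega> \<in> Sig m" for \<omega>
  proof (rule part_label(3)[OF P])
    show "\<omega> \<in> space \<mu>" "\<omega> \<in> cyl m [\<omega> 0]" using that D(3) by (auto simp: cyl1)
    show "cyl m [\<omega> 0] \<in> P" using that by (auto simp: P_def Sig_def)
  qed
  have labeq: "part_label P \<omega> = part_label P \<omega>' \<longleftrightarrow> \<omega> 0 = \<omega>' 0" if "\<omega> \<in> Sig m" "\<omega>' \<in> Sig m" for \<omega> \<omega>'
    using lab[OF that(1)] lab[OF that(2)] that by (auto simp: cyl1)
  have "Hx \<mu> (blk (part_label P) n) = Hx \<mu> (pref n)" for n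
  proof (rule antisym)
    show "Hx \<mu> (blk (part_label P) n) \<le> Hx \<mu> (pref n)"
    proof (rule Hx_mono[OF D(1) simple_pref[OF D(2)]])
      fix \<omega> \<omega>' assume "\<omega> \<in> space \<mu>" "\<omega>' \<in> space \<mu>" "pref n \<omega> = pref n \<omega>'"
      then show "blk (part_label P) n \<omega> = blk (part_label P) n \<omega>'"
        using D(3) by (intro blk_cong) (simp add: labeq shift_pow_Sig, simp add: shift_pow pref_eq_iff)
    qed
    show "Hx \<mu> (pref n) \<le> Hx \<mu> (blk (part_label P) n)"
    proof (rule Hx_mono[OF D(1) simple_blk[OF \<mu> simple_part_label[OF P]]])
      fix \<omega> \<omega>' assume w: "\<omega> \<in> space \<mu>" "\<omega>' \<in> space \<mu>" and eq: "blk (part_label P) n \<omega> = blk (part_label P) n \<omega>'"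
      show "pref n \<omega> = pref n \<omega>'" unfolding pref_eq_iff
      proof (intro allI impI)
        fix i assume i: "i < n"
        have "part_label P ((shift ^^ i) \<omega>) = part_label P ((shift ^^ i) \<omega>')"
          using arg_cong[OF eq, of "\<lambda>l. l ! i"] i by (simp add: blk_nth)
        then have "((shift ^^ i) \<omega>) 0 = ((shift ^^ i) \<omega>') 0"
          using labeq w D(3) shift_pow_Sig by auto
        then show "\<omega> i = \<omega>' i" by (simp add: shift_pow)
      qed
    qed
  qed
  then have "(\<lambda>n. Hn m (law m \<mu>) n / n) \<longlonglongrightarrow> ent_rel \<mu> P"
    using ent_rel_eq_lim[OF \<mu> P] by (simp add: Hx_pref_law[OF \<mu>])
  then have eqL: "ent_rel \<mu> P = L" using L(1) LIMSEQ_unique by blast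
  have "ks_entropy \<mu> = L" unfolding ks_entropy_def
    by (rule cSup_eq_maximum) (use P eqL ent_rel_le[OF \<mu> _ L(1)] in auto)
  then show "(\<lambda>n. Hn m (law m \<mu>) n / n) \<longlonglongrightarrow> ks_entropy \<mu>"
    and "n \<ge> 1 \<Longrightarrow> ks_entropy \<mu> \<le> Hn m (law m \<mu>) n / n" using L by auto
qed

lemma ks_entropy_ge:
  assumes "\<mu> \<in> inv_measures m" "\<And>n. n \<ge> 1 \<Longrightarrow> n * c \<le> Hn m (law m \<mu>) n"
  shows "c \<le> ks_entropy \<mu>"
proof (rule LIMSEQ_le_const[OF ks_entropy_cylinders(1)[OF assms(1)]])
  show "\<exists>N. \<forall>n\<ge>N. c \<le> Hn m (law m \<mu>) n / real n"
    using assms(2) by (intro exI[of _ 1]) (auto simp: field_simps)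
qed

lemma law_range:
  assumes "\<mu> \<in> inv_measures m"
  shows "0 \<le> law m \<mu> w" "law m \<mu> w \<le> 1"
  using prob_space.prob_le_1[OF inv_measuresD(1)[OF assms]] by (auto simp: law_def)

lemma ks_entropy_nonneg:
  assumes "\<mu> \<in> inv_measures m"
  shows "0 \<le> ks_entropy \<mu>"
  by (rule ks_entropy_ge[OF assms]) (auto simp: Hn_def intro!: sum_nonneg eta_nonneg law_range[OF assms])

section \<open>Cylinder laws and invariant measures\<close>

text \<open>A representative point of the cylinder of \<open>w\<close>; the padding symbol 1 belongs
  to the alphabet as soon as \<open>m \<ge> 1\<close>.\<close>

definition pt :: "nat list \<Rightarrow> nat \<Rightarrow> nat" where
  "pt w = (\<lambda>i. if i < length w then w ! i else 1)"

text \<open>Summing over an appended letter is Kolmogorov consistency, summing over a prepended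
  letter is shift invariance. Prescribing zero on words outside the alphabet makes a measure and its
  law match as functions on all lists.\<close>

definition is_law :: "nat \<Rightarrow> (nat list \<Rightarrow> real) \<Rightarrow> bool" where
  "is_law m p \<longleftrightarrow> (\<forall>w. 0 \<le> p w) \<and> p [] = 1 \<and> (\<forall>w. (\<Sum>a\<in>{1..m}. p (w @ [a])) = p w) \<and>
     (\<forall>w. (\<Sum>a\<in>{1..m}. p (a # w)) = p w) \<and> (\<forall>w. \<not> set w \<subseteq> {1..m} \<longrightarrow> p w = 0)"

definition csets :: "nat \<Rightarrow> nat \<Rightarrow> nat list set \<Rightarrow> (nat \<Rightarrow> nat) set" where
  "csets m k S = {\<omega> \<in> Sig m. pref k \<omega> \<in> S}"

lemma pref_pt [simp]: "length w = n \<Longrightarrow> pref n (pt w) = w"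
  by (auto simp: list_eq_iff_nth_eq pt_def)

lemma pt_Sig:
  assumes "w \<in> words m n" "m \<ge> 1"
  shows "pt w \<in> Sig m"
proof -
  have "w ! i \<in> {1..m}" if "i < length w" for i
    using assms(1) nth_mem[OF that] unfolding words_def by blast
  then show ?thesis using assms(2) by (auto simp: Sig_def pt_def)
qed

lemma words_Suc_right: "words m (Suc n) = (\<lambda>(w, a). w @ [a]) ` (words m n \<times> {1..m})"
proof (intro equalityI subsetI)
  fix w assume w: "w \<in> words m (Suc n)"
  then have ne: "w \<noteq> []" by (auto simp: words_def)
  then have "w = butlast w @ [last w]" by simp
  moreover have "butlast w \<in> words m n" using w by (auto simp: words_def dest: in_set_butlastD)
  moreover have "last w \<in> {1..m}" using w last_in_set[OF ne] by (auto simp: words_def)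
  ultimately show "w \<in> (\<lambda>(w, a). w @ [a]) ` (words m n \<times> {1..m})" by (auto intro!: image_eqI[of _ _ "(butlast w, last w)"])
qed (auto simp: words_def)

lemma sum_words_Suc_right: "(\<Sum>w\<in>words m (Suc n). F w) = (\<Sum>w\<in>words m n. \<Sum>a\<in>{1..m}. F (w @ [a]))"
proof -
  have "(\<Sum>w\<in>words m (Suc n). F w) = (\<Sum>(w, a)\<in>words m n \<times> {1..m}. F (w @ [a]))"
    unfolding words_Suc_right by (subst sum.reindex) (auto simp: inj_on_def case_prod_beta)
  then show ?thesis by (simp add: sum.cartesian_product[symmetric])
qed

lemma csets_sets: "csets m k S \<in> sets (SigM m)"
  unfolding csets_def by (rule pref_set_SigM)

lemma measure_csets:
  assumes "finite_measure M" "sets M = sets (SigM m)"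
  shows "measure M (csets m k S) = (\<Sum>w\<in>words m k \<inter> S. measure M (cyl m w))"
proof -
  interpret finite_measure M by fact
  have "csets m k S = (\<Union>w\<in>words m k \<inter> S. cyl m w)"
    using pref_in_words by (fastforce simp: csets_def cyl_def words_def)
  moreover have "disjoint_family_on (cyl m) (words m k \<inter> S)"
    by (auto simp: disjoint_family_on_def cyl_def words_def)
  ultimately show ?thesis
    using finite_measure_finite_Union[of "words m k \<inter> S" "cyl m"] cyl_SigM assms(2) by auto
qed

lemma SigM_generated: "sets (SigM m) = sigma_sets (Sig m) {csets m k S | k S. True}"
proof (intro equalityI subsetI)
  let ?E = "{csets m k S | k S. True}"
  fix A assume "A \<in> sets (SigM m)"
  then obtain B where B: "B \<in> sets borel" "A = Sig m \<inter> B"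
    unfolding SigM_def sets_restrict_space by blast
  have "B \<in> sigma_sets UNIV {S. open S}" using B(1) by (simp add: borel_def)
  then have "Sig m \<inter> B \<in> sigma_sets (Sig m) ?E"
  proof (induction rule: sigma_sets.induct)
    case (Basic B)
    then have op: "open B" by simp
    define S where "S k = {w. cyl m w \<subseteq> B}" for k :: nat
    have "Sig m \<inter> B = (\<Union>k. csets m k (S k))"
    proof (intro equalityI subsetI)
      fix \<omega> assume "\<omega> \<in> (\<Union>k. csets m k (S k))"
      then show "\<omega> \<in> Sig m \<inter> B" using in_cyl_pref by (auto simp: csets_def S_def)
    next
      fix \<omega> assume \<omega>: "\<omega> \<in> Sig m \<inter> B"
      then obtain K where K: "\<And>\<omega>'. pref K \<omega>' = pref K \<omega> \<Longrightarrow> \<omega>' \<in> B" using open_agree[OF op] by blast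
      have "cyl m (pref K \<omega>) \<subseteq> B" using K by (auto simp: cyl_def)
      then show "\<omega> \<in> (\<Union>k. csets m k (S k))" using \<omega> by (auto simp: csets_def S_def)
    qed
    moreover have "(\<Union>k. csets m k (S k)) \<in> sigma_sets (Sig m) ?E"
      by (rule sigma_sets.Union) (auto intro: sigma_sets.Basic)
    ultimately show ?case by simp
  next
    case Empty
    then show ?case by (simp add: sigma_sets.Empty)
  next
    case (Compl B)
    have "Sig m - Sig m \<inter> B \<in> sigma_sets (Sig m) ?E" by (rule sigma_sets.Compl[OF Compl.IH])
    moreover have "Sig m - Sig m \<inter> B = Sig m \<inter> (UNIV - B)" by auto
    ultimately show ?case by simp
  next
    case (Union B)
    have "(\<Union>i. Sig m \<inter> B i) \<in> sigma_sets (Sig m) ?E" by (rule sigma_sets.Union[OF Union.IH])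
    moreover have "(\<Union>i. Sig m \<inter> B i) = Sig m \<inter> (\<Union>i. B i)" by auto
    ultimately show ?case by simp
  qed
  then show "A \<in> sigma_sets (Sig m) ?E" using B(2) by simp
next
  fix A assume "A \<in> sigma_sets (Sig m) {csets m k S | k S. True}"
  then show "A \<in> sets (SigM m)"
  proof (induction rule: sigma_sets.induct)
    case (Basic a)
    then show ?case using csets_sets by auto
  next
    case (Compl a)
    then show ?case using sets.compl_sets[of a "SigM m"] by simp
  qed auto
qed

text \<open>Sets depending on finitely many coordinates form a generator stable under intersection:
  conditions at lengths \<open>k\<close> and \<open>l\<close> become one condition at length
  \<open>max k l\<close>.\<close>

lemma SigM_eqI:
  assumes M: "prob_space M" "sets M = sets (SigM m)" and N: "prob_space N" "sets N = sets (SigM m)"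
    and eq: "\<And>w. set w \<subseteq> {1..m} \<Longrightarrow> measure M (cyl m w) = measure N (cyl m w)"
  shows "M = N"
proof -
  interpret M: prob_space M by fact
  interpret N: prob_space N by fact
  let ?E = "{csets m k S | k S. True}"
  have eqC: "measure M (csets m k S) = measure N (csets m k S)" for k S
    using measure_csets[OF M.finite_measure_axioms M(2)] measure_csets[OF N.finite_measure_axioms N(2)]
    by (auto intro!: sum.cong eq simp: words_def)
  show ?thesis
  proof (rule measure_eqI_generator_eq[where E="?E" and \<Omega>="Sig m" and A="\<lambda>_. Sig m"])
    show "Int_stable ?E"
    proof (rule Int_stableI)
      fix a b assume "a \<in> ?E" "b \<in> ?E"
      then obtain k S l R where ab: "a = csets m k S" "b = csets m l R" by auto
      have "a \<inter> b = csets m (max k l) {w. take k w \<in> S \<and> take l w \<in> R}"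
        unfolding ab by (auto simp: csets_def take_pref)
      then show "a \<inter> b \<in> ?E" by blast
    qed
    show "?E \<subseteq> Pow (Sig m)" by (auto simp: csets_def)
    show "emeasure M X = emeasure N X" if "X \<in> ?E" for X
      using that eqC by (auto simp: M.emeasure_eq_measure N.emeasure_eq_measure)
    show "sets M = sigma_sets (Sig m) ?E" "sets N = sigma_sets (Sig m) ?E"
      using M N SigM_generated by auto
    have "Sig m = csets m 0 UNIV" by (simp add: csets_def)
    then show "range (\<lambda>_::nat. Sig m) \<subseteq> ?E" by blast
  qed auto
qed

section \<open>From invariant measures to laws\<close>

lemma pref_Suc: "pref (Suc n) \<omega> = \<omega> 0 # pref n (shift \<omega>)"
  using pref_append[of 1 n \<omega>] by (simp add: pref_def)

lemma pref_Suc_right: "pref (Suc n) \<omega> = pref n \<omega> @ [\<omega> n]"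
  by (simp add: pref_def)

lemma shift_vimage_cyl: "shift -` cyl m w \<inter> Sig m = (\<Union>a\<in>{1..m}. cyl m (a # w))"
proof (intro set_eqI iffI)
  fix \<omega> assume \<omega>: "\<omega> \<in> shift -` cyl m w \<inter> Sig m"
  then have "\<omega> \<in> cyl m (\<omega> 0 # w)" by (simp add: cyl_def pref_Suc)
  moreover have "\<omega> 0 \<in> {1..m}" using \<omega> unfolding Sig_def by blast
  ultimately show "\<omega> \<in> (\<Union>a\<in>{1..m}. cyl m (a # w))" by blast
next
  fix \<omega> assume "\<omega> \<in> (\<Union>a\<in>{1..m}. cyl m (a # w))"
  then obtain a where "\<omega> \<in> cyl m (a # w)" by blast
  then show "\<omega> \<in> shift -` cyl m w \<inter> Sig m" by (simp add: cyl_def pref_Suc shift_Sig)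
qed

lemma cyl_append: "cyl m w = (\<Union>a\<in>{1..m}. cyl m (w @ [a]))"
proof (intro set_eqI iffI)
  fix \<omega> assume \<omega>: "\<omega> \<in> cyl m w"
  then have "\<omega> \<in> cyl m (w @ [\<omega> (length w)])" by (simp add: cyl_def pref_Suc_right)
  moreover have "\<omega> (length w) \<in> {1..m}" using \<omega> unfolding Sig_def cyl_def by blast
  ultimately show "\<omega> \<in> (\<Union>a\<in>{1..m}. cyl m (w @ [a]))" by blast
next
  fix \<omega> assume "\<omega> \<in> (\<Union>a\<in>{1..m}. cyl m (w @ [a]))"
  then obtain a where "\<omega> \<in> cyl m (w @ [a])" by blast
  then show "\<omega> \<in> cyl m w" by (simp add: cyl_def pref_Suc_right)
qed

lemma cyl_empty: "\<not> set w \<subseteq> {1..m} \<Longrightarrow> cyl m w = {}"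
  using pref_in_words[of _ m "length w"] unfolding cyl_def words_def by force

lemma law_is_law:
  assumes \<mu>: "\<mu> \<in> inv_measures m"
  shows "is_law m (law m \<mu>)"
proof -
  note D = inv_measuresD[OF \<mu>]
  interpret prob_space \<mu> by (rule D(1))
  have cm: "cyl m w \<in> sets \<mu>" for w using cyl_SigM D(2) by simp
  show ?thesis unfolding is_law_def law_def
  proof (intro conjI allI impI)
    fix w :: "nat list"
    show "0 \<le> measure \<mu> (cyl m w)" by simp
    show "measure \<mu> (cyl m []) = 1" using prob_space D(3) by (simp add: cyl_def pref_def)
    have "disjoint_family_on (\<lambda>a. cyl m (w @ [a])) {1..m}"
      by (auto simp: disjoint_family_on_def cyl_def)
    then have "measure \<mu> (\<Union>a\<in>{1..m}. cyl m (w @ [a])) = (\<Sum>a\<in>{1..m}. measure \<mu> (cyl m (w @ [a])))"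
      by (intro finite_measure_finite_Union) (use cm in auto)
    from this[unfolded cyl_append[symmetric]]
    show "(\<Sum>a\<in>{1..m}. measure \<mu> (cyl m (w @ [a]))) = measure \<mu> (cyl m w)" by simp
    have "shift -` cyl m w \<inter> space \<mu> = (\<Union>a\<in>{1..m}. cyl m (a # w))"
      unfolding D(3) by (rule shift_vimage_cyl)
    moreover have "disjoint_family_on (\<lambda>a. cyl m (a # w)) {1..m}"
      by (auto simp: disjoint_family_on_def cyl_def)
    then have "measure \<mu> (\<Union>a\<in>{1..m}. cyl m (a # w)) = (\<Sum>a\<in>{1..m}. measure \<mu> (cyl m (a # w)))"
      by (intro finite_measure_finite_Union) (use cm in auto)
    ultimately show "(\<Sum>a\<in>{1..m}. measure \<mu> (cyl m (a # w))) = measure \<mu> (cyl m w)"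
      using D(4)[OF cm[of w]] by simp
    assume "\<not> set w \<subseteq> {1..m}"
    then have "cyl m w = {}" by (rule cyl_empty)
    then show "measure \<mu> (cyl m w) = 0" by simp
  qed
qed

lemma is_law_m: "is_law m p \<Longrightarrow> m \<ge> 1"
proof (rule ccontr)
  assume p: "is_law m p" and "\<not> m \<ge> 1"
  then have "(\<Sum>a\<in>{1..m}. p ([] @ [a])) = 0" by simp
  moreover have "(\<Sum>a\<in>{1..m}. p ([] @ [a])) = p []" "p [] = 1" using p unfolding is_law_def by blast+
  ultimately show False by simp
qed

lemma is_law_sum:
  assumes "is_law m p"
  shows "(\<Sum>w\<in>words m n. p w) = 1"
proof (induction n)
  case 0
  then show ?case using assms by (simp add: is_law_def)
next
  case (Suc n)
  then show ?case using assms by (simp add: sum_words_Suc_right is_law_def)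
qed

lemma is_law_extend:
  assumes "is_law m p"
  shows "(\<Sum>v\<in>words m k. p (w @ v)) = p w"
proof (induction k)
  case (Suc k)
  have r: "(\<Sum>a\<in>{1..m}. p (v @ [a])) = p v" for v using assms by (simp add: is_law_def)
  have "(\<Sum>v\<in>words m (Suc k). p (w @ v)) = (\<Sum>v\<in>words m k. \<Sum>a\<in>{1..m}. p ((w @ v) @ [a]))"
    by (simp add: sum_words_Suc_right)
  also have "\<dots> = (\<Sum>v\<in>words m k. p (w @ v))" by (simp only: r)
  finally show ?case using Suc by simp
qed simp

section \<open>From laws to invariant measures: Kolmogorov extension\<close>

lemma take_words_point_measure:
  assumes p: "is_law m p" and nk: "n \<le> k"
  shows "distr (point_measure (words m k) (\<lambda>w. ennreal (p w))) (count_space (words m n)) (take n)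
    = point_measure (words m n) (\<lambda>w. ennreal (p w))"
proof (rule measure_eqI)
  let ?P = "\<lambda>k. point_measure (words m k) (\<lambda>w. ennreal (p w))"
  show "sets (distr (?P k) (count_space (words m n)) (take n)) = sets (?P n)" by (simp add: sets_point_measure)
  fix A assume "A \<in> sets (distr (?P k) (count_space (words m n)) (take n))"
  then have A: "A \<subseteq> words m n" by simp
  have tk: "take n \<in> words m k \<rightarrow> words m n" using nk by (auto simp: words_def dest: in_set_takeD)
  have pn: "0 \<le> p w" for w using p by (simp add: is_law_def)
  have "emeasure (distr (?P k) (count_space (words m n)) (take n)) A = emeasure (?P k) (take n -` A \<inter> words m k)"
    by (subst emeasure_distr) (use A tk in \<open>auto simp: space_point_measure measurable_point_measure_eq1\<close>)
  also have "\<dots> = (\<Sum>w\<in>take n -` A \<inter> words m k. ennreal (p w))"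
    by (rule emeasure_point_measure_finite) auto
  also have "take n -` A \<inter> words m k = (\<lambda>(u, v). u @ v) ` (A \<times> words m (k - n))"
  proof (intro equalityI subsetI)
    fix w assume w: "w \<in> take n -` A \<inter> words m k"
    then have "w = (\<lambda>(u, v). u @ v) (take n w, drop n w)" "(take n w, drop n w) \<in> A \<times> words m (k - n)"
      by (auto simp: words_def dest: in_set_dropD)
    then show "w \<in> (\<lambda>(u, v). u @ v) ` (A \<times> words m (k - n))" by (rule image_eqI)
  next
    fix w assume "w \<in> (\<lambda>(u, v). u @ v) ` (A \<times> words m (k - n))"
    then obtain u v where "w = u @ v" "u \<in> A" "v \<in> words m (k - n)" by auto
    moreover from this have "u \<in> words m n" using A by auto
    ultimately show "w \<in> take n -` A \<inter> words m k" using nk by (auto simp: words_def)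
  qed
  also have "(\<Sum>w\<in>\<dots>. ennreal (p w)) = (\<Sum>(u, v)\<in>A \<times> words m (k - n). ennreal (p (u @ v)))"
  proof (subst sum.reindex)
    show "inj_on (\<lambda>(u, v). u @ v) (A \<times> words m (k - n))"
    proof (rule inj_onI, clarify)
      fix a b c d assume "a \<in> A" "c \<in> A" "a @ b = c @ d"
      moreover from this have "length a = length c" using A by (auto simp: words_def)
      ultimately show "a = c \<and> b = d" by simp
    qed
  qed (simp add: case_prod_beta)
  also have "\<dots> = (\<Sum>u\<in>A. \<Sum>v\<in>words m (k - n). ennreal (p (u @ v)))"
    by (simp add: sum.cartesian_product)
  also have "\<dots> = (\<Sum>u\<in>A. ennreal (p u))"
    using pn is_law_extend[OF p] by (simp add: sum_ennreal)
  also have "\<dots> = emeasure (?P n) A"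
    using A finite_subset[OF A] by (intro emeasure_point_measure_finite[symmetric]) auto
  finally show "emeasure (distr (?P k) (count_space (words m n)) (take n)) A = emeasure (?P n) A" .
qed

text \<open>Joint distribution of the letters at the positions \<open>J\<close>, with letters read
  as real numbers so that the projective limit is taken over the real line. Words of length
  \<open>n\<close> serve for every \<open>J\<close> below \<open>n\<close>.\<close>

definition real_marginal :: "nat \<Rightarrow> (nat list \<Rightarrow> real) \<Rightarrow> nat \<Rightarrow> nat set \<Rightarrow> (nat \<Rightarrow> real) measure" where
  "real_marginal m p n J = distr (point_measure (words m n) (\<lambda>w. ennreal (p w))) (PiM J (\<lambda>_. borel)) (\<lambda>w. \<lambda>j\<in>J. real (w ! j))"

lemma real_marginal_measurable:
  "(\<lambda>w. \<lambda>j\<in>J. real (w ! j)) \<in> measurable (point_measure (words m n) (\<lambda>w. ennreal (p w))) (PiM J (\<lambda>_. borel))"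
  by (auto simp: measurable_point_measure_eq1 space_PiM PiE_def)

lemma real_marginal_eq:
  assumes p: "is_law m p" and nk: "n \<le> k" and J: "J \<subseteq> {..<n}"
  shows "real_marginal m p k J = real_marginal m p n J"
proof -
  let ?g = "\<lambda>w::nat list. \<lambda>j\<in>J. real (w ! j)"
  have tk: "take n \<in> words m k \<rightarrow> words m n" using nk by (auto simp: words_def dest: in_set_takeD)
  have "real_marginal m p n J = distr (distr (point_measure (words m k) (\<lambda>w. ennreal (p w))) (count_space (words m n)) (take n)) (PiM J (\<lambda>_. borel)) ?g"
    unfolding real_marginal_def take_words_point_measure[OF p nk] ..
  also have "\<dots> = distr (point_measure (words m k) (\<lambda>w. ennreal (p w))) (PiM J (\<lambda>_. borel)) (?g \<circ> take n)"
    by (rule distr_distr) (use tk in \<open>auto simp: measurable_point_measure_eq1 space_PiM PiE_def\<close>)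
  also have "\<dots> = real_marginal m p k J" unfolding real_marginal_def
  proof (rule distr_cong)
    fix w :: "nat list"
    have "(take n w) ! j = w ! j" if "j \<in> J" for j using J that by (intro nth_take) auto
    then show "(?g \<circ> take n) w = ?g w" by (auto simp: fun_eq_iff)
  qed auto
  finally show ?thesis ..
qed

text \<open>The marginal for a finite \<open>J\<close> is read off from the shortest words that
  reach all of \<open>J\<close>; longer words give the same by right consistency. The projective
  limit on real sequences is carried back to the symbol space by rounding.\<close>

lemma law_exists:
  assumes p: "is_law m p"
  shows "\<exists>\<mu>\<in>inv_measures m. law m \<mu> = p"
proof -
  define P where "P J = real_marginal m p (LEAST n. J \<subseteq> {..<n}) J" for J
  have least: "J \<subseteq> {..<(LEAST n. J \<subseteq> {..<n})}" if fin: "finite J" for J :: "nat set"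
  proof (rule LeastI_ex)
    obtain k where "\<forall>n\<in>J. n < k" using fin finite_nat_set_iff_bounded by auto
    then show "\<exists>n. J \<subseteq> {..<n}" by (intro exI[of _ k]) auto
  qed
  have Peq: "P J = real_marginal m p n J" if "J \<subseteq> {..<n}" for J n
    unfolding P_def
  proof (rule real_marginal_eq[OF p, symmetric])
    have "finite J" using that finite_subset by blast
    then show "J \<subseteq> {..<(LEAST n. J \<subseteq> {..<n})}" by (rule least)
    show "(LEAST n. J \<subseteq> {..<n}) \<le> n" using that by (rule Least_le)
  qed
  have pn: "0 \<le> p w" for w using p by (simp add: is_law_def)
  have Pprob: "prob_space (point_measure (words m n) (\<lambda>w. ennreal (p w)))" for n
  proof (rule prob_spaceI)
    show "emeasure (point_measure (words m n) (\<lambda>w. ennreal (p w))) (space (point_measure (words m n) (\<lambda>w. ennreal (p w)))) = 1"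
      using is_law_sum[OF p, of n] pn by (simp add: space_point_measure emeasure_point_measure_finite sum_ennreal)
  qed
  interpret polish_projective UNIV P
  proof (intro polish_projective.intro projective_family.intro)
    fix J H :: "nat set" assume JH: "J \<subseteq> H" "finite H"
    obtain n where n: "H \<subseteq> {..<n}" using least[OF JH(2)] by blast
    show "P J = distr (P H) (PiM J (\<lambda>_. borel)) (\<lambda>f. restrict f J)"
    proof -
      have "distr (P H) (PiM J (\<lambda>_. borel)) (\<lambda>f. restrict f J) =
        distr (point_measure (words m n) (\<lambda>w. ennreal (p w))) (PiM J (\<lambda>_. borel)) ((\<lambda>f. restrict f J) \<circ> (\<lambda>w. \<lambda>j\<in>H. real (w ! j)))"
        unfolding Peq[OF n] real_marginal_def
        by (rule distr_distr[OF measurable_restrict_subset[OF JH(1)] real_marginal_measurable])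
      also have "(\<lambda>f. restrict f J) \<circ> (\<lambda>w. \<lambda>j\<in>H. real (w ! j)) = (\<lambda>w. \<lambda>j\<in>J. real (w ! j))"
        using JH(1) by (auto simp: fun_eq_iff restrict_def)
      finally have *: "distr (P H) (PiM J (\<lambda>_. borel)) (\<lambda>f. restrict f J) = real_marginal m p n J"
        unfolding real_marginal_def .
      have "J \<subseteq> {..<n}" using n JH(1) by blast
      from Peq[OF this] show ?thesis unfolding * .
    qed
  next
    fix J :: "nat set" assume "finite J"
    show "prob_space (P J)" unfolding P_def real_marginal_def
      by (rule prob_space.prob_space_distr[OF Pprob real_marginal_measurable])
  qed
  \<comment> \<open>Reals that are not sent to a letter go to the default letter 1, so that
    \<open>G\<close> takes every real sequence into \<open>Sig m\<close>, not only almost every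
    one.\<close>
  define h where "h x = (if nat \<lfloor>x\<rfloor> \<in> {1..m} then nat \<lfloor>x\<rfloor> else 1)" for x :: real
  define G where "G f = (\<lambda>k::nat. h (f k))" for f
  have m1: "m \<ge> 1" by (rule is_law_m[OF p])
  have hm: "h \<in> borel_measurable borel"
    unfolding h_def by measurable
  have GS: "G f \<in> Sig m" for f using m1 by (auto simp: G_def h_def Sig_def)
  have "G \<in> measurable (PiM UNIV (\<lambda>_. borel)) (PiM UNIV (\<lambda>_. borel))"
    unfolding G_def using hm by (intro measurable_PiM_single') (auto simp: space_PiM)
  then have Gm: "G \<in> measurable lim (SigM m)"
    unfolding SigM_def
    by (intro measurable_restrict_space2) (use GS in \<open>auto simp: sets_PiM_equal_borel cong: measurable_cong_sets\<close>)
  define \<mu> where "\<mu> = distr lim (SigM m) G"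
  have \<mu>: "prob_space \<mu>" "sets \<mu> = sets (SigM m)" unfolding \<mu>_def
    by (rule P.prob_space_distr[OF Gm]) simp
  have law: "measure \<mu> (cyl m w) = p w" if w: "w \<in> words m n" for w n
  proof -
    define X where "X = {g \<in> space (PiM {..<n} (\<lambda>_. borel :: real measure)). \<forall>j\<in>{..<n}. h (g j) = w ! j}"
    have Xm: "X \<in> sets (PiM {..<n} (\<lambda>_. borel))"
      unfolding X_def
    proof (rule sets.sets_Collect_finite_All)
      fix j assume "j \<in> {..<n}"
      then have "(\<lambda>g. h (g j)) \<in> borel_measurable (PiM {..<n} (\<lambda>_. borel))"
        using hm by (intro measurable_compose[OF measurable_component_singleton]) auto
      then have "(\<lambda>g. h (g j)) -` {w ! j} \<inter> space (PiM {..<n} (\<lambda>_. borel)) \<in> sets (PiM {..<n} (\<lambda>_. borel))"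
        by (rule measurable_sets) simp
      then show "{g \<in> space (PiM {..<n} (\<lambda>_. borel)). h (g j) = w ! j} \<in> sets (PiM {..<n} (\<lambda>_. borel))"
        by (simp add: vimage_def Int_def conj_commute)
    qed auto
    have lw: "length w = n" using w by (simp add: words_def)
    have hr: "h (real a) = a" if "a \<in> {1..m}" for a using that by (simp add: h_def)
    have hv: "h (real (v ! j)) = v ! j" if "v \<in> words m n" "j < n" for v j
    proof (rule hr)
      show "v ! j \<in> {1..m}" using that nth_mem[of j v] unfolding words_def by blast
    qed
    have "measure \<mu> (cyl m w) = measure lim (G -` cyl m w \<inter> space lim)"
      unfolding \<mu>_def by (rule measure_distr[OF Gm cyl_SigM])
    also have "G -` cyl m w \<inter> space lim = prod_emb UNIV (\<lambda>_. borel) {..<n} X"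
      using GS lw by (auto simp: prod_emb_def X_def cyl_def G_def list_eq_iff_nth_eq space_PiM)
    also have "measure lim \<dots> = measure (P {..<n}) X" by (rule measure_lim_emb) (use Xm in auto)
    also have "\<dots> = measure (point_measure (words m n) (\<lambda>w. ennreal (p w))) ((\<lambda>w. \<lambda>j\<in>{..<n}. real (w ! j)) -` X \<inter> words m n)"
      unfolding Peq[OF subset_refl] real_marginal_def
      by (subst measure_distr[OF real_marginal_measurable Xm]) (simp add: space_point_measure)
    also have "(\<lambda>w. \<lambda>j\<in>{..<n}. real (w ! j)) -` X \<inter> words m n = {w}"
      using hv w by (auto simp: X_def space_PiM PiE_def list_eq_iff_nth_eq words_def)
    also have "measure (point_measure (words m n) (\<lambda>w. ennreal (p w))) {w} = p w"
      using w pn by (simp add: measure_def emeasure_point_measure_finite)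
    finally show ?thesis .
  qed
  have lawall: "law m \<mu> w = p w" for w
  proof (cases "set w \<subseteq> {1..m}")
    case True
    then show ?thesis using law[of w "length w"] by (simp add: law_def words_def)
  next
    case False
    then have "cyl m w = {}" by (rule cyl_empty)
    then show ?thesis using False p by (simp add: law_def is_law_def)
  qed
  have shm: "shift \<in> measurable \<mu> (SigM m)" using measurable_shift \<mu>(2) by (simp cong: measurable_cong_sets)
  have sp: "space \<mu> = Sig m" using sets_eq_imp_space_eq[OF \<mu>(2)] by simp
  \<comment> \<open>Left consistency is invariance on cylinders, and measures that agree on
    cylinders are equal.\<close>
  have inv: "distr \<mu> (SigM m) shift = \<mu>"
  proof (rule SigM_eqI)
    show "prob_space (distr \<mu> (SigM m) shift)" by (rule prob_space.prob_space_distr[OF \<mu>(1) shm])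
    fix w :: "nat list" assume w: "set w \<subseteq> {1..m}"
    interpret M: prob_space \<mu> by (rule \<mu>(1))
    have "measure (distr \<mu> (SigM m) shift) (cyl m w) = measure \<mu> (shift -` cyl m w \<inter> space \<mu>)"
      by (rule measure_distr[OF shm cyl_SigM])
    also have "shift -` cyl m w \<inter> space \<mu> = (\<Union>a\<in>{1..m}. cyl m (a # w))"
      unfolding sp by (rule shift_vimage_cyl)
    also have "measure \<mu> \<dots> = (\<Sum>a\<in>{1..m}. measure \<mu> (cyl m (a # w)))"
    proof (rule M.finite_measure_finite_Union)
      show "disjoint_family_on (\<lambda>a. cyl m (a # w)) {1..m}" by (auto simp: disjoint_family_on_def cyl_def)
    qed (use cyl_SigM \<mu>(2) in auto)
    also have "\<dots> = measure \<mu> (cyl m w)" using lawall p by (simp add: law_def is_law_def)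
    finally show "measure (distr \<mu> (SigM m) shift) (cyl m w) = measure \<mu> (cyl m w)" .
  qed (use \<mu> in auto)
  have "\<mu> \<in> inv_measures m" unfolding inv_measures_def
  proof (intro CollectI conjI ballI \<mu>)
    fix A assume A: "A \<in> sets \<mu>"
    have "emeasure \<mu> A = emeasure (distr \<mu> (SigM m) shift) A" unfolding inv ..
    also have "\<dots> = emeasure \<mu> (shift -` A \<inter> space \<mu>)"
      by (rule emeasure_distr[OF shm]) (use A \<mu>(2) in simp)
    finally show "emeasure \<mu> (shift -` A \<inter> space \<mu>) = emeasure \<mu> A" ..
  qed
  then show ?thesis using lawall by (auto simp: fun_eq_iff)
qed

section \<open>Integrals as limits of cylinder sums, and limits of laws\<close>

definition cyl_sum :: "nat \<Rightarrow> (nat list \<Rightarrow> real) \<Rightarrow> ((nat \<Rightarrow> nat) \<Rightarrow> real) \<Rightarrow> nat \<Rightarrow> real" where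
  "cyl_sum m p \<phi> K = (\<Sum>w\<in>words m K. p w * \<phi> (pt w))"

lemma UC_pt:
  assumes "UC m \<phi>" "\<omega> \<in> Sig m" "m \<ge> 1"
  shows "(\<lambda>K. \<phi> (pt (pref K \<omega>))) \<longlonglongrightarrow> \<phi> \<omega>"
proof (rule LIMSEQ_I)
  fix e :: real assume "e > 0"
  from UC_obtain[OF assms(1) this] obtain K where
    K: "\<And>\<omega> \<omega>'. \<omega> \<in> Sig m \<Longrightarrow> \<omega>' \<in> Sig m \<Longrightarrow> pref K \<omega> = pref K \<omega>' \<Longrightarrow> \<bar>\<phi> \<omega> - \<phi> \<omega>'\<bar> < e" by auto
  have "norm (\<phi> (pt (pref n \<omega>)) - \<phi> \<omega>) < e" if "n \<ge> K" for n
  proof -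
    have "pref K (pt (pref n \<omega>)) = pref K \<omega>" using that by (auto simp: pref_eq_iff pt_def)
    moreover have "pt (pref n \<omega>) \<in> Sig m" by (rule pt_Sig[OF pref_in_words[OF assms(2)] assms(3)])
    ultimately show ?thesis using K assms(2) by simp
  qed
  then show "\<exists>no. \<forall>n\<ge>no. norm (\<phi> (pt (pref n \<omega>)) - \<phi> \<omega>) < e" by blast
qed

lemma UC_measurable:
  assumes "UC m \<phi>" "m \<ge> 1" "sets M = sets (SigM m)"
  shows "\<phi> \<in> borel_measurable M"
proof (rule borel_measurable_LIMSEQ_real)
  have sp: "space M = Sig m" using sets_eq_imp_space_eq[OF assms(3)] by simp
  show "(\<lambda>K. \<phi> (pt (pref K \<omega>))) \<longlonglongrightarrow> \<phi> \<omega>" if "\<omega> \<in> space M" for \<omega>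
    using UC_pt[OF assms(1) _ assms(2)] that sp by simp
  fix K
  show "(\<lambda>\<omega>. \<phi> (pt (pref K \<omega>))) \<in> borel_measurable M"
    using borel_measurable_simple_function[OF simple_function_compose[OF simple_pref[OF assms(3), of K], of "\<lambda>w. \<phi> (pt w)"]]
    by (simp add: comp_def)
qed

lemma UC_integrable:
  assumes "UC m \<phi>" "m \<ge> 1" "sets M = sets (SigM m)" "prob_space M"
  shows "integrable M \<phi>"
proof -
  interpret prob_space M by fact
  have sp: "space M = Sig m" using sets_eq_imp_space_eq[OF assms(3)] by simp
  obtain B where B: "\<And>\<omega>. \<omega> \<in> Sig m \<Longrightarrow> \<bar>\<phi> \<omega>\<bar> \<le> B" using UC_bounded[OF assms(1)] by auto
  show ?thesis
  proof (rule integrable_const_bound[of _ B])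
    show "AE x in M. norm (\<phi> x) \<le> B" by (rule AE_I2) (use B sp in auto)
    show "\<phi> \<in> borel_measurable M" by (rule UC_measurable[OF assms(1-3)])
  qed
qed

text \<open>The cylinder sum is the integral of the function that is constant on cylinders of length
  \<open>K\<close> with the values at the points \<open>pt w\<close>; the integrand differs from it
  by at most \<open>e\<close> everywhere.\<close>

lemma integral_cyl_sum:
  assumes \<mu>: "\<mu> \<in> inv_measures m" and \<phi>: "UC m \<phi>" and m: "m \<ge> 1"
    and K: "\<And>\<omega> \<omega>'. \<omega> \<in> Sig m \<Longrightarrow> \<omega>' \<in> Sig m \<Longrightarrow> pref K \<omega> = pref K \<omega>' \<Longrightarrow> \<bar>\<phi> \<omega> - \<phi> \<omega>'\<bar> \<le> e"
  shows "\<bar>integral\<^sup>L \<mu> \<phi> - cyl_sum m (law m \<mu>) \<phi> K\<bar> \<le> e"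
proof -
  note D = inv_measuresD[OF \<mu>]
  interpret prob_space \<mu> by (rule D(1))
  have cm: "cyl m w \<in> sets \<mu>" for w using cyl_SigM D(2) by simp
  let ?g = "\<lambda>\<omega>. \<Sum>w\<in>words m K. indicator (cyl m w) \<omega> * \<phi> (pt w)"
  have g: "?g \<omega> = \<phi> (pt (pref K \<omega>))" if "\<omega> \<in> Sig m" for \<omega>
  proof -
    have "?g \<omega> = (\<Sum>w\<in>words m K. if w = pref K \<omega> then \<phi> (pt w) else 0)"
      using that by (intro sum.cong refl) (auto simp: cyl_def words_def indicator_def)
    also have "\<dots> = \<phi> (pt (pref K \<omega>))" using pref_in_words[OF that] by simp
    finally show ?thesis .
  qed
  have gi: "integrable \<mu> ?g" using cm by (intro Bochner_Integration.integrable_sum integrable_mult_left integrable_real_indicator) (auto simp: emeasure_eq_measure)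
  have gI: "integral\<^sup>L \<mu> ?g = cyl_sum m (law m \<mu>) \<phi> K"
    using cm by (subst Bochner_Integration.integral_sum)
      (auto simp: cyl_sum_def law_def emeasure_eq_measure intro!: integrable_real_indicator)
  have \<phi>i: "integrable \<mu> \<phi>" by (rule UC_integrable[OF \<phi> m D(2,1)])
  have "\<bar>integral\<^sup>L \<mu> \<phi> - integral\<^sup>L \<mu> ?g\<bar> = \<bar>\<integral>\<omega>. \<phi> \<omega> - ?g \<omega> \<partial>\<mu>\<bar>"
    using \<phi>i gi by simp
  also have "\<dots> \<le> (\<integral>\<omega>. \<bar>\<phi> \<omega> - ?g \<omega>\<bar> \<partial>\<mu>)" by (rule integral_abs_bound)
  also have "\<dots> \<le> (\<integral>\<omega>. e \<partial>\<mu>)"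
  proof (rule integral_mono)
    show "integrable \<mu> (\<lambda>\<omega>. \<bar>\<phi> \<omega> - ?g \<omega>\<bar>)" using \<phi>i gi by (intro integrable_abs Bochner_Integration.integrable_diff)
    show "\<bar>\<phi> \<omega> - ?g \<omega>\<bar> \<le> e" if "\<omega> \<in> space \<mu>" for \<omega>
    proof -
      have \<omega>: "\<omega> \<in> Sig m" using that D(3) by simp
      show ?thesis unfolding g[OF \<omega>]
        by (rule K[OF \<omega> pt_Sig[OF pref_in_words[OF \<omega>] m]]) simp
    qed
  qed simp
  also have "\<dots> = e" using prob_space by simp
  finally show ?thesis unfolding gI .
qed

text \<open>Tychonoff's theorem for a product of unit intervals indexed by the countable set of
  words. It plays the role of weak compactness of the probability measures.\<close>

lemma laws_compact:
  fixes q :: "nat \<Rightarrow> nat list \<Rightarrow> real"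
  assumes "\<And>k w. 0 \<le> q k w" "\<And>k w. q k w \<le> 1"
  obtains r p where "strict_mono r" "\<And>w. (\<lambda>k. q (r k) w) \<longlonglongrightarrow> p w"
proof -
  have "compactin (product_topology (\<lambda>_::nat list. euclidean) UNIV) (Pi\<^sub>E UNIV (\<lambda>_. {0..1::real}))"
    by (subst compactin_PiE) (auto simp: compactin_euclidean_iff)
  then have "compact (Pi\<^sub>E (UNIV :: nat list set) (\<lambda>_. {0..1::real}))"
    by (simp only: euclidean_product_topology compactin_euclidean_iff)
  then have sc: "seq_compact (Pi\<^sub>E (UNIV :: nat list set) (\<lambda>_. {0..1::real}))"
    by (rule compact_imp_seq_compact)
  have "\<forall>k. q k \<in> Pi\<^sub>E UNIV (\<lambda>_. {0..1})" using assms by auto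
  then obtain p r where r: "strict_mono r" "(q \<circ> r) \<longlonglongrightarrow> p"
    using seq_compactE[OF sc] by blast
  have "(\<lambda>k. q (r k) w) \<longlonglongrightarrow> p w" for w
  proof -
    have "(\<lambda>k. (q \<circ> r) k w) \<longlonglongrightarrow> p w"
      by (rule continuous_on_tendsto_compose[OF continuous_on_product_coordinates r(2)]) auto
    then show ?thesis by (simp add: comp_def)
  qed
  then show thesis using that r(1) by blast
qed

text \<open>Only the left identity may fail along the sequence, by a defect \<open>c k\<close> that
  tends to 0. Time averages of finite orbit pieces satisfy the remaining identities exactly.\<close>

lemma limit_is_law:
  assumes lim: "\<And>w. (\<lambda>k. q k w) \<longlonglongrightarrow> p w"
    and nn: "\<And>k w. 0 \<le> q k w" and nil: "\<And>k. q k [] = 1"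
    and right: "\<And>k w. (\<Sum>a\<in>{1..m}. q k (w @ [a])) = q k w"
    and left: "\<And>k w. \<bar>(\<Sum>a\<in>{1..m}. q k (a # w)) - q k w\<bar> \<le> c k" and c: "c \<longlonglongrightarrow> 0"
    and bad: "\<And>k w. \<not> set w \<subseteq> {1..m} \<Longrightarrow> q k w = 0"
  shows "is_law m p"
  unfolding is_law_def
proof (intro conjI allI impI)
  fix w
  show "0 \<le> p w" by (rule LIMSEQ_le_const[OF lim]) (use nn in auto)
  show "p [] = 1" using lim[of "[]"] nil by (simp add: LIMSEQ_const_iff)
  have "(\<lambda>k. \<Sum>a\<in>{1..m}. q k (w @ [a])) \<longlonglongrightarrow> (\<Sum>a\<in>{1..m}. p (w @ [a]))" by (intro tendsto_sum lim)
  then show "(\<Sum>a\<in>{1..m}. p (w @ [a])) = p w" unfolding right using lim LIMSEQ_unique by blast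
  have "(\<lambda>k. (\<Sum>a\<in>{1..m}. q k (a # w)) - q k w) \<longlonglongrightarrow> (\<Sum>a\<in>{1..m}. p (a # w)) - p w"
    by (intro tendsto_diff tendsto_sum lim)
  moreover have "(\<lambda>k. (\<Sum>a\<in>{1..m}. q k (a # w)) - q k w) \<longlonglongrightarrow> 0"
    by (rule Lim_null_comparison[OF _ c]) (use left in auto)
  ultimately have "(\<Sum>a\<in>{1..m}. p (a # w)) - p w = 0" using LIMSEQ_unique by blast
  then show "(\<Sum>a\<in>{1..m}. p (a # w)) = p w" by simp
  assume "\<not> set w \<subseteq> {1..m}"
  then show "p w = 0" using lim[of w] bad by (simp add: LIMSEQ_const_iff)
qed

text \<open>\<open>J\<close> is any sequence of numbers that the cylinder sums of \<open>q k\<close>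
  approximate with the modulus of continuity of \<open>\<phi>\<close>, uniformly in
  \<open>k\<close>. This covers integrals of invariant measures and weighted averages of Birkhoff
  sums at once.\<close>

lemma integral_limit:
  assumes \<mu>: "\<mu> \<in> inv_measures m" and \<phi>: "UC m \<phi>" and m: "m \<ge> 1"
    and lim: "\<And>w. (\<lambda>k. q k w) \<longlonglongrightarrow> law m \<mu> w"
    and J: "\<And>K e k. (\<And>\<omega> \<omega>'. \<omega> \<in> Sig m \<Longrightarrow> \<omega>' \<in> Sig m \<Longrightarrow> pref K \<omega> = pref K \<omega>' \<Longrightarrow> \<bar>\<phi> \<omega> - \<phi> \<omega>'\<bar> \<le> e) \<Longrightarrow>
        \<bar>J k - cyl_sum m (q k) \<phi> K\<bar> \<le> e"
  shows "J \<longlonglongrightarrow> integral\<^sup>L \<mu> \<phi>"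
proof (rule LIMSEQ_I)
  fix e :: real assume e: "e > 0"
  then have e3: "e / 3 > 0" by simp
  from UC_obtain[OF \<phi> e3] obtain K where
    K': "\<And>\<omega> \<omega>'. \<omega> \<in> Sig m \<Longrightarrow> \<omega>' \<in> Sig m \<Longrightarrow> pref K \<omega> = pref K \<omega>' \<Longrightarrow> \<bar>\<phi> \<omega> - \<phi> \<omega>'\<bar> < e / 3" by auto
  have K: "\<bar>\<phi> \<omega> - \<phi> \<omega>'\<bar> \<le> e / 3" if "\<omega> \<in> Sig m" "\<omega>' \<in> Sig m" "pref K \<omega> = pref K \<omega>'" for \<omega> \<omega>'
    using K'[OF that] by simp
  have "(\<lambda>k. cyl_sum m (q k) \<phi> K) \<longlonglongrightarrow> cyl_sum m (law m \<mu>) \<phi> K"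
    unfolding cyl_sum_def by (intro tendsto_intros lim)
  from LIMSEQ_D[OF this e3] obtain N where
    N: "\<And>k. k \<ge> N \<Longrightarrow> norm (cyl_sum m (q k) \<phi> K - cyl_sum m (law m \<mu>) \<phi> K) < e / 3" by blast
  have "norm (J k - integral\<^sup>L \<mu> \<phi>) < e" if "k \<ge> N" for k
    using J[of K "e / 3" k, OF K] integral_cyl_sum[OF \<mu> \<phi> m, of K "e / 3", OF K] N[OF that]
    unfolding real_norm_def by linarith
  then show "\<exists>no. \<forall>n\<ge>no. norm (J n - integral\<^sup>L \<mu> \<phi>) < e" by blast
qed

lemma Hn_limit:
  assumes lim: "\<And>w. (\<lambda>k. q k w) \<longlonglongrightarrow> p w" and "\<And>k w. 0 \<le> q k w" "\<And>k w. q k w \<le> 1"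
  shows "(\<lambda>k. Hn m (q k) n) \<longlonglongrightarrow> Hn m p n"
  unfolding Hn_def
proof (rule tendsto_sum)
  fix w
  have "p w \<in> {0..1}"
    using LIMSEQ_le_const[OF lim[of w], of 0] LIMSEQ_le_const2[OF lim[of w], of 1] assms by auto
  then show "(\<lambda>k. eta (q k w)) \<longlonglongrightarrow> eta (p w)"
    by (intro continuous_on_tendsto_compose[OF continuous_on_eta lim]) (use assms in auto)
qed

text \<open>The right side is the tangent line of \<open>eta\<close> at \<open>y\<close>, so this is
  concavity.\<close>

lemma eta_tangent:
  assumes "0 \<le> x" "0 < y"
  shows "eta x \<le> - x * ln y + (y - x)"
proof (cases "x = 0")
  case False
  then have x: "x > 0" using assms by simp
  have "ln (y / x) \<le> y / x - 1" by (rule ln_le_minus_one) (use x assms in simp)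
  then have "x * (ln y - ln x) \<le> x * (y / x - 1)" using x assms by (intro mult_left_mono) (auto simp: ln_div)
  also have "\<dots> = y - x" using x by (simp add: field_simps)
  finally show ?thesis by (simp add: eta_def algebra_simps)
qed (use assms in simp)

text \<open>The tangent line is taken at the weighted mean. A vanishing mean is treated apart, since
  the tangent at 0 is vertical; then all terms vanish.\<close>

lemma eta_jensen:
  assumes "finite I" "\<And>i. i \<in> I \<Longrightarrow> 0 \<le> u i" "(\<Sum>i\<in>I. u i) = 1" "\<And>i. i \<in> I \<Longrightarrow> 0 \<le> x i"
  shows "(\<Sum>i\<in>I. u i * eta (x i)) \<le> eta (\<Sum>i\<in>I. u i * x i)"
proof -
  define X where "X = (\<Sum>i\<in>I. u i * x i)"
  have X0: "X \<ge> 0" unfolding X_def using assms by (intro sum_nonneg) auto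
  show ?thesis
  proof (cases "X = 0")
    case True
    then have "u i * x i = 0" if "i \<in> I" for i
      using sum_nonneg_eq_0_iff[OF assms(1), of "\<lambda>i. u i * x i"] assms that by (simp add: X_def)
    then have "u i * eta (x i) = 0" if "i \<in> I" for i using that by (auto simp: eta_def)
    then have "(\<Sum>i\<in>I. u i * eta (x i)) = 0" by (intro sum.neutral) blast
    then show ?thesis using True by (simp add: X_def)
  next
    case False
    then have X: "X > 0" using X0 by simp
    have "(\<Sum>i\<in>I. u i * eta (x i)) \<le> (\<Sum>i\<in>I. u i * (- x i * ln X + (X - x i)))"
      by (intro sum_mono mult_left_mono eta_tangent X assms)
    also have "\<dots> = - ln X * (\<Sum>i\<in>I. u i * x i) + X * (\<Sum>i\<in>I. u i) - (\<Sum>i\<in>I. u i * x i)"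
      by (simp add: sum_distrib_left sum_distrib_right sum.distrib sum_subtractf algebra_simps sum_negf)
    also have "\<dots> = eta X" unfolding assms(3) X_def[symmetric] by (simp add: eta_def)
    finally show ?thesis by (simp add: X_def)
  qed
qed

section \<open>Geometry of the iterated function system\<close>

fun Tl :: "(nat \<Rightarrow> real \<Rightarrow> real) \<Rightarrow> nat list \<Rightarrow> real \<Rightarrow> real" where
  "Tl T [] x = x"
| "Tl T (a # w) x = T a (Tl T w x)"

fun Dl :: "(nat \<Rightarrow> real \<Rightarrow> real) \<Rightarrow> (nat \<Rightarrow> real \<Rightarrow> real) \<Rightarrow> nat list \<Rightarrow> real \<Rightarrow> real" where
  "Dl T DT [] x = 1"
| "Dl T DT (a # w) x = DT a (Tl T w x) * Dl T DT w x"

lemma Tl_append: "Tl T (u @ v) x = Tl T u (Tl T v x)"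
  by (induction u) auto

lemma Dl_append: "Dl T DT (u @ v) x = Dl T DT u (Tl T v x) * Dl T DT v x"
  by (induction u) (auto simp: Tl_append)

lemma compn_eq_Tl: "compn T \<omega> n x = Tl T (pref n \<omega>) x"
  by (induction n arbitrary: x) (auto simp: pref_def Tl_append)

text \<open>The general geometry rests on \<open>le1\<close>, the common consequence of the
  conditions at the fixed points and off them. Strict contraction away from the fixed points enters
  as the explicit hypothesis \<open>contr\<close> of \<open>zero_lyap\<close>.\<close>

locale ifs =
  fixes m :: nat and T DT :: "nat \<Rightarrow> real \<Rightarrow> real"
  assumes m: "m \<ge> 1"
    and maps: "\<And>i x. i \<in> {1..m} \<Longrightarrow> x \<in> {0..1} \<Longrightarrow> T i x \<in> {0..1}"
    and deriv: "\<And>i x. i \<in> {1..m} \<Longrightarrow> x \<in> {0..1} \<Longrightarrow> (T i has_real_derivative DT i x) (at x within {0..1})"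
    and C1: "\<And>i. i \<in> {1..m} \<Longrightarrow> continuous_on {0..1} (DT i)"
    and pos: "\<And>i x. i \<in> {1..m} \<Longrightarrow> x \<in> {0..1} \<Longrightarrow> DT i x > 0"
    and disj: "\<And>i j. i \<in> {1..m} \<Longrightarrow> j \<in> {1..m} \<Longrightarrow> i \<noteq> j \<Longrightarrow> T i ` {0<..<1} \<inter> T j ` {0<..<1} = {}"
    and diam: "\<And>\<epsilon>. \<epsilon> > 0 \<Longrightarrow> \<exists>N. \<forall>n\<ge>N. \<forall>\<omega>\<in>Sig m. diameter (compn T \<omega> n ` {0..1}) < \<epsilon>"
    and le1: "\<And>i x. i \<in> {1..m} \<Longrightarrow> x \<in> {0..1} \<Longrightarrow> DT i x \<le> 1"
begin

abbreviation "g \<equiv> gpot T DT"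

lemma Tl_in: "set w \<subseteq> {1..m} \<Longrightarrow> x \<in> {0..1} \<Longrightarrow> Tl T w x \<in> {0..1}"
proof (induction w)
  case (Cons a w)
  then have "a \<in> {1..m}" "Tl T w x \<in> {0..1}" by auto
  from maps[OF this] show ?case by simp
qed simp

lemma Tl_deriv:
  assumes "set w \<subseteq> {1..m}" "x \<in> {0..1}"
  shows "(Tl T w has_real_derivative Dl T DT w x) (at x within {0..1})"
  using assms
proof (induction w)
  case Nil
  have "Tl T [] = (\<lambda>x. x)" by auto
  then show ?case by simp
next
  case (Cons a w)
  have a: "a \<in> {1..m}" and w: "set w \<subseteq> {1..m}" using Cons.prems by auto
  have sub: "Tl T w ` {0..1} \<subseteq> {0..1}" using Tl_in[OF w] by blast
  have "(T a has_real_derivative DT a (Tl T w x)) (at (Tl T w x) within Tl T w ` {0..1})"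
    by (rule DERIV_subset[OF deriv[OF a Tl_in[OF w Cons.prems(2)]] sub])
  from DERIV_image_chain[OF this Cons.IH[OF w Cons.prems(2)]]
  show ?case by (simp add: comp_def)
qed

lemma Dl_pos: "set w \<subseteq> {1..m} \<Longrightarrow> x \<in> {0..1} \<Longrightarrow> Dl T DT w x > 0"
proof (induction w)
  case (Cons a w)
  then have "a \<in> {1..m}" "Tl T w x \<in> {0..1}" using Tl_in[of w x] by auto
  from pos[OF this] Cons show ?case by simp
qed simp

lemma Tl_mvt:
  assumes w: "set w \<subseteq> {1..m}" and ab: "0 \<le> a" "a < b" "b \<le> 1"
  obtains z where "z \<in> {0..1}" "Tl T w b - Tl T w a = (b - a) * Dl T DT w z"
proof -
  have "(Tl T w has_derivative (*) (Dl T DT w x)) (at x within {a..b})" if "a \<le> x" "x \<le> b" for x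
  proof -
    have "(Tl T w has_real_derivative Dl T DT w x) (at x within {a..b})"
      by (rule DERIV_subset[OF Tl_deriv[OF w]]) (use that ab in auto)
    then show ?thesis by (simp add: has_field_derivative_def)
  qed
  from mvt_simple[OF ab(2) this] obtain z where "z \<in> {a<..<b}" "Tl T w b - Tl T w a = Dl T DT w z * (b - a)" by blast
  then show thesis using that[of z] ab by (auto simp: mult.commute)
qed

lemma Tl_strict_mono:
  assumes "set w \<subseteq> {1..m}" "0 \<le> a" "a < b" "b \<le> 1"
  shows "Tl T w a < Tl T w b"
proof -
  obtain z where z: "z \<in> {0..1}" "Tl T w b - Tl T w a = (b - a) * Dl T DT w z" using Tl_mvt[OF assms] by blast
  have "(b - a) * Dl T DT w z > 0" using Dl_pos[OF assms(1) z(1)] assms(3) by simp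
  then show ?thesis using z(2) by simp
qed

lemma Tl_mono:
  assumes "set w \<subseteq> {1..m}" "0 \<le> a" "a \<le> b" "b \<le> 1"
  shows "Tl T w a \<le> Tl T w b"
  using Tl_strict_mono[OF assms(1,2) _ assms(4)] assms(3) by (cases "a = b") auto

lemma Tl_continuous: "set w \<subseteq> {1..m} \<Longrightarrow> continuous_on {0..1} (Tl T w)"
  using Tl_deriv[of w] by (intro DERIV_continuous_on) blast

lemma Tl_open_image:
  assumes w: "set w \<subseteq> {1..m}" and y: "Tl T w 0 < y" "y < Tl T w 1"
  obtains x where "x \<in> {0<..<1}" "Tl T w x = y"
proof -
  have "\<exists>x\<ge>0. x \<le> 1 \<and> Tl T w x = y"
    by (rule IVT') (use y Tl_continuous[OF w] in auto)
  then obtain x where x: "0 \<le> x" "x \<le> 1" "Tl T w x = y" by blast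
  then have "x \<noteq> 0" "x \<noteq> 1" using y by auto
  then show thesis using that[of x] x by auto
qed

text \<open>Induction along the words: different first letters are separated by \<open>disj\<close>,
  because interior points are mapped to interior points; equal first letters are removed by strict
  monotonicity of the map.\<close>

lemma Tl_disjoint:
  assumes "set w \<subseteq> {1..m}" "set v \<subseteq> {1..m}" "length w = length v" "w \<noteq> v"
    and "x \<in> {0<..<1}" "y \<in> {0<..<1}"
  shows "Tl T w x \<noteq> Tl T v y"
  using assms
proof (induction w arbitrary: v)
  case (Cons a w)
  then obtain b v' where v: "v = b # v'" by (cases v) auto
  have ab: "a \<in> {1..m}" "b \<in> {1..m}" and ws: "set w \<subseteq> {1..m}" "set v' \<subseteq> {1..m}" using Cons.prems v by auto
  have wi: "Tl T w x \<in> {0<..<1}" if "set w \<subseteq> {1..m}" "x \<in> {0<..<1}" for w x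
  proof -
    have "Tl T w 0 < Tl T w x" "Tl T w x < Tl T w 1" using that by (auto intro!: Tl_strict_mono)
    moreover have "Tl T w 0 \<in> {0..1}" "Tl T w 1 \<in> {0..1}" using Tl_in[OF that(1), of 0] Tl_in[OF that(1), of 1] by auto
    ultimately show ?thesis by auto
  qed
  have in1: "Tl T w x \<in> {0<..<1}" "Tl T v' y \<in> {0<..<1}" using wi ws Cons.prems by blast+
  show ?case
  proof (cases "a = b")
    case False
    have "T a (Tl T w x) \<noteq> T b (Tl T v' y)"
      using disj[OF ab False] imageI[OF in1(1), of "T a"] imageI[OF in1(2), of "T b"] by (metis IntI empty_iff)
    then show ?thesis unfolding v by simp
  next
    case True
    then have "w \<noteq> v'" using Cons.prems v by auto
    then have ne: "Tl T w x \<noteq> Tl T v' y" using Cons.IH[of v'] Cons.prems ws v by auto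
    have inj: "T a u < T a u'" if "u < u'" "u \<in> {0<..<1}" "u' \<in> {0<..<1}" for u u'
      using Tl_strict_mono[of "[a]" u u'] ab that by simp
    from ne consider "Tl T w x < Tl T v' y" | "Tl T v' y < Tl T w x" by linarith
    then have "T a (Tl T w x) \<noteq> T a (Tl T v' y)" using inj in1 by cases force+
    then show ?thesis using True v by simp
  qed
qed simp

text \<open>The diameter hypothesis, transferred from sequences to words by padding. It stands in
  for a contraction rate: the level \<open>N\<close> is uniform over all words.\<close>

lemma Tl_small:
  assumes "e > 0"
  obtains N where "\<And>n w x y. n \<ge> N \<Longrightarrow> w \<in> words m n \<Longrightarrow> x \<in> {0..1} \<Longrightarrow> y \<in> {0..1} \<Longrightarrow> \<bar>Tl T w x - Tl T w y\<bar> < e"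
proof -
  obtain N where N: "\<And>n \<omega>. n \<ge> N \<Longrightarrow> \<omega> \<in> Sig m \<Longrightarrow> diameter (compn T \<omega> n ` {0..1}) < e"
    using diam[OF assms] by blast
  have "\<bar>Tl T w x - Tl T w y\<bar> < e" if "n \<ge> N" "w \<in> words m n" "x \<in> {0..1}" "y \<in> {0..1}" for n w x y
  proof -
    have w: "set w \<subseteq> {1..m}" and lw: "length w = n" using that(2) by (auto simp: words_def)
    let ?\<omega> = "pt w"
    have p: "pref n ?\<omega> = w" using lw by simp
    have eq: "compn T ?\<omega> n ` {0..1} = Tl T w ` {0..1}" using compn_eq_Tl[of T ?\<omega> n] p by auto
    have "Tl T w ` {0..1} \<subseteq> {0..1}" using Tl_in[OF w] by blast
    then have "bounded (Tl T w ` {0..1})" using bounded_subset bounded_closed_interval by blast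
    from diameter_bounded_bound[OF this, of "Tl T w x" "Tl T w y"] that
    have "\<bar>Tl T w x - Tl T w y\<bar> \<le> diameter (Tl T w ` {0..1})" by (simp add: dist_real_def)
    also have "\<dots> < e" using N[OF that(1) pt_Sig[OF that(2) m]] eq by simp
    finally show ?thesis .
  qed
  then show thesis using that by blast
qed

section \<open>The coding map\<close>

lemma Pi_conv:
  assumes \<omega>: "\<omega> \<in> Sig m"
  shows "(\<lambda>n. Tl T (pref n \<omega>) 0) \<longlonglongrightarrow> Pi_map T \<omega>"
proof -
  have sw: "set (pref n \<omega>) \<subseteq> {1..m}" for n using pref_in_words[OF \<omega>] by (simp add: words_def)
  have "Cauchy (\<lambda>n. Tl T (pref n \<omega>) 0)"
  proof (rule metric_CauchyI)
    fix e :: real assume e: "e > 0"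
    obtain N where N: "\<And>n w x y. n \<ge> N \<Longrightarrow> w \<in> words m n \<Longrightarrow> x \<in> {0..1} \<Longrightarrow> y \<in> {0..1} \<Longrightarrow> \<bar>Tl T w x - Tl T w y\<bar> < e"
      using Tl_small[OF e] by metis
    have 0: "\<exists>x\<in>{0..1}. Tl T (pref n \<omega>) 0 = Tl T (pref N \<omega>) x" if "n \<ge> N" for n
    proof -
      have "pref n \<omega> = pref N \<omega> @ pref (n - N) ((shift ^^ N) \<omega>)"
        using pref_append[of N "n - N" \<omega>] that by simp
      moreover have "Tl T (pref (n - N) ((shift ^^ N) \<omega>)) 0 \<in> {0..1}"
        using pref_in_words[OF shift_pow_Sig[OF \<omega>]] by (intro Tl_in) (auto simp: words_def)
      ultimately show ?thesis by (metis Tl_append)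
    qed
    have "dist (Tl T (pref k \<omega>) 0) (Tl T (pref n \<omega>) 0) < e" if kn: "k \<ge> N" "n \<ge> N" for k n
    proof -
      obtain x y where "x \<in> {0..1}" "y \<in> {0..1}" "Tl T (pref k \<omega>) 0 = Tl T (pref N \<omega>) x" "Tl T (pref n \<omega>) 0 = Tl T (pref N \<omega>) y"
        using 0[OF kn(1)] 0[OF kn(2)] by blast
      then show ?thesis using N[OF order_refl pref_in_words[OF \<omega>]] by (simp add: dist_real_def)
    qed
    then show "\<exists>M. \<forall>k\<ge>M. \<forall>n\<ge>M. dist (Tl T (pref k \<omega>) 0) (Tl T (pref n \<omega>) 0) < e" by blast
  qed
  then have "convergent (\<lambda>n. Tl T (pref n \<omega>) 0)" by (rule Cauchy_convergent)
  then show ?thesis unfolding Pi_map_def compn_eq_Tl by (simp add: convergent_LIMSEQ_iff)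
qed

lemma Pi_in: "\<omega> \<in> Sig m \<Longrightarrow> Pi_map T \<omega> \<in> {0..1}"
proof -
  assume \<omega>: "\<omega> \<in> Sig m"
  have "Tl T (pref n \<omega>) 0 \<in> {0..1}" for n
    using pref_in_words[OF \<omega>] by (intro Tl_in) (auto simp: words_def)
  then show ?thesis
    using LIMSEQ_le_const[OF Pi_conv[OF \<omega>], of 0] LIMSEQ_le_const2[OF Pi_conv[OF \<omega>], of 1] by auto
qed

lemma Pi_shift:
  assumes \<omega>: "\<omega> \<in> Sig m"
  shows "Pi_map T \<omega> = T (\<omega> 0) (Pi_map T (shift \<omega>))"
proof -
  have a: "\<omega> 0 \<in> {1..m}" using \<omega> unfolding Sig_def by blast
  have c: "continuous_on {0..1} (T (\<omega> 0))"
    by (rule DERIV_continuous_on) (rule deriv[OF a])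
  have "(\<lambda>n. T (\<omega> 0) (Tl T (pref n (shift \<omega>)) 0)) \<longlonglongrightarrow> T (\<omega> 0) (Pi_map T (shift \<omega>))"
  proof (rule continuous_on_tendsto_compose[OF c Pi_conv[OF shift_Sig[OF \<omega>]] Pi_in[OF shift_Sig[OF \<omega>]]])
    show "\<forall>\<^sub>F n in sequentially. Tl T (pref n (shift \<omega>)) 0 \<in> {0..1}"
      using pref_in_words[OF shift_Sig[OF \<omega>]] by (intro always_eventually allI Tl_in) (auto simp: words_def)
  qed
  then have "(\<lambda>n. Tl T (pref (Suc n) \<omega>) 0) \<longlonglongrightarrow> T (\<omega> 0) (Pi_map T (shift \<omega>))"
    by (simp add: pref_Suc)
  moreover have "(\<lambda>n. Tl T (pref (Suc n) \<omega>) 0) \<longlonglongrightarrow> Pi_map T \<omega>"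
    using Pi_conv[OF \<omega>] by (rule LIMSEQ_Suc)
  ultimately show ?thesis using LIMSEQ_unique by blast
qed

lemma Pi_eq_Tl:
  "\<omega> \<in> Sig m \<Longrightarrow> Pi_map T \<omega> = Tl T (pref n \<omega>) (Pi_map T ((shift ^^ n) \<omega>))"
proof (induction n arbitrary: \<omega>)
  case (Suc n)
  have "Pi_map T \<omega> = T (\<omega> 0) (Tl T (pref n (shift \<omega>)) (Pi_map T ((shift ^^ n) (shift \<omega>))))"
    using Pi_shift[OF Suc.prems] Suc.IH[OF shift_Sig[OF Suc.prems]] by simp
  then show ?case by (simp add: pref_Suc funpow_swap1)
qed (simp add: pref_def)

lemma Pi_interval:
  assumes "\<omega> \<in> Sig m"
  shows "Pi_map T \<omega> \<in> {Tl T (pref n \<omega>) 0..Tl T (pref n \<omega>) 1}"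
proof -
  have "set (pref n \<omega>) \<subseteq> {1..m}" using pref_in_words[OF assms] by (simp add: words_def)
  moreover have "Pi_map T ((shift ^^ n) \<omega>) \<in> {0..1}" by (rule Pi_in[OF shift_pow_Sig[OF assms]])
  ultimately show ?thesis unfolding Pi_eq_Tl[OF assms, of n] by (auto intro!: Tl_mono)
qed

section \<open>Distortion and the potential \<open>g\<close>\<close>

lemma lnDT_uniform:
  assumes "e > 0"
  obtains d where "d > 0" "\<And>i x y. i \<in> {1..m} \<Longrightarrow> x \<in> {0..1} \<Longrightarrow> y \<in> {0..1} \<Longrightarrow> \<bar>x - y\<bar> < d \<Longrightarrow> \<bar>ln (DT i x) - ln (DT i y)\<bar> < e"
proof -
  have "\<exists>d>0. \<forall>x\<in>{0..1}. \<forall>y\<in>{0..1}. \<bar>x - y\<bar> < d \<longrightarrow> \<bar>ln (DT i x) - ln (DT i y)\<bar> < e" if i: "i \<in> {1..m}" for i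
  proof -
    have "DT i x \<noteq> 0" if "x \<in> {0..1}" for x using pos[OF i that] by simp
    then have "continuous_on {0..1} (\<lambda>x. ln (DT i x))" using C1[OF i] by (intro continuous_on_ln) auto
    then have "uniformly_continuous_on {0..1} (\<lambda>x. ln (DT i x))" by (rule compact_uniformly_continuous) simp
    from uniformly_continuous_onE[OF this assms] obtain d where
      d: "d > 0" "\<And>x x'. x \<in> {0..1} \<Longrightarrow> x' \<in> {0..1} \<Longrightarrow> dist x' x < d \<Longrightarrow> dist (ln (DT i x')) (ln (DT i x)) < e" by blast
    show ?thesis
    proof (intro exI[of _ d] conjI d(1) ballI impI)
      fix x y :: real assume "x \<in> {0..1}" "y \<in> {0..1}" "\<bar>x - y\<bar> < d"
      then show "\<bar>ln (DT i x) - ln (DT i y)\<bar> < e" using d(2)[of y x] by (simp add: dist_real_def)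
    qed
  qed
  then obtain d where d: "\<And>i. i \<in> {1..m} \<Longrightarrow> d i > 0 \<and> (\<forall>x\<in>{0..1}. \<forall>y\<in>{0..1}. \<bar>x - y\<bar> < d i \<longrightarrow> \<bar>ln (DT i x) - ln (DT i y)\<bar> < e)"
    by metis
  define D where "D = Min (d ` {1..m})"
  have ne: "{1..m} \<noteq> {}" using m by simp
  have "D > 0" unfolding D_def using d ne by (subst Min_gr_iff) auto
  moreover have "D \<le> d i" if "i \<in> {1..m}" for i unfolding D_def using that by (intro Min_le) auto
  ultimately show thesis using that[of D] d by (meson order_less_le_trans)
qed

lemma lnDT_bounded:
  obtains B where "B > 0" "\<And>i x. i \<in> {1..m} \<Longrightarrow> x \<in> {0..1} \<Longrightarrow> \<bar>ln (DT i x)\<bar> \<le> B"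
proof -
  have "\<exists>B. \<forall>x\<in>{0..1}. \<bar>ln (DT i x)\<bar> \<le> B" if i: "i \<in> {1..m}" for i
  proof -
    have "DT i x \<noteq> 0" if "x \<in> {0..1}" for x using pos[OF i that] by simp
    then have "continuous_on {0..1} (\<lambda>x. ln (DT i x))" using C1[OF i] by (intro continuous_on_ln) auto
    then have "compact ((\<lambda>x. ln (DT i x)) ` {0..1})" by (rule compact_continuous_image) simp
    from compact_imp_bounded[OF this] show ?thesis unfolding bounded_iff by auto
  qed
  then obtain b where b: "\<And>i x. i \<in> {1..m} \<Longrightarrow> x \<in> {0..1} \<Longrightarrow> \<bar>ln (DT i x)\<bar> \<le> b i" by metis
  define B where "B = 1 + Max (insert 0 (b ` {1..m}))"
  have "b i \<le> B" if "i \<in> {1..m}" for i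
  proof -
    have "b i \<le> Max (insert 0 (b ` {1..m}))" using that by (intro Max_ge) auto
    then show ?thesis by (simp add: B_def)
  qed
  moreover have "B > 0" unfolding B_def by (simp add: add_pos_nonneg)
  ultimately show thesis using that[of B] b by (meson order_trans)
qed

text \<open>The projections of two sequences with a long common beginning are close by
  \<open>Tl_small\<close>, and the logarithms of the derivatives have a modulus of continuity common
  to the finitely many maps.\<close>

lemma UC_g: "UC m g"
  unfolding UC_def
proof (intro allI impI)
  fix e :: real assume "e > 0"
  then obtain d where d: "d > 0" "\<And>i x y. i \<in> {1..m} \<Longrightarrow> x \<in> {0..1} \<Longrightarrow> y \<in> {0..1} \<Longrightarrow> \<bar>x - y\<bar> < d \<Longrightarrow> \<bar>ln (DT i x) - ln (DT i y)\<bar> < e"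
    using lnDT_uniform by metis
  obtain N where N: "\<And>n w x y. n \<ge> N \<Longrightarrow> w \<in> words m n \<Longrightarrow> x \<in> {0..1} \<Longrightarrow> y \<in> {0..1} \<Longrightarrow> \<bar>Tl T w x - Tl T w y\<bar> < d"
    using Tl_small[OF d(1)] by metis
  show "\<exists>K. \<forall>\<omega>\<in>Sig m. \<forall>\<omega>'\<in>Sig m. pref K \<omega> = pref K \<omega>' \<longrightarrow> \<bar>g \<omega> - g \<omega>'\<bar> < e"
  \<comment> \<open>One symbol selects the map, the next \<open>N\<close> locate the point at which
    its derivative is taken.\<close>
  proof (intro exI[of _ "Suc N"] ballI impI)
    fix \<omega> \<omega>' assume w: "\<omega> \<in> Sig m" "\<omega>' \<in> Sig m" and "pref (Suc N) \<omega> = pref (Suc N) \<omega>'"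
    then have eq: "\<omega> 0 = \<omega>' 0" "pref N (shift \<omega>) = pref N (shift \<omega>')" by (auto simp: pref_Suc)
    have a: "\<omega>' 0 \<in> {1..m}" using w unfolding Sig_def by blast
    note s = shift_Sig[OF w(1)] shift_Sig[OF w(2)]
    have "\<bar>Pi_map T (shift \<omega>) - Pi_map T (shift \<omega>')\<bar> < d"
      unfolding Pi_eq_Tl[OF s(1), of N] Pi_eq_Tl[OF s(2), of N] eq(2)
      by (rule N[OF order_refl pref_in_words[OF s(2)] Pi_in[OF shift_pow_Sig[OF s(1)]] Pi_in[OF shift_pow_Sig[OF s(2)]]])
    from d(2)[OF a Pi_in[OF s(1)] Pi_in[OF s(2)] this]
    show "\<bar>g \<omega> - g \<omega>'\<bar> < e" unfolding gpot_def eq(1) by simp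
  qed
qed

lemma g_nonneg: "\<omega> \<in> Sig m \<Longrightarrow> 0 \<le> g \<omega>"
proof -
  assume \<omega>: "\<omega> \<in> Sig m"
  then have a: "\<omega> 0 \<in> {1..m}" unfolding Sig_def by blast
  show ?thesis unfolding gpot_def
    using le1[OF a Pi_in[OF shift_Sig[OF \<omega>]]] pos[OF a Pi_in[OF shift_Sig[OF \<omega>]]] by simp
qed

lemma ln_Dl:
  assumes "set w \<subseteq> {1..m}" "x \<in> {0..1}"
  shows "ln (Dl T DT w x) = (\<Sum>i<length w. ln (DT (w ! i) (Tl T (drop (Suc i) w) x)))"
  using assms
proof (induction w)
  case (Cons a w)
  have a: "a \<in> {1..m}" and w: "set w \<subseteq> {1..m}" using Cons.prems by auto
  have "ln (Dl T DT (a # w) x) = ln (DT a (Tl T w x)) + ln (Dl T DT w x)"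
    using pos[OF a Tl_in[OF w Cons.prems(2)]] Dl_pos[OF w Cons.prems(2)] by (simp add: ln_mult)
  also have "\<dots> = (\<Sum>i<Suc (length w). ln (DT ((a # w) ! i) (Tl T (drop (Suc i) (a # w)) x)))"
    unfolding sum.lessThan_Suc_shift Cons.IH[OF w Cons.prems(2)] by simp
  finally show ?case by simp
qed simp

text \<open>By the chain rule both quantities are sums over time of logarithms of derivatives of the
  same maps. At time \<open>i\<close> the two evaluation points lie in the image of the same word of
  length \<open>n - Suc i\<close>, so they are close except for the last few times. In particular
  the derivative at every \<open>x\<close> is controlled by the orbit of one point of the
  cylinder.\<close>

lemma distortion:
  fixes e :: real
  assumes e: "e > 0"
  obtains N where "\<And>n \<omega> x. n \<ge> N \<Longrightarrow> \<omega> \<in> Sig m \<Longrightarrow> x \<in> {0..1} \<Longrightarrow>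
     \<bar>ln (Dl T DT (pref n \<omega>) x) + (\<Sum>i<n. g ((shift ^^ i) \<omega>))\<bar> \<le> n * e"
proof -
  obtain d where d: "d > 0" "\<And>i x y. i \<in> {1..m} \<Longrightarrow> x \<in> {0..1} \<Longrightarrow> y \<in> {0..1} \<Longrightarrow> \<bar>x - y\<bar> < d \<Longrightarrow> \<bar>ln (DT i x) - ln (DT i y)\<bar> < e / 2"
    using lnDT_uniform[OF half_gt_zero[OF e]] by metis
  obtain K where K: "\<And>n w x y. n \<ge> K \<Longrightarrow> w \<in> words m n \<Longrightarrow> x \<in> {0..1} \<Longrightarrow> y \<in> {0..1} \<Longrightarrow> \<bar>Tl T w x - Tl T w y\<bar> < d"
    using Tl_small[OF d(1)] by metis
  obtain B where B: "B > 0" "\<And>i x. i \<in> {1..m} \<Longrightarrow> x \<in> {0..1} \<Longrightarrow> \<bar>ln (DT i x)\<bar> \<le> B" using lnDT_bounded by metis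
  obtain N :: nat where N: "real N > Suc K * (2 * B) / (e / 2)" using reals_Archimedean2[of "Suc K * (2 * B) / (e / 2)"] by blast
  have "\<bar>ln (Dl T DT (pref n \<omega>) x) + (\<Sum>i<n. g ((shift ^^ i) \<omega>))\<bar> \<le> n * e"
    if n: "n \<ge> N" and \<omega>: "\<omega> \<in> Sig m" and x: "x \<in> {0..1}" for n \<omega> x
  proof -
    have sw: "set (pref n \<omega>) \<subseteq> {1..m}" using pref_in_words[OF \<omega>] by (simp add: words_def)
    let ?s = "\<lambda>i. (shift ^^ Suc i) \<omega>"
    let ?y = "\<lambda>i. Tl T (pref (n - Suc i) (?s i)) x" and ?z = "\<lambda>i. Pi_map T (?s i)"
    let ?d = "\<lambda>i. \<bar>ln (DT (\<omega> i) (?y i)) - ln (DT (\<omega> i) (?z i))\<bar>"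
    have sS: "?s i \<in> Sig m" for i by (rule shift_pow_Sig[OF \<omega>])
    have y: "?y i \<in> {0..1}" for i using pref_in_words[OF sS] x by (intro Tl_in) (auto simp: words_def)
    have z: "?z i \<in> {0..1}" for i by (rule Pi_in[OF sS])
    have a: "\<omega> i \<in> {1..m}" for i using \<omega> unfolding Sig_def by blast
    have dr: "drop (Suc i) (pref n \<omega>) = pref (n - Suc i) (?s i)" for i
      by (auto simp: list_eq_iff_nth_eq shift_pow shift_def add.commute)
    have "ln (Dl T DT (pref n \<omega>) x) = (\<Sum>i<n. ln (DT (\<omega> i) (?y i)))"
      unfolding ln_Dl[OF sw x] dr by simp
    moreover have "(\<Sum>i<n. g ((shift ^^ i) \<omega>)) = (\<Sum>i<n. - ln (DT (\<omega> i) (?z i)))"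
      unfolding gpot_def by (simp add: shift_pow)
    ultimately have "\<bar>ln (Dl T DT (pref n \<omega>) x) + (\<Sum>i<n. g ((shift ^^ i) \<omega>))\<bar> = \<bar>\<Sum>i<n. ln (DT (\<omega> i) (?y i)) - ln (DT (\<omega> i) (?z i))\<bar>"
      by (simp add: sum_subtractf sum_negf)
    also have "\<dots> \<le> (\<Sum>i<n. ?d i)" by (rule sum_abs)
    also have "\<dots> \<le> n * e"
    proof (rule sum_le_early[where K = "Suc K" and B = "2 * B"])
      fix i assume i: "i < n - Suc K"
      have "\<bar>?y i - ?z i\<bar> < d"
        by (subst Pi_eq_Tl[OF sS[of i], where n = "n - Suc i"],
          rule K[OF _ pref_in_words[OF sS] x Pi_in[OF shift_pow_Sig[OF sS]]]) (use i in simp)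
      from d(2)[OF a[of i] y z this] show "?d i \<le> e / 2" by (rule less_imp_le)
    next
      fix i
      show "?d i \<le> 2 * B" using B(2)[OF a y, of i i] B(2)[OF a z, of i i] by linarith
    next
      have "Suc K * (2 * B) / (e / 2) \<le> n" using N n by linarith
      then show "Suc K * (2 * B) \<le> n * (e / 2)" using e by (simp add: field_simps)
    qed (use e B in auto)
    finally show ?thesis .
  qed
  then show thesis using that by blast
qed

lemma interval_length:
  assumes "set w \<subseteq> {1..m}"
  obtains z where "z \<in> {0..1}" "Tl T w 1 - Tl T w 0 = Dl T DT w z"
  using Tl_mvt[OF assms, of 0 1] by auto

end

section \<open>Moran sets and the mass distribution principle\<close>

definition cw :: "(nat \<Rightarrow> nat list) \<Rightarrow> nat \<Rightarrow> nat list" where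
  "cw W k = concat (map W [0..<k])"

text \<open>The infinite concatenation. With nonempty words the first \<open>Suc n\<close> of them
  already reach position \<open>n\<close>, and later words do not change that letter.\<close>

definition flat :: "(nat \<Rightarrow> nat list) \<Rightarrow> nat \<Rightarrow> nat" where
  "flat W n = cw W (Suc n) ! n"

lemma cw_0 [simp]: "cw W 0 = []"
  by (simp add: cw_def)

lemma cw_Suc: "cw W (Suc k) = cw W k @ W k"
  by (simp add: cw_def)

lemma length_cw: "length (cw W k) = (\<Sum>j<k. length (W j))"
  by (induction k) (auto simp: cw_Suc)

lemma cw_prefix: "k \<le> k' \<Longrightarrow> \<exists>v. cw W k' = cw W k @ v"
  by (induction k' rule: dec_induct) (auto simp: cw_Suc)

lemma cw_nth:
  assumes "n < length (cw W k)" "k \<le> k'"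
  shows "cw W k' ! n = cw W k ! n"
  using cw_prefix[OF assms(2), of W] assms(1) by (auto simp: nth_append)

lemma length_cw_ge:
  assumes "\<And>j. length (W j) \<ge> 1"
  shows "k \<le> length (cw W k)"
proof (induction k)
  case (Suc k)
  then show ?case using assms[of k] by (simp add: cw_Suc)
qed simp

lemma pref_flat:
  assumes "\<And>j. length (W j) \<ge> 1"
  shows "pref (length (cw W k)) (flat W) = cw W k"
proof -
  have "flat W n = cw W k ! n" if "n < length (cw W k)" for n
  proof -
    have "n < length (cw W (Suc n))" using length_cw_ge[of W "Suc n", OF assms] by simp
    then have "cw W (max k (Suc n)) ! n = flat W n" unfolding flat_def by (rule cw_nth) simp
    moreover have "cw W (max k (Suc n)) ! n = cw W k ! n" using that by (rule cw_nth) simp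
    ultimately show ?thesis by simp
  qed
  then show ?thesis by (auto simp: list_eq_iff_nth_eq)
qed

lemma flat_Sig:
  assumes "\<And>j. length (W j) \<ge> 1" "\<And>j. set (W j) \<subseteq> {1..m}"
  shows "flat W \<in> Sig m"
proof -
  have "flat W n \<in> {1..m}" for n
  proof -
    have "n < length (cw W (Suc n))" using length_cw_ge[of W "Suc n", OF assms(1)] by simp
    then have "flat W n \<in> set (cw W (Suc n))" unfolding flat_def by (rule nth_mem)
    also have "\<dots> \<subseteq> {1..m}" unfolding cw_def using assms(2) by (simp add: UN_subset_iff)
    finally show ?thesis .
  qed
  then show ?thesis unfolding Sig_def by blast
qed

lemma cw_restrict: "cw (restrict W {..<k}) k = cw W k"
  unfolding cw_def by (intro arg_cong[where f=concat] map_cong) auto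

text \<open>The lengths of the pieces depend on the position only, so the concatenation can be cut
  back into its words; outside the index set both functions are undefined in the same way.\<close>

lemma cw_inj:
  assumes "v \<in> PiE {..<k} V" "v' \<in> PiE {..<k} V" "cw v k = cw v' k"
    and "\<And>j w w'. w \<in> V j \<Longrightarrow> w' \<in> V j \<Longrightarrow> length w = length w'"
  shows "v = v'"
proof -
  have "map v [0..<k] = map v' [0..<k]"
  proof (rule concat_injective)
    show "concat (map v [0..<k]) = concat (map v' [0..<k])" using assms(3) by (simp add: cw_def)
    have "length (v j) = length (v' j)" if "j < k" for j
    proof -
      have j: "j \<in> {..<k}" using that by simp
      show ?thesis by (rule assms(4)[OF PiE_mem[OF assms(1) j] PiE_mem[OF assms(2) j]])
    qed
    then show "\<forall>(x, y)\<in>set (zip (map v [0..<k]) (map v' [0..<k])). length x = length y"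
      unfolding set_zip by fastforce
  qed simp
  then have "v j = v' j" if "j < k" for j using that by (simp add: map_eq_conv)
  then show ?thesis using assms(1,2) by (intro PiE_ext[of v "{..<k}" V v']) auto
qed

context ifs
begin

text \<open>Cylinder intervals of equally long words have disjoint interiors. Each one considered
  contains an interval of length \<open>r\<close> whose left end lies in a window of length
  \<open>3 * r\<close> around \<open>U\<close>; two left ends in the same cell of a grid of width
  \<open>r\<close> would force an overlap.\<close>

lemma few_intervals:
  fixes W :: "'b \<Rightarrow> nat list"
  assumes Q: "\<And>v. v \<in> Q \<Longrightarrow> set (W v) \<subseteq> {1..m} \<and> length (W v) = n \<and> Tl T (W v) 1 - Tl T (W v) 0 \<ge> r"
    and inj: "inj_on W Q" and r: "r > 0"
    and U: "\<And>x y. x \<in> U \<Longrightarrow> y \<in> U \<Longrightarrow> \<bar>x - y\<bar> < r"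
    and meet: "\<And>v. v \<in> Q \<Longrightarrow> \<exists>y\<in>U. Tl T (W v) 0 \<le> y \<and> y \<le> Tl T (W v) 1"
  shows "finite Q \<and> card Q \<le> 3"
proof (cases "Q = {}")
  case False
  then obtain x0 where x0: "x0 \<in> U" using meet by blast
  obtain y where y: "\<And>v. v \<in> Q \<Longrightarrow> y v \<in> U \<and> Tl T (W v) 0 \<le> y v \<and> y v \<le> Tl T (W v) 1"
    using meet by metis
  \<comment> \<open>This places an interval from \<open>c v\<close> to \<open>c v + r\<close> inside
    the cylinder interval so that it still contains the chosen point \<open>y v\<close> of
    \<open>U\<close>.\<close>
  define c where "c v = max (Tl T (W v) 0) (y v - r)" for v
  have c: "Tl T (W v) 0 \<le> c v" "c v + r \<le> Tl T (W v) 1" "x0 - 2 * r < c v" "c v < x0 + r" if v: "v \<in> Q" for v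
    using y[OF v] Q[OF v] U[OF x0, of "y v"] r unfolding c_def by auto
  define k where "k v = \<lfloor>(c v - x0) / r\<rfloor>" for v
  have "k v \<in> {-2, -1, 0}" if v: "v \<in> Q" for v
  proof -
    have "- 2 \<le> (c v - x0) / r" "(c v - x0) / r < 1" using c[OF v] r by (auto simp: field_simps)
    then have "-2 \<le> k v" "k v < 1" unfolding k_def by linarith+
    then show ?thesis by auto
  qed
  then have kQ: "k ` Q \<subseteq> {-2, -1, 0}" by blast
  have "inj_on k Q"
  proof (rule inj_onI, rule ccontr)
    fix u v assume uv: "u \<in> Q" "v \<in> Q" "k u = k v" "u \<noteq> v"
    have "\<bar>(c u - x0) / r - (c v - x0) / r\<bar> < 1" using uv(3) unfolding k_def by linarith
    moreover have "(c u - x0) / r - (c v - x0) / r = (c u - c v) / r" by (simp add: diff_divide_distrib)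
    ultimately have "\<bar>c u - c v\<bar> < r" using r by (simp add: abs_divide field_simps)
    then have lt: "c u < c v + r" "c v < c u + r" by linarith+
    \<comment> \<open>The midpoint of the overlap of the two intervals of length \<open>r\<close>;
      it is interior to both cylinder intervals.\<close>
    define t where "t = (max (c u) (c v) + min (c u) (c v) + r) / 2"
    have t: "c u < t" "c v < t" "t < c u + r" "t < c v + r" using lt r unfolding t_def by auto
    obtain x where x: "x \<in> {0<..<1}" "Tl T (W u) x = t"
      using Tl_open_image[of "W u" t] Q[OF uv(1)] c[OF uv(1)] t by auto
    obtain x' where x': "x' \<in> {0<..<1}" "Tl T (W v) x' = t"
      using Tl_open_image[of "W v" t] Q[OF uv(2)] c[OF uv(2)] t by auto
    have "W u \<noteq> W v" using inj uv by (auto dest: inj_onD)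
    then have "Tl T (W u) x \<noteq> Tl T (W v) x'"
      using Q[OF uv(1)] Q[OF uv(2)] x(1) x'(1) by (intro Tl_disjoint) auto
    then show False using x x' by simp
  qed
  then have "finite Q" using kQ finite_subset finite_imageD by (metis finite.emptyI finite.insertI)
  moreover have "card Q = card (k ` Q)" using \<open>inj_on k Q\<close> by (simp add: card_image)
  moreover have "card (k ` Q) \<le> card {-2, -1, 0 :: int}" by (rule card_mono[OF _ kQ]) simp
  ultimately show ?thesis by simp
qed simp

text \<open>\<open>U\<close> is examined at the last stage \<open>k\<close> whose intervals are
  still known to be longer than \<open>U\<close>. At most three of them meet \<open>U\<close>, each
  of mass \<open>exp (- S k)\<close>, and \<open>growth\<close> compares this with the power of the
  length at stage \<open>Suc k\<close>, which is at most the diameter. The slack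
  \<open>\<eta>\<close> serves sets shorter than all stages, such as single points, for which
  \<open>0 powr s = 0\<close> contributes nothing even at \<open>s = 0\<close>.\<close>

lemma moran_cover:
  fixes V :: "nat \<Rightarrow> nat list set" and b :: "nat \<Rightarrow> real"
  assumes fin: "\<And>j. finite (V j)" and ne: "\<And>j. V j \<noteq> {}"
    and sub: "\<And>j. V j \<subseteq> words m (l j)" and l: "\<And>j. l j \<ge> 1"
    and D: "\<And>j w x. w \<in> V j \<Longrightarrow> x \<in> {0..1} \<Longrightarrow> Dl T DT w x \<ge> exp (- b j)"
    and s: "s \<ge> 0" and growth: "\<And>k. s * (\<Sum>j<Suc k. b j) \<le> (\<Sum>j<k. ln (real (card (V j)))) + C"
    and dvg: "filterlim (\<lambda>k. \<Sum>j<k. ln (real (card (V j)))) at_top sequentially"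
    and U: "bounded U" "diameter U \<le> 1 / 2" and \<eta>: "\<eta> > 0"
  shows "\<exists>k Q. Q \<subseteq> PiE {..<k} V \<and> finite Q \<and>
      (\<forall>W. (\<forall>j. W j \<in> V j) \<longrightarrow> Pi_map T (flat W) \<in> U \<longrightarrow> restrict W {..<k} \<in> Q) \<and>
      card Q * exp (- (\<Sum>j<k. ln (real (card (V j))))) \<le> 3 * exp C * diameter U powr s + \<eta>"
proof -
  define S where "S k = (\<Sum>j<k. ln (real (card (V j))))" for k
  define r where "r k = exp (- (\<Sum>j<k. b j))" for k
  have Dcw: "Dl T DT (cw v k) x \<ge> r k \<and> set (cw v k) \<subseteq> {1..m}" if "\<And>j. j < k \<Longrightarrow> v j \<in> V j" "x \<in> {0..1}" for v k x
    using that
  proof (induction k arbitrary: x)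
    case (Suc k)
    have vk: "v k \<in> V k" using Suc.prems by simp
    then have sv: "set (v k) \<subseteq> {1..m}" using sub by (auto simp: words_def)
    have IH: "Dl T DT (cw v k) (Tl T (v k) x) \<ge> r k \<and> set (cw v k) \<subseteq> {1..m}"
      by (rule Suc.IH) (use Suc.prems Tl_in[OF sv] in auto)
    have "r (Suc k) = r k * exp (- b k)" by (simp add: r_def flip: exp_add)
    also have "\<dots> \<le> Dl T DT (cw v k) (Tl T (v k) x) * Dl T DT (v k) x"
      using IH D[OF vk Suc.prems(2)] by (intro mult_mono) (auto simp: r_def intro: order_trans[of 0 "exp _"])
    finally show ?case using IH sv by (simp add: cw_Suc Dl_append)
  qed (simp add: r_def)
  define Q where "Q k = {v \<in> PiE {..<k} V. \<exists>y\<in>U. Tl T (cw v k) 0 \<le> y \<and> y \<le> Tl T (cw v k) 1}" for k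
  have lenV: "length w = l j" if "w \<in> V j" for w j using sub that by (auto simp: words_def)
  have Qmem: "restrict W {..<k} \<in> Q k" if W: "\<forall>j. W j \<in> V j" "Pi_map T (flat W) \<in> U" for W k
  proof -
    have l1: "length (W j) \<ge> 1" for j using lenV[of "W j" j] W l by simp
    have sW: "set (W j) \<subseteq> {1..m}" for j using W(1) sub unfolding words_def by blast
    have "Pi_map T (flat W) \<in> {Tl T (pref (length (cw W k)) (flat W)) 0..Tl T (pref (length (cw W k)) (flat W)) 1}"
      by (rule Pi_interval[OF flat_Sig[OF l1 sW]])
    then have "Pi_map T (flat W) \<in> {Tl T (cw W k) 0..Tl T (cw W k) 1}" unfolding pref_flat[OF l1] .
    then show ?thesis unfolding Q_def using W by (auto simp: cw_restrict)
  qed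
  have Qcard: "finite (Q k) \<and> card (Q k) \<le> 3" if small: "diameter U < r k" for k
  proof (rule few_intervals[where W = "\<lambda>v. cw v k" and r = "r k" and n = "\<Sum>j<k. l j" and U = U])
    fix v assume v: "v \<in> Q k"
    then have vV: "v j \<in> V j" if "j < k" for j using that by (auto simp: Q_def PiE_def Pi_def)
    have sw: "set (cw v k) \<subseteq> {1..m}" using Dcw[of k v 0] vV by simp
    moreover have "length (cw v k) = (\<Sum>j<k. l j)" unfolding length_cw using lenV[OF vV] by simp
    moreover have "r k \<le> Tl T (cw v k) 1 - Tl T (cw v k) 0"
    proof -
      obtain z where z: "z \<in> {0..1}" "Tl T (cw v k) 1 - Tl T (cw v k) 0 = Dl T DT (cw v k) z"
        using interval_length[OF sw] by blast
      then show ?thesis using Dcw[of k v z] vV by simp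
    qed
    ultimately show "set (cw v k) \<subseteq> {1..m} \<and> length (cw v k) = (\<Sum>j<k. l j) \<and> r k \<le> Tl T (cw v k) 1 - Tl T (cw v k) 0" by blast
    show "\<exists>y\<in>U. Tl T (cw v k) 0 \<le> y \<and> y \<le> Tl T (cw v k) 1" using v by (simp add: Q_def)
  next
    show "inj_on (\<lambda>v. cw v k) (Q k)"
    proof (rule inj_onI)
      fix u v assume "u \<in> Q k" "v \<in> Q k" "cw u k = cw v k"
      then show "u = v" using lenV by (intro cw_inj[of u k V v]) (auto simp: Q_def)
    qed
    show "r k > 0" by (simp add: r_def)
    fix x y assume "x \<in> U" "y \<in> U"
    then show "\<bar>x - y\<bar> < r k" using diameter_bounded_bound[OF U(1), of x y] small by (simp add: dist_real_def)
  qed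
  have main: "\<exists>k. diameter U < r k \<and> 3 * exp (- S k) \<le> 3 * exp C * diameter U powr s + \<eta>"
  proof (cases "\<forall>k. diameter U < r k")
    case True
    \<comment> \<open>No stage is too short for \<open>U\<close> here, so it can be taken deep
      enough for three intervals to have mass at most \<open>\<eta>\<close>.\<close>
    have "eventually (\<lambda>k. S k \<ge> ln (3 / \<eta>)) sequentially"
      using dvg unfolding S_def filterlim_at_top by blast
    then obtain k where "S k \<ge> ln (3 / \<eta>)" using eventually_happens'[of sequentially] by auto
    then have "exp (- S k) \<le> exp (- ln (3 / \<eta>))" by simp
    also have "\<dots> = \<eta> / 3" using \<eta> by (simp add: exp_minus)
    finally have "3 * exp (- S k) \<le> \<eta>" by simp
    moreover have "0 \<le> 3 * exp C * diameter U powr s" by simp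
    ultimately have "3 * exp (- S k) \<le> 3 * exp C * diameter U powr s + \<eta>" by linarith
    then show ?thesis using True by blast
  next
    case False
    define k where "k = (LEAST k. \<not> diameter U < r k)"
    have k: "\<not> diameter U < r k" 
    proof -
      have "\<exists>k. \<not> diameter U < r k" using False by simp
      from LeastI_ex[OF this] show ?thesis unfolding k_def .
    qed
    \<comment> \<open>At stage 0 the length is \<open>r 0 = 1\<close>, above the bound 1/2 on the
      diameter.\<close>
    have "k \<noteq> 0" using k U(2) by (cases "k = 0") (auto simp: r_def)
    then obtain k' where k': "k = Suc k'" by (cases k) auto
    have dk': "diameter U < r k'"
      using not_less_Least[of k' "\<lambda>k. \<not> diameter U < r k"] k' unfolding k_def by auto
    \<comment> \<open>Here the index shift in \<open>growth\<close> is used: mass at stage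
      \<open>k'\<close> against length at stage \<open>Suc k'\<close>.\<close>
    have "exp (- S k') \<le> exp (C - s * (\<Sum>j<Suc k'. b j))" using growth[of k'] by (simp add: S_def)
    also have "\<dots> = exp C * r k powr s" unfolding r_def k' by (simp add: powr_def mult_exp_exp algebra_simps)
    also have "\<dots> \<le> exp C * diameter U powr s"
      using k s by (intro mult_left_mono powr_mono2) (auto simp: r_def)
    finally show ?thesis using dk' \<eta> by (intro exI[of _ k']) auto
  qed
  then obtain k where k: "diameter U < r k" "3 * exp (- S k) \<le> 3 * exp C * diameter U powr s + \<eta>" by blast
  have "card (Q k) * exp (- S k) \<le> 3 * exp (- S k)" using Qcard[OF k(1)] by (intro mult_right_mono) auto
  also note k(2)
  finally have "card (Q k) * exp (- S k) \<le> 3 * exp C * diameter U powr s + \<eta>" .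
  moreover have "Q k \<subseteq> PiE {..<k} V" by (auto simp: Q_def)
  ultimately show ?thesis using Qcard[OF k(1)] Qmem unfolding S_def by (intro exI[of _ k] exI[of _ "Q k"]) blast
qed

text \<open>The mass lives on the space of choice sequences, as a product of uniform measures,
  instead of on the line. A cover of \<open>E\<close> of small cost would cover all choice sequences
  by sets of total mass below 1.\<close>

lemma moran_set:
  fixes V :: "nat \<Rightarrow> nat list set" and b :: "nat \<Rightarrow> real"
  assumes fin: "\<And>j. finite (V j)" and ne: "\<And>j. V j \<noteq> {}"
    and sub: "\<And>j. V j \<subseteq> words m (l j)" and l: "\<And>j. l j \<ge> 1"
    and D: "\<And>j w x. w \<in> V j \<Longrightarrow> x \<in> {0..1} \<Longrightarrow> Dl T DT w x \<ge> exp (- b j)"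
    and s: "s \<ge> 0" and growth: "\<And>k. s * (\<Sum>j<Suc k. b j) \<le> (\<Sum>j<k. ln (real (card (V j)))) + C"
    and dvg: "filterlim (\<lambda>k. \<Sum>j<k. ln (real (card (V j)))) at_top sequentially"
    and E: "\<And>W. (\<And>j. W j \<in> V j) \<Longrightarrow> Pi_map T (flat W) \<in> E"
  shows "hausdorff_measure s E \<noteq> 0"
proof
  assume "hausdorff_measure s E = 0"
  then have "hausdorff_pre s (1/2) E \<le> 0"
    unfolding hausdorff_measure_def by (metis SUP_upper greaterThan_iff half_gt_zero zero_less_one)
  then have pre0: "hausdorff_pre s (1/2) E = 0" by simp
  define K0 where "K0 = 3 * exp C"
  have K0: "K0 > 0" by (simp add: K0_def)
  have "hausdorff_pre s (1/2) E < ennreal (1 / (4 * K0))" unfolding pre0 using K0 by simp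
  then obtain U where U: "E \<subseteq> (\<Union>i. U i)" "\<And>i. bounded (U i) \<and> diameter (U i) \<le> 1 / 2"
    and Usum: "(\<Sum>i. ennreal (diameter (U i) powr s)) < ennreal (1 / (4 * K0))"
    unfolding hausdorff_pre_def INF_less_iff by blast
  \<comment> \<open>These slacks add up to 1/2, and a cover of cost below
    \<open>1 / (4 * K0)\<close> contributes at most 1/4; the total 3/4 is less than 1.\<close>
  define \<eta> :: "nat \<Rightarrow> real" where "\<eta> i = (1/2)^(i+2)" for i
  have "\<exists>k Q. Q \<subseteq> PiE {..<k} V \<and> finite Q \<and>
      (\<forall>W. (\<forall>j. W j \<in> V j) \<longrightarrow> Pi_map T (flat W) \<in> U i \<longrightarrow> restrict W {..<k} \<in> Q) \<and>
      card Q * exp (- (\<Sum>j<k. ln (real (card (V j))))) \<le> K0 * diameter (U i) powr s + \<eta> i" for i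
    unfolding K0_def
    by (rule moran_cover[OF fin ne sub l D s growth dvg]) (use U(2) in \<open>auto simp: \<eta>_def\<close>)
  then obtain k Q where kQ: "\<And>i. Q i \<subseteq> PiE {..<k i} V \<and> finite (Q i) \<and>
      (\<forall>W. (\<forall>j. W j \<in> V j) \<longrightarrow> Pi_map T (flat W) \<in> U i \<longrightarrow> restrict W {..<k i} \<in> Q i) \<and>
      card (Q i) * exp (- (\<Sum>j<k i. ln (real (card (V j))))) \<le> K0 * diameter (U i) powr s + \<eta> i"
    by metis
  let ?M = "\<lambda>j. uniform_count_measure (V j)"
  interpret product_prob_space ?M UNIV
    by (rule product_prob_spaceI) (rule prob_space_uniform_count_measure[OF fin ne])
  let ?P = "PiM UNIV ?M"
  have spP: "space ?P = PiE UNIV V" by (simp add: space_PiM space_uniform_count_measure)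
  \<comment> \<open>A finite union of cylinder sets containing every choice sequence whose point
    lies in \<open>U i\<close>; measurability of \<open>U i\<close> never enters.\<close>
  define Z where "Z i = (\<Union>v\<in>Q i. prod_emb UNIV ?M {..<k i} (PiE {..<k i} (\<lambda>j. {v j})))" for i
  have Vj: "v j \<in> V j" if "v \<in> Q i" "j < k i" for i v j using kQ[of i] that by (auto simp: PiE_def Pi_def)
  have card_pos: "card (V j) > 0" for j using fin ne by (simp add: card_gt_0_iff)
  have Zm: "prod_emb UNIV ?M {..<k i} (PiE {..<k i} (\<lambda>j. {v j})) \<in> sets ?P" if "v \<in> Q i" for v i
    using Vj[OF that] by (intro sets_PiM_I) (auto simp: sets_uniform_count_measure)
  have Zsets: "Z i \<in> sets ?P" for i unfolding Z_def using kQ[of i] Zm by (intro sets.finite_UN) auto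
  have Zc: "emeasure ?P (Z i) \<le> ennreal (K0 * diameter (U i) powr s + \<eta> i)" for i
  proof -
    have one: "emeasure ?P (prod_emb UNIV ?M {..<k i} (PiE {..<k i} (\<lambda>j. {v j}))) = ennreal (exp (- (\<Sum>j<k i. ln (real (card (V j))))))" if v: "v \<in> Q i" for v
    proof -
      have "emeasure ?P (prod_emb UNIV ?M {..<k i} (PiE {..<k i} (\<lambda>j. {v j}))) = (\<Prod>j<k i. emeasure (?M j) {v j})"
        using Vj[OF v] by (intro emeasure_PiM_emb) (auto simp: sets_uniform_count_measure)
      also have "\<dots> = (\<Prod>j<k i. ennreal (1 / card (V j)))"
      proof (intro prod.cong refl)
        fix j assume "j \<in> {..<k i}"
        then have "{v j} \<subseteq> V j" using Vj[OF v] by auto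
        then have "emeasure (?M j) {v j} = ennreal (card {v j} / card (V j))"
          by (rule emeasure_uniform_count_measure[OF fin])
        then show "emeasure (?M j) {v j} = ennreal (1 / card (V j))" by simp
      qed
      also have "\<dots> = ennreal (\<Prod>j<k i. 1 / card (V j))" by (rule prod_ennreal) simp
      also have "(\<Prod>j<k i. 1 / real (card (V j))) = (\<Prod>j<k i. exp (- ln (real (card (V j)))))"
        using card_pos by (intro prod.cong refl) (simp add: exp_minus field_simps)
      also have "\<dots> = exp (- (\<Sum>j<k i. ln (real (card (V j)))))" by (simp add: exp_sum sum_negf[symmetric])
      finally show ?thesis .
    qed
    have "emeasure ?P (Z i) \<le> (\<Sum>v\<in>Q i. emeasure ?P (prod_emb UNIV ?M {..<k i} (PiE {..<k i} (\<lambda>j. {v j}))))"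
      unfolding Z_def using kQ[of i] Zm by (intro emeasure_subadditive_finite) auto
    also have "\<dots> = (\<Sum>v\<in>Q i. ennreal (exp (- (\<Sum>j<k i. ln (real (card (V j)))))))" by (intro sum.cong refl one)
    also have "\<dots> = ennreal (\<Sum>v\<in>Q i. exp (- (\<Sum>j<k i. ln (real (card (V j))))))" by (rule sum_ennreal) simp
    also have "\<dots> = ennreal (card (Q i) * exp (- (\<Sum>j<k i. ln (real (card (V j))))))" by simp
    also have "\<dots> \<le> ennreal (K0 * diameter (U i) powr s + \<eta> i)" by (rule ennreal_leI) (use kQ[of i] in blast)
    finally show ?thesis .
  qed
  have cover: "space ?P \<subseteq> (\<Union>i. Z i)"
  proof
    fix W assume W: "W \<in> space ?P"
    then have WV: "\<And>j. W j \<in> V j" by (auto simp: spP)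
    from E[OF this] U(1) obtain i where i: "Pi_map T (flat W) \<in> U i" by blast
    have "restrict W {..<k i} \<in> Q i" using kQ[of i] i WV by blast
    moreover have "W \<in> prod_emb UNIV ?M {..<k i} (PiE {..<k i} (\<lambda>j. {restrict W {..<k i} j}))"
      using W by (auto simp: prod_emb_def space_PiM)
    ultimately show "W \<in> (\<Union>i. Z i)" unfolding Z_def by blast
  qed
  have "1 = emeasure ?P (space ?P)" using emeasure_space_1 by simp
  also have "\<dots> \<le> emeasure ?P (\<Union>i. Z i)" by (rule emeasure_mono[OF cover]) (use Zsets in auto)
  also have "\<dots> \<le> (\<Sum>i. emeasure ?P (Z i))" by (rule emeasure_subadditive_countably) (use Zsets in auto)
  also have "\<dots> \<le> (\<Sum>i. ennreal (K0 * diameter (U i) powr s + \<eta> i))" by (intro suminf_le Zc) auto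
  also have "\<dots> = (\<Sum>i. ennreal K0 * ennreal (diameter (U i) powr s) + ennreal (\<eta> i))"
    using K0 by (intro suminf_cong) (simp add: ennreal_plus ennreal_mult \<eta>_def)
  also have "\<dots> = (\<Sum>i. ennreal K0 * ennreal (diameter (U i) powr s)) + (\<Sum>i. ennreal (\<eta> i))"
    by (rule suminf_add[symmetric]) auto
  also have "(\<Sum>i. ennreal K0 * ennreal (diameter (U i) powr s)) = ennreal K0 * (\<Sum>i. ennreal (diameter (U i) powr s))"
    by (rule ennreal_suminf_cmult)
  also have "(\<Sum>i. ennreal (\<eta> i)) = ennreal (1 / 2)"
  proof (rule suminf_ennreal_eq)
    have "(\<lambda>i. (1/2)^2 * (1/2)^i :: real) sums ((1/2)^2 * (1 / (1 - 1/2)))"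
      by (intro sums_mult geometric_sums) simp
    then show "\<eta> sums (1 / 2)" unfolding \<eta>_def by (simp add: power_add power2_eq_square mult.commute)
  qed (simp add: \<eta>_def)
  also have "ennreal K0 * (\<Sum>i. ennreal (diameter (U i) powr s)) + ennreal (1 / 2) \<le> ennreal K0 * ennreal (1 / (4 * K0)) + ennreal (1 / 2)"
    using Usum by (intro add_right_mono mult_left_mono) auto
  also have "\<dots> = ennreal (3 / 4)"
  proof -
    have "ennreal K0 * ennreal (1 / (4 * K0)) = ennreal (1 / 4)" using K0 by (simp add: ennreal_mult[symmetric])
    moreover have "ennreal (1 / 4) + ennreal (1 / 2) = ennreal (1 / 4 + 1 / 2)" by (rule ennreal_plus[symmetric]) auto
    moreover have "(1 / 4 + 1 / 2 :: real) = 3 / 4" by simp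
    ultimately show ?thesis by metis
  qed
  also have "\<dots> < 1" by (simp add: ennreal_less_one_iff)
  finally show False by simp
qed

end

section \<open>Typical concatenations of words\<close>

text \<open>Independent sampling is modelled by finite sums: the product of the weights
  \<open>p\<close> over a list is its probability.\<close>

definition llen :: "'a set \<Rightarrow> nat \<Rightarrow> 'a list set" where
  "llen A n = {xs. set xs \<subseteq> A \<and> length xs = n}"

lemma finite_llen: "finite A \<Longrightarrow> finite (llen A n)"
  unfolding llen_def by (rule finite_lists_length_eq)

lemma sum_llen_Suc:
  "(\<Sum>xs\<in>llen A (Suc n). F xs) = (\<Sum>a\<in>A. \<Sum>xs\<in>llen A n. F (a # xs))"
proof -
  have "llen A (Suc n) = (\<lambda>(a, xs). a # xs) ` (A \<times> llen A n)"
    by (auto simp: llen_def length_Suc_conv image_def)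
  then have "(\<Sum>xs\<in>llen A (Suc n). F xs) = (\<Sum>(a, xs)\<in>A \<times> llen A n. F (a # xs))"
    by (simp add: sum.reindex inj_on_def case_prod_beta)
  then show ?thesis by (simp add: sum.cartesian_product)
qed

lemma sum_UN_le:
  fixes F :: "'a \<Rightarrow> real"
  assumes "finite I" "\<And>i. finite (B i)" "\<And>i x. x \<in> B i \<Longrightarrow> 0 \<le> F x"
  shows "sum F (\<Union>i\<in>I. B i) \<le> (\<Sum>i\<in>I. sum F (B i))"
  using assms(1)
proof (induction I rule: finite_induct)
  case (insert i I)
  have "sum F (B i \<union> (\<Union>i\<in>I. B i)) = sum F (B i) + sum F (\<Union>i\<in>I. B i) - sum F (B i \<inter> (\<Union>i\<in>I. B i))"
    by (rule sum_Un) (use assms insert in auto)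
  moreover have "0 \<le> sum F (B i \<inter> (\<Union>i\<in>I. B i))" by (rule sum_nonneg) (use assms(3) in blast)
  ultimately show ?case using insert by simp
qed simp

context
  fixes A :: "'a set" and p :: "'a \<Rightarrow> real"
  assumes p_sum: "(\<Sum>a\<in>A. p a) = 1"
begin

lemma llen_weight: "(\<Sum>xs\<in>llen A n. prod_list (map p xs)) = 1"
proof (induction n)
  case 0
  have "llen A 0 = {[]}" by (auto simp: llen_def)
  then show ?case by simp
next
  case (Suc n)
  have "(\<Sum>xs\<in>llen A (Suc n). prod_list (map p xs)) = (\<Sum>a\<in>A. p a * (\<Sum>xs\<in>llen A n. prod_list (map p xs)))"
    by (simp add: sum_llen_Suc sum_distrib_left)
  then show ?case using Suc p_sum by simp
qed

lemma llen_mean: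
  assumes "(\<Sum>a\<in>A. p a * \<phi> a) = 0"
  shows "(\<Sum>xs\<in>llen A n. prod_list (map p xs) * sum_list (map \<phi> xs)) = 0"
proof (induction n)
  case 0
  have "llen A 0 = {[]}" by (auto simp: llen_def)
  then show ?case by simp
next
  case (Suc n)
  have "(\<Sum>xs\<in>llen A (Suc n). prod_list (map p xs) * sum_list (map \<phi> xs)) =
     (\<Sum>a\<in>A. p a * \<phi> a * (\<Sum>xs\<in>llen A n. prod_list (map p xs)) + p a * (\<Sum>xs\<in>llen A n. prod_list (map p xs) * sum_list (map \<phi> xs)))"
    unfolding sum_llen_Suc
    by (intro sum.cong refl) (simp add: sum_distrib_left sum.distrib[symmetric] algebra_simps)
  then show ?case using assms by (simp add: llen_weight Suc)
qed

text \<open>The cross terms vanish because the mean is zero, so variances add.\<close>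

lemma llen_variance:
  assumes "(\<Sum>a\<in>A. p a * \<phi> a) = 0"
  shows "(\<Sum>xs\<in>llen A n. prod_list (map p xs) * (sum_list (map \<phi> xs))\<^sup>2) = n * (\<Sum>a\<in>A. p a * (\<phi> a)\<^sup>2)"
proof (induction n)
  case 0
  have "llen A 0 = {[]}" by (auto simp: llen_def)
  then show ?case by simp
next
  case (Suc n)
  let ?P = "\<lambda>xs. prod_list (map p xs)" and ?S = "\<lambda>xs. sum_list (map \<phi> xs)"
  have "(\<Sum>xs\<in>llen A (Suc n). ?P xs * (?S xs)\<^sup>2) =
     (\<Sum>a\<in>A. p a * (\<phi> a)\<^sup>2 * (\<Sum>xs\<in>llen A n. ?P xs) + 2 * p a * \<phi> a * (\<Sum>xs\<in>llen A n. ?P xs * ?S xs)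
        + p a * (\<Sum>xs\<in>llen A n. ?P xs * (?S xs)\<^sup>2))"
    unfolding sum_llen_Suc
    by (intro sum.cong refl) (simp add: sum_distrib_left sum.distrib[symmetric] power2_eq_square algebra_simps)
  also have "\<dots> = (\<Sum>a\<in>A. p a * (\<phi> a)\<^sup>2) + (\<Sum>a\<in>A. p a) * (n * (\<Sum>a\<in>A. p a * (\<phi> a)\<^sup>2))"
    by (simp add: llen_weight llen_mean[OF assms] Suc sum.distrib sum_distrib_right)
  finally show ?case using p_sum by (simp add: algebra_simps)
qed

lemma llen_chebyshev:
  assumes A: "finite A" and pn: "\<And>a. a \<in> A \<Longrightarrow> 0 \<le> p a" and d: "d > 0" and n: "n \<ge> 1"
  shows "(\<Sum>xs | xs \<in> llen A n \<and> \<bar>sum_list (map \<phi> xs) - n * (\<Sum>a\<in>A. p a * \<phi> a)\<bar> > n * d. prod_list (map p xs))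
     \<le> (\<Sum>a\<in>A. p a * (\<phi> a - (\<Sum>a\<in>A. p a * \<phi> a))\<^sup>2) / (n * d\<^sup>2)"
proof -
  define E where "E = (\<Sum>a\<in>A. p a * \<phi> a)"
  define \<psi> where "\<psi> a = \<phi> a - E" for a
  let ?P = "\<lambda>xs. prod_list (map p xs)"
  have P0: "0 \<le> ?P xs" if "xs \<in> llen A n" for xs n
    using that pn by (intro prod_list_nonneg) (auto simp: llen_def subset_iff)
  have z: "(\<Sum>a\<in>A. p a * \<psi> a) = 0"
  proof -
    have "(\<Sum>a\<in>A. p a * \<psi> a) = (\<Sum>a\<in>A. p a * \<phi> a) - (\<Sum>a\<in>A. p a) * E"
      by (simp add: \<psi>_def right_diff_distrib sum_subtractf sum_distrib_right)
    then show ?thesis using p_sum by (simp add: E_def)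
  qed
  have S: "sum_list (map \<psi> xs) = sum_list (map \<phi> xs) - length xs * E" for xs
    by (induction xs) (auto simp: \<psi>_def algebra_simps)
  let ?B = "{xs. xs \<in> llen A n \<and> \<bar>sum_list (map \<phi> xs) - n * E\<bar> > n * d}"
  have "(n * d)\<^sup>2 * (\<Sum>xs\<in>?B. ?P xs) \<le> (\<Sum>xs\<in>?B. ?P xs * (sum_list (map \<psi> xs))\<^sup>2)"
    unfolding sum_distrib_left
  proof (rule sum_mono)
    fix xs assume xs: "xs \<in> ?B"
    then have l: "length xs = n" by (simp add: llen_def)
    have "(n * d)\<^sup>2 \<le> (sum_list (map \<psi> xs))\<^sup>2"
      using xs d unfolding S l by (intro abs_le_square_iff[THEN iffD1]) auto
    then have "?P xs * (n * d)\<^sup>2 \<le> ?P xs * (sum_list (map \<psi> xs))\<^sup>2"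
      using P0 xs by (intro mult_left_mono) auto
    then show "(n * d)\<^sup>2 * ?P xs \<le> ?P xs * (sum_list (map \<psi> xs))\<^sup>2" by (simp add: mult.commute)
  qed
  also have "\<dots> \<le> (\<Sum>xs\<in>llen A n. ?P xs * (sum_list (map \<psi> xs))\<^sup>2)"
    using P0 by (intro sum_mono2 finite_llen A) auto
  also have "\<dots> = n * (\<Sum>a\<in>A. p a * (\<psi> a)\<^sup>2)" by (rule llen_variance[OF z])
  finally have "(\<Sum>xs\<in>?B. ?P xs) \<le> n * (\<Sum>a\<in>A. p a * (\<psi> a)\<^sup>2) / (n * d)\<^sup>2"
    using n d by (simp add: pos_le_divide_eq mult.commute)
  also have "\<dots> = (\<Sum>a\<in>A. p a * (\<psi> a)\<^sup>2) / (n * d\<^sup>2)"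
    using n d by (simp add: power2_eq_square field_simps)
  finally show ?thesis unfolding \<psi>_def E_def .
qed

text \<open>Chebyshev's inequality for each of finitely many statistics and a union bound;
  \<open>N\<close> makes the total probability of failure at most 1/2.\<close>

lemma typical_lists:
  fixes \<phi> :: "'i \<Rightarrow> 'a \<Rightarrow> real"
  assumes A: "finite A" and pn: "\<And>a. a \<in> A \<Longrightarrow> 0 \<le> p a" and d: "d > 0" and I: "finite I"
  shows "\<exists>N. \<forall>n\<ge>N. (\<Sum>xs | xs \<in> llen A n \<and> (\<forall>i\<in>I. \<bar>sum_list (map (\<phi> i) xs) - n * (\<Sum>a\<in>A. p a * \<phi> i a)\<bar> \<le> n * d). prod_list (map p xs)) \<ge> 1 / 2"
proof -
  let ?P = "\<lambda>xs. prod_list (map p xs)"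
  define v where "v i = (\<Sum>a\<in>A. p a * (\<phi> i a - (\<Sum>a\<in>A. p a * \<phi> i a))\<^sup>2)" for i
  obtain N :: nat where N: "real N > 2 * (\<Sum>i\<in>I. v i) / d\<^sup>2" using reals_Archimedean2[of "2 * (\<Sum>i\<in>I. v i) / d\<^sup>2"] by blast
  have "(\<Sum>xs | xs \<in> llen A n \<and> (\<forall>i\<in>I. \<bar>sum_list (map (\<phi> i) xs) - n * (\<Sum>a\<in>A. p a * \<phi> i a)\<bar> \<le> n * d). ?P xs) \<ge> 1 / 2"
    if n: "n \<ge> max N 1" for n
  proof -
    have P0: "0 \<le> ?P xs" if "xs \<in> llen A n" for xs
      using that pn by (intro prod_list_nonneg) (auto simp: llen_def subset_iff)
    define B where "B i = {xs. xs \<in> llen A n \<and> \<bar>sum_list (map (\<phi> i) xs) - n * (\<Sum>a\<in>A. p a * \<phi> i a)\<bar> > n * d}" for i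
    define G where "G = {xs. xs \<in> llen A n \<and> (\<forall>i\<in>I. \<bar>sum_list (map (\<phi> i) xs) - n * (\<Sum>a\<in>A. p a * \<phi> i a)\<bar> \<le> n * d)}"
    have fB: "finite (B i)" for i unfolding B_def using finite_llen[OF A] by simp
    have fG: "finite G" unfolding G_def using finite_llen[OF A] by simp
    have "1 = (\<Sum>xs\<in>llen A n. ?P xs)" by (rule llen_weight[symmetric])
    also have "llen A n = G \<union> (\<Union>i\<in>I. B i)" unfolding G_def B_def by (auto simp: not_le)
    also have "(\<Sum>xs\<in>G \<union> (\<Union>i\<in>I. B i). ?P xs) \<le> (\<Sum>xs\<in>G. ?P xs) + (\<Sum>xs\<in>(\<Union>i\<in>I. B i). ?P xs)"
    proof -
      have "0 \<le> (\<Sum>xs\<in>G \<inter> (\<Union>i\<in>I. B i). ?P xs)" by (rule sum_nonneg) (use P0 in \<open>auto simp: G_def\<close>)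
      then show ?thesis using sum.union_inter[OF fG, of "\<Union>i\<in>I. B i" ?P] I fB by simp
    qed
    also have "(\<Sum>xs\<in>(\<Union>i\<in>I. B i). ?P xs) \<le> (\<Sum>i\<in>I. \<Sum>xs\<in>B i. ?P xs)"
      by (rule sum_UN_le[OF I fB]) (use P0 in \<open>auto simp: B_def\<close>)
    also have "\<dots> \<le> (\<Sum>i\<in>I. v i / (n * d\<^sup>2))"
      unfolding B_def v_def by (intro sum_mono llen_chebyshev A pn d) (use n in auto)
    also have "\<dots> = (\<Sum>i\<in>I. v i) / (n * d\<^sup>2)" by (simp add: sum_divide_distrib)
    also have "\<dots> \<le> 1 / 2"
    proof -
      have "2 * (\<Sum>i\<in>I. v i) / d\<^sup>2 \<le> n" using N n by linarith
      then show ?thesis using n d by (simp add: field_simps)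
    qed
    finally show ?thesis unfolding G_def by simp
  qed
  then show ?thesis by blast
qed

end

section \<open>Birkhoff sums\<close>

definition bsum :: "((nat \<Rightarrow> nat) \<Rightarrow> real) \<Rightarrow> nat \<Rightarrow> (nat \<Rightarrow> nat) \<Rightarrow> real" where
  "bsum f n \<omega> = (\<Sum>i<n. f ((shift ^^ i) \<omega>))"

lemma bsum_add: "bsum f (n + k) \<omega> = bsum f n \<omega> + bsum f k ((shift ^^ n) \<omega>)"
proof -
  have "(\<Sum>i<n + k. f ((shift ^^ i) \<omega>)) = (\<Sum>i<n. f ((shift ^^ i) \<omega>)) + (\<Sum>i<k. f ((shift ^^ (n + i)) \<omega>))"
    by (induction k) auto
  moreover have "(shift ^^ (n + i)) \<omega> = (shift ^^ i) ((shift ^^ n) \<omega>)" for i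
    by (simp add: shift_pow add.commute add.left_commute)
  ultimately show ?thesis unfolding bsum_def by simp
qed

lemma UC_shift:
  assumes "UC m f"
  shows "UC m (\<lambda>\<omega>. f ((shift ^^ i) \<omega>))"
  unfolding UC_def
proof (intro allI impI)
  fix e :: real assume "e > 0"
  from UC_obtain[OF assms this] obtain K where
    K: "\<And>\<omega> \<omega>'. \<omega> \<in> Sig m \<Longrightarrow> \<omega>' \<in> Sig m \<Longrightarrow> pref K \<omega> = pref K \<omega>' \<Longrightarrow> \<bar>f \<omega> - f \<omega>'\<bar> < e" by auto
  show "\<exists>K. \<forall>\<omega>\<in>Sig m. \<forall>\<omega>'\<in>Sig m. pref K \<omega> = pref K \<omega>' \<longrightarrow> \<bar>f ((shift ^^ i) \<omega>) - f ((shift ^^ i) \<omega>')\<bar> < e"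
  proof (intro exI[of _ "i + K"] ballI impI)
    fix \<omega> \<omega>' assume w: "\<omega> \<in> Sig m" "\<omega>' \<in> Sig m" "pref (i + K) \<omega> = pref (i + K) \<omega>'"
    have "pref K ((shift ^^ i) \<omega>) = pref K ((shift ^^ i) \<omega>')" using w(3) by (simp add: pref_append)
    then show "\<bar>f ((shift ^^ i) \<omega>) - f ((shift ^^ i) \<omega>')\<bar> < e"
      by (rule K[OF shift_pow_Sig[OF w(1)] shift_pow_Sig[OF w(2)]])
  qed
qed

lemma UC_add:
  assumes "UC m f" "UC m h"
  shows "UC m (\<lambda>\<omega>. f \<omega> + h \<omega>)"
  unfolding UC_def
proof (intro allI impI)
  fix e :: real assume "e > 0"
  then have e2: "e / 2 > 0" by simp
  from UC_obtain[OF assms(1) e2] obtain K where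
    K: "\<And>\<omega> \<omega>'. \<omega> \<in> Sig m \<Longrightarrow> \<omega>' \<in> Sig m \<Longrightarrow> pref K \<omega> = pref K \<omega>' \<Longrightarrow> \<bar>f \<omega> - f \<omega>'\<bar> < e / 2" by auto
  from UC_obtain[OF assms(2) e2] obtain L where
    L: "\<And>\<omega> \<omega>'. \<omega> \<in> Sig m \<Longrightarrow> \<omega>' \<in> Sig m \<Longrightarrow> pref L \<omega> = pref L \<omega>' \<Longrightarrow> \<bar>h \<omega> - h \<omega>'\<bar> < e / 2" by auto
  show "\<exists>K. \<forall>\<omega>\<in>Sig m. \<forall>\<omega>'\<in>Sig m. pref K \<omega> = pref K \<omega>' \<longrightarrow> \<bar>f \<omega> + h \<omega> - (f \<omega>' + h \<omega>')\<bar> < e"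
  proof (intro exI[of _ "max K L"] ballI impI)
    fix \<omega> \<omega>' assume w: "\<omega> \<in> Sig m" "\<omega>' \<in> Sig m" "pref (max K L) \<omega> = pref (max K L) \<omega>'"
    then have "pref K \<omega> = pref K \<omega>'" "pref L \<omega> = pref L \<omega>'" by (auto simp: pref_eq_iff)
    then show "\<bar>f \<omega> + h \<omega> - (f \<omega>' + h \<omega>')\<bar> < e" using K[OF w(1,2)] L[OF w(1,2)] by linarith
  qed
qed

lemma UC_bsum:
  assumes "UC m f"
  shows "UC m (bsum f n)"
proof (induction n)
  case 0
  show ?case by (simp add: UC_def bsum_def)
next
  case (Suc n)
  have "bsum f (Suc n) = (\<lambda>\<omega>. bsum f n \<omega> + f ((shift ^^ n) \<omega>))" by (auto simp: bsum_def)
  then show ?case using UC_add[OF Suc UC_shift[OF assms]] by simp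
qed

lemma inv_distr:
  assumes "\<mu> \<in> inv_measures m"
  shows "distr \<mu> (SigM m) shift = \<mu>"
proof (rule measure_eqI)
  note D = inv_measuresD[OF assms]
  show "sets (distr \<mu> (SigM m) shift) = sets \<mu>" using D by simp
  fix A assume "A \<in> sets (distr \<mu> (SigM m) shift)"
  then have A: "A \<in> sets (SigM m)" by simp
  have "shift \<in> measurable \<mu> (SigM m)" using measurable_shift D(2) by (simp cong: measurable_cong_sets)
  then have "emeasure (distr \<mu> (SigM m) shift) A = emeasure \<mu> (shift -` A \<inter> space \<mu>)"
    using A by (rule emeasure_distr)
  then show "emeasure (distr \<mu> (SigM m) shift) A = emeasure \<mu> A"
    using assms A D(2) by (auto simp: inv_measures_def)
qed

lemma integral_shift:
  assumes \<mu>: "\<mu> \<in> inv_measures m" and f: "UC m f" and m: "m \<ge> 1"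
  shows "(\<integral>\<omega>. f ((shift ^^ i) \<omega>) \<partial>\<mu>) = integral\<^sup>L \<mu> f"
proof (induction i)
  case (Suc i)
  note D = inv_measuresD[OF \<mu>]
  have s: "shift \<in> measurable \<mu> (SigM m)" using measurable_shift D(2) by (simp cong: measurable_cong_sets)
  have "(\<integral>\<omega>. f ((shift ^^ i) \<omega>) \<partial>(distr \<mu> (SigM m) shift)) = (\<integral>\<omega>. f ((shift ^^ i) (shift \<omega>)) \<partial>\<mu>)"
    by (rule integral_distr[OF s UC_measurable[OF UC_shift[OF f] m refl]])
  then show ?case using Suc by (simp add: inv_distr[OF \<mu>] funpow_swap1)
qed simp

lemma integral_bsum:
  assumes \<mu>: "\<mu> \<in> inv_measures m" and f: "UC m f" and m: "m \<ge> 1"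
  shows "integral\<^sup>L \<mu> (bsum f n) = n * integral\<^sup>L \<mu> f"
proof -
  note D = inv_measuresD[OF \<mu>]
  have "integral\<^sup>L \<mu> (bsum f n) = (\<Sum>i<n. \<integral>\<omega>. f ((shift ^^ i) \<omega>) \<partial>\<mu>)"
    unfolding bsum_def[abs_def]
    by (intro Bochner_Integration.integral_sum UC_integrable[OF UC_shift[OF f] m D(2,1)])
  then show ?thesis by (simp add: integral_shift[OF assms])
qed

text \<open>The value \<open>\<phi> w\<close> attached to a word replaces the Birkhoff sum over that
  word. The error \<open>c\<close> per word accounts for the dependence of the function on symbols
  beyond the end of the word.\<close>

lemma bsum_concat:
  fixes c :: real
  assumes c: "\<And>\<omega> w. \<omega> \<in> Sig m \<Longrightarrow> w \<in> A \<Longrightarrow> pref n \<omega> = w \<Longrightarrow> \<bar>bsum f n \<omega> - \<phi> w\<bar> \<le> c"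
    and A: "A \<subseteq> words m n"
  shows "set xs \<subseteq> A \<Longrightarrow> \<omega> \<in> Sig m \<Longrightarrow> pref (length xs * n) \<omega> = concat xs \<Longrightarrow>
    \<bar>bsum f (length xs * n) \<omega> - sum_list (map \<phi> xs)\<bar> \<le> length xs * c"
proof (induction xs arbitrary: \<omega>)
  case Nil
  then show ?case by (simp add: bsum_def)
next
  case (Cons w xs)
  have w: "w \<in> A" and lw: "length w = n" using Cons.prems A by (auto simp: words_def)
  have "pref n \<omega> @ pref (length xs * n) ((shift ^^ n) \<omega>) = w @ concat xs"
    using Cons.prems(3) by (simp add: pref_append)
  then have 1: "pref n \<omega> = w" and 2: "pref (length xs * n) ((shift ^^ n) \<omega>) = concat xs"
    using lw by (auto simp: append_eq_append_conv)
  have "bsum f (length (w # xs) * n) \<omega> = bsum f n \<omega> + bsum f (length xs * n) ((shift ^^ n) \<omega>)"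
    by (simp add: bsum_add)
  moreover have "\<bar>bsum f n \<omega> - \<phi> w\<bar> \<le> c" by (rule c[OF Cons.prems(2) w 1])
  moreover have "\<bar>bsum f (length xs * n) ((shift ^^ n) \<omega>) - sum_list (map \<phi> xs)\<bar> \<le> length xs * c"
    by (rule Cons.IH[OF _ shift_pow_Sig[OF Cons.prems(2)] 2]) (use Cons.prems in auto)
  ultimately show ?case by (simp add: algebra_simps)
qed

lemma length_concat_const: "(\<And>w. w \<in> set xs \<Longrightarrow> length w = n) \<Longrightarrow> length (concat xs) = length xs * n"
  by (induction xs) auto

lemma inj_on_concat: "(\<And>w. w \<in> A \<Longrightarrow> length w = n) \<Longrightarrow> inj_on concat (llen A N)"
proof (rule inj_onI)
  fix xs ys assume l: "\<And>w. w \<in> A \<Longrightarrow> length w = n" and xy: "xs \<in> llen A N" "ys \<in> llen A N" "concat xs = concat ys"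
  show "xs = ys"
  proof (rule concat_injective[OF xy(3)])
    show "length xs = length ys" using xy by (simp add: llen_def)
    have "length x = n \<and> length y = n" if "(x, y) \<in> set (zip xs ys)" for x y
      using l set_zip_leftD[OF that] set_zip_rightD[OF that] xy(1,2) unfolding llen_def by blast
    then show "\<forall>(x, y)\<in>set (zip xs ys). length x = length y" by auto
  qed
qed

text \<open>Three statistics of words of length \<open>n\<close> are controlled together:
  \<open>- ln p\<close>, whose mean is the cylinder entropy, and the Birkhoff sums of
  \<open>f\<close> and \<open>g\<close>. A typical list has weight at most
  \<open>exp (- (N * (n * h) - N * d))\<close> and typical lists have total weight at least 1/2,
  which bounds their number from below. The rate \<open>h\<close> is an arbitrary lower bound on
  cylinder entropies, so that mixtures can be used without computing their entropy.\<close>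

lemma typical_words:
  fixes e h :: real
  assumes \<mu>: "\<mu> \<in> inv_measures m" and m: "m \<ge> 1" and f: "UC m f" and g: "UC m g"
    and H: "\<And>n. n * h \<le> Hn m (law m \<mu>) n" and e: "e > 0"
  obtains l V where "l \<ge> l0" "l \<ge> 1" "V \<subseteq> words m l" "V \<noteq> {}" "ln (real (card V)) \<ge> l * (h - e)"
    "\<And>\<omega>. \<omega> \<in> Sig m \<Longrightarrow> pref l \<omega> \<in> V \<Longrightarrow> \<bar>bsum f l \<omega> - l * integral\<^sup>L \<mu> f\<bar> \<le> l * e"
    "\<And>\<omega>. \<omega> \<in> Sig m \<Longrightarrow> pref l \<omega> \<in> V \<Longrightarrow> \<bar>bsum g l \<omega> - l * integral\<^sup>L \<mu> g\<bar> \<le> l * e"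
proof -
  note D = inv_measuresD[OF \<mu>]
  have law: "is_law m (law m \<mu>)" by (rule law_is_law[OF \<mu>])
  have e4: "e / 4 > 0" using e by simp
  obtain Nf where Nf: "\<And>n \<omega> \<omega>'. n \<ge> Nf \<Longrightarrow> \<omega> \<in> Sig m \<Longrightarrow> \<omega>' \<in> Sig m \<Longrightarrow> pref n \<omega> = pref n \<omega>' \<Longrightarrow>
     \<bar>bsum f n \<omega> - bsum f n \<omega>'\<bar> \<le> n * (e / 4)"
    using UC_shift_sum[OF f e4] unfolding bsum_def by metis
  obtain Ng where Ng: "\<And>n \<omega> \<omega>'. n \<ge> Ng \<Longrightarrow> \<omega> \<in> Sig m \<Longrightarrow> \<omega>' \<in> Sig m \<Longrightarrow> pref n \<omega> = pref n \<omega>' \<Longrightarrow>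
     \<bar>bsum g n \<omega> - bsum g n \<omega>'\<bar> \<le> n * (e / 4)"
    using UC_shift_sum[OF g e4] unfolding bsum_def by metis
  define n where "n = max 1 (max Nf Ng)"
  have n1: "n \<ge> 1" by (simp add: n_def)
  have nf: "\<bar>bsum f n \<omega> - bsum f n \<omega>'\<bar> \<le> n * (e / 4)" if "\<omega> \<in> Sig m" "\<omega>' \<in> Sig m" "pref n \<omega> = pref n \<omega>'" for \<omega> \<omega>'
    by (rule Nf[OF _ that]) (simp add: n_def)
  have ng: "\<bar>bsum g n \<omega> - bsum g n \<omega>'\<bar> \<le> n * (e / 4)" if "\<omega> \<in> Sig m" "\<omega>' \<in> Sig m" "pref n \<omega> = pref n \<omega>'" for \<omega> \<omega>'
    by (rule Ng[OF _ that]) (simp add: n_def)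
  define p where "p = law m \<mu>"
  \<comment> \<open>Words of probability zero are dropped to keep \<open>ln (p w)\<close>
    meaningful; they change none of the weighted sums.\<close>
  define A where "A = {w \<in> words m n. p w > 0}"
  have pn: "0 \<le> p w" for w using law by (simp add: p_def is_law_def)
  have fA: "finite A" by (simp add: A_def)
  have sumA: "(\<Sum>w\<in>A. p w * F w) = (\<Sum>w\<in>words m n. p w * F w)" for F
    by (rule sum.mono_neutral_left) (use pn in \<open>auto simp: A_def order.order_iff_strict\<close>)
  have pA: "(\<Sum>w\<in>A. p w) = 1" using sumA[of "\<lambda>_. 1"] is_law_sum[OF law, of n] by (simp add: p_def)
  define \<phi> where "\<phi> i = (if i = 0 then (\<lambda>w. - ln (p w)) else if i = 1 then (\<lambda>w. bsum f n (pt w)) else (\<lambda>w. bsum g n (pt w)))" for i :: nat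
  have \<phi>s: "\<phi> 0 = (\<lambda>w. - ln (p w))" "\<phi> 1 = (\<lambda>w. bsum f n (pt w))" "\<phi> 2 = (\<lambda>w. bsum g n (pt w))" by (auto simp: \<phi>_def)
  \<comment> \<open>Three errors of size \<open>d\<close> occur per word: the deviation allowed for
    typical lists, the replacement of the integral by a cylinder sum, and the variation of the
    Birkhoff sum on a cylinder. Together they stay below \<open>e\<close> per symbol.\<close>
  define d where "d = n * (e / 4)"
  have d: "d > 0" using n1 e by (simp add: d_def)
  have E0: "(\<Sum>w\<in>A. p w * \<phi> 0 w) = Hn m p n" unfolding sumA \<phi>s Hn_def eta_def by (simp add: sum_negf)
  have E1: "\<bar>(\<Sum>w\<in>A. p w * \<phi> 1 w) - n * integral\<^sup>L \<mu> f\<bar> \<le> d"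
    using integral_cyl_sum[OF \<mu> UC_bsum[OF f, of n] m, of n "n * (e/4)"] nf
    unfolding sumA unfolding \<phi>s cyl_sum_def p_def d_def integral_bsum[OF \<mu> f m] by (simp add: abs_minus_commute)
  have E2: "\<bar>(\<Sum>w\<in>A. p w * \<phi> 2 w) - n * integral\<^sup>L \<mu> g\<bar> \<le> d"
    using integral_cyl_sum[OF \<mu> UC_bsum[OF g, of n] m, of n "n * (e/4)"] ng
    unfolding sumA unfolding \<phi>s cyl_sum_def p_def d_def integral_bsum[OF \<mu> g m] by (simp add: abs_minus_commute)
  obtain N0 where N0: "\<And>N. N \<ge> N0 \<Longrightarrow> (\<Sum>xs | xs \<in> llen A N \<and> (\<forall>i\<in>{0,1,2}. \<bar>sum_list (map (\<phi> i) xs) - N * (\<Sum>a\<in>A. p a * \<phi> i a)\<bar> \<le> N * d). prod_list (map p xs)) \<ge> 1 / 2"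
    using typical_lists[OF pA fA pn d, of "{0,1,2}" \<phi>] by auto
  \<comment> \<open>With \<open>N \<ge> 2 * N1\<close> the loss \<open>ln 2\<close>, caused by the
    weight 1/2 of the typical lists, is at most \<open>e / 2\<close> per symbol.\<close>
  obtain N1 :: nat where N1: "real N1 > ln 2 / e" using reals_Archimedean2[of "ln 2 / e"] by blast
  define N where "N = max (max N0 l0) (max 1 (2 * N1))"
  have N: "N \<ge> N0" "N \<ge> l0" "N \<ge> 1" "N \<ge> 2 * N1" by (auto simp: N_def)
  define G where "G = {xs. xs \<in> llen A N \<and> (\<forall>i\<in>{0,1,2}. \<bar>sum_list (map (\<phi> i) xs) - N * (\<Sum>a\<in>A. p a * \<phi> i a)\<bar> \<le> N * d)}"
  have G: "(\<Sum>xs\<in>G. prod_list (map p xs)) \<ge> 1 / 2" using N0[OF N(1)] by (simp add: G_def)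
  have fG: "finite G" unfolding G_def using finite_llen[OF fA] by simp
  have Gl: "set xs \<subseteq> A" "length xs = N" "\<bar>sum_list (map (\<phi> i) xs) - N * (\<Sum>a\<in>A. p a * \<phi> i a)\<bar> \<le> N * d" if "xs \<in> G" "i \<in> {0,1,2}" for xs i
    using that unfolding G_def llen_def by blast+
  have Aw: "length w = n" "set w \<subseteq> {1..m}" if "w \<in> A" for w using that by (auto simp: A_def words_def)
  define V where "V = concat ` G"
  define l where "l = N * n"
  have cV: "card V = card G"
    unfolding V_def by (intro card_image inj_on_subset[OF inj_on_concat[of A n N]]) (use Aw in \<open>auto simp: G_def\<close>)
  have Gne: "G \<noteq> {}" using G by auto
  show thesis
  proof (rule that)
    show "l \<ge> l0" "l \<ge> 1" using N n1 by (auto simp: l_def intro: order_trans[of l0 N] simp: )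
    show "V \<subseteq> words m l"
    proof
      fix v assume "v \<in> V"
      then obtain xs where xs: "xs \<in> G" "v = concat xs" by (auto simp: V_def)
      have "length v = l" unfolding xs(2) l_def
        using length_concat_const[of xs n] Gl(1,2)[OF xs(1), of 0] Aw(1) by auto
      moreover have "set v \<subseteq> {1..m}" unfolding xs(2) using Gl(1)[OF xs(1), of 0] Aw(2) by fastforce
      ultimately show "v \<in> words m l" by (simp add: words_def)
    qed
    show "V \<noteq> {}" using Gne by (simp add: V_def)
    have "1 / 2 \<le> (\<Sum>xs\<in>G. prod_list (map p xs))" by (rule G)
    also have "\<dots> \<le> (\<Sum>xs\<in>G. exp (- (N * (n * h) - N * d)))"
    proof (rule sum_mono)
      fix xs assume xs: "xs \<in> G"
      have "prod_list (map p xs) = exp (- sum_list (map (\<phi> 0) xs))" if "set xs \<subseteq> A" for xs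
        using that
      proof (induction xs)
        case (Cons w xs)
        then have "p w > 0" by (simp add: A_def)
        then show ?case using Cons by (simp add: \<phi>s exp_diff exp_minus divide_inverse)
      qed simp
      then have "prod_list (map p xs) = exp (- sum_list (map (\<phi> 0) xs))" using Gl(1)[OF xs, of 0] by simp
      also have "\<dots> \<le> exp (- (N * (n * h) - N * d))"
      proof -
        have "N * (n * h) \<le> N * Hn m p n" using H[of n] by (intro mult_left_mono) (auto simp: p_def)
        then show ?thesis using Gl(3)[OF xs, of 0] unfolding E0 by simp
      qed
      finally show "prod_list (map p xs) \<le> exp (- (N * (n * h) - N * d))" .
    qed
    also have "\<dots> = card V * exp (- (N * (n * h) - N * d))" by (simp add: cV)
    finally have "1 / 2 \<le> card V * exp (- (N * (n * h) - N * d))" .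
    then have "exp (N * (n * h) - N * d) * (1 / 2) \<le> exp (N * (n * h) - N * d) * (card V * exp (- (N * (n * h) - N * d)))"
      by (intro mult_left_mono) auto
    also have "\<dots> = card V" unfolding exp_minus by simp
    finally have "exp (N * (n * h) - N * d) / 2 \<le> card V" by simp
    moreover have cp: "card V > 0" using cV Gne fG by (simp add: card_gt_0_iff)
    ultimately have "ln (exp (N * (n * h) - N * d) / 2) \<le> ln (card V)" by (subst ln_le_cancel_iff) auto
    then have "N * (n * h) - N * d - ln 2 \<le> ln (card V)" by (simp add: ln_div)
    moreover have "ln 2 \<le> N * (n * (e / 2))"
    proof -
      have "ln 2 \<le> N1 * e" using N1 e by (simp add: field_simps)
      also have "\<dots> \<le> (N / 2) * e" using N(4) e by (intro mult_right_mono) auto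
      also have "\<dots> = N * (1 * (e / 2))" by simp
      also have "\<dots> \<le> N * (n * (e / 2))" using n1 e by (intro mult_left_mono mult_right_mono) auto
      finally show ?thesis .
    qed
    moreover have "0 \<le> N * (n * (e / 4))" using e by simp
    ultimately show "ln (real (card V)) \<ge> l * (h - e)" unfolding l_def d_def by (simp add: algebra_simps)
    have approx: "\<bar>bsum F l \<omega> - l * I\<bar> \<le> l * e"
      if \<omega>: "\<omega> \<in> Sig m" "pref l \<omega> \<in> V" and i: "i \<in> {0,1,2}" "\<phi> i = (\<lambda>w. bsum F n (pt w))"
        and E: "\<bar>(\<Sum>w\<in>A. p w * \<phi> i w) - n * I\<bar> \<le> d"
        and nF: "\<And>\<omega> \<omega>'. \<omega> \<in> Sig m \<Longrightarrow> \<omega>' \<in> Sig m \<Longrightarrow> pref n \<omega> = pref n \<omega>' \<Longrightarrow> \<bar>bsum F n \<omega> - bsum F n \<omega>'\<bar> \<le> n * (e / 4)"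
      for \<omega> F i and I :: real
    proof -
      obtain xs where xs: "xs \<in> G" "pref l \<omega> = concat xs" using \<omega>(2) by (auto simp: V_def)
      note L = Gl[OF xs(1) i(1)]
      have "\<bar>bsum F (length xs * n) \<omega> - sum_list (map (\<phi> i) xs)\<bar> \<le> length xs * d"
      proof (rule bsum_concat[where m = m and A = A and n = n and \<phi> = "\<phi> i" and f = F and c = d])
        fix \<omega> w assume "\<omega> \<in> Sig m" "w \<in> A" "pref n \<omega> = w"
        moreover from this have "pt w \<in> Sig m" using pt_Sig[OF _ m] by (auto simp: A_def)
        ultimately show "\<bar>bsum F n \<omega> - \<phi> i w\<bar> \<le> d"
          unfolding i(2) d_def by (intro nF) (auto dest: Aw)
      qed (use L xs \<omega> in \<open>auto simp: A_def l_def\<close>)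
      then have 1: "\<bar>bsum F l \<omega> - sum_list (map (\<phi> i) xs)\<bar> \<le> N * d" using L(2) by (simp add: l_def)
      have 2: "\<bar>N * (\<Sum>w\<in>A. p w * \<phi> i w) - N * (n * I)\<bar> \<le> N * d"
        using mult_left_mono[OF E, of "real N"] by (simp add: abs_mult flip: right_diff_distrib)
      have "3 * (N * d) \<le> l * e" unfolding d_def l_def using e by simp
      moreover have "real l * I = N * (n * I)" by (simp add: l_def)
      ultimately show ?thesis using 1 2 L(3) by linarith
    qed
    show "\<bar>bsum f l \<omega> - l * integral\<^sup>L \<mu> f\<bar> \<le> l * e" if "\<omega> \<in> Sig m" "pref l \<omega> \<in> V" for \<omega>
      by (rule approx[OF that _ \<phi>s(2) E1]) (use nf in auto)
    show "\<bar>bsum g l \<omega> - l * integral\<^sup>L \<mu> g\<bar> \<le> l * e" if "\<omega> \<in> Sig m" "pref l \<omega> \<in> V" for \<omega>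
      by (rule approx[OF that _ \<phi>s(3) E2]) (use ng in auto)
  qed
qed

section \<open>Lower bounds for the dimension of level sets\<close>

text \<open>A parameter is allowed to advance only when its cost \<open>F\<close> can be afforded.
  The constant \<open>C\<close> makes the parameter 0 affordable from the start.\<close>

lemma slow_sequence:
  fixes F :: "nat \<Rightarrow> real"
  obtains \<kappa> :: "nat \<Rightarrow> nat" and C :: real where "\<And>k. F (\<kappa> k) \<le> real k + C" "filterlim \<kappa> at_top sequentially" "C \<ge> 0"
proof -
  define C where "C = max 0 (F 0)"
  define S where "S k = {i. i \<le> k \<and> F i \<le> k + C}" for k :: nat
  define \<kappa> where "\<kappa> k = Max (S k)" for k
  have fS: "finite (S k)" and "0 \<in> S k" for k unfolding S_def C_def by auto
  then have "\<kappa> k \<in> S k" for k unfolding \<kappa>_def by (intro Max_in) auto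
  then have 1: "F (\<kappa> k) \<le> k + C" for k by (simp add: S_def)
  have 2: "filterlim \<kappa> at_top sequentially"
    unfolding filterlim_at_top
  proof
    fix i
    obtain N :: nat where N: "F i \<le> N" using real_arch_simple by blast
    have "i \<le> \<kappa> k" if "k \<ge> max N i" for k
      unfolding \<kappa>_def by (rule Max_ge[OF fS]) (use that N in \<open>auto simp: S_def C_def\<close>)
    then show "\<forall>\<^sub>F k in sequentially. i \<le> \<kappa> k" unfolding eventually_sequentially by blast
  qed
  show thesis by (rule that[OF 1 2]) (simp add: C_def)
qed

lemma birk_avg_eq: "birk_avg f n \<omega> = bsum f n \<omega> / n"
  by (simp add: birk_avg_def bsum_def)

text \<open>Over complete blocks the error is a length-weighted mean of the
  \<open>\<epsilon> j\<close>, hence negligible in the limit. When \<open>k\<close> blocks are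
  complete, \<open>n \<ge> k\<close>, and \<open>slow\<close> makes the unfinished block short in
  comparison with \<open>n\<close>.\<close>

lemma flat_level_set:
  fixes l :: "nat \<Rightarrow> nat" and \<alpha> C :: real and \<epsilon> :: "nat \<Rightarrow> real"
  assumes f: "UC m f"
    and l: "\<And>j. l j \<ge> 1" and W: "\<And>j. W j \<in> words m (l j)"
    and blocks: "\<And>j \<omega>. \<omega> \<in> Sig m \<Longrightarrow> pref (l j) \<omega> = W j \<Longrightarrow> \<bar>bsum f (l j) \<omega> - l j * \<alpha>\<bar> \<le> l j * \<epsilon> j"
    and eps: "\<epsilon> \<longlonglongrightarrow> 0" and slow: "\<And>k. l k \<le> (k + C) * \<epsilon> k" and C: "C \<ge> 0" and eps0: "\<And>k. 0 \<le> \<epsilon> k"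
  shows "flat W \<in> level_set m f \<alpha>"
proof -
  let ?\<omega> = "flat W"
  have lW: "length (W j) = l j" for j using W[of j] by (simp add: words_def)
  have l1: "length (W j) \<ge> 1" for j using l lW by simp
  have \<omega>: "?\<omega> \<in> Sig m"
    by (rule flat_Sig[OF l1]) (use W in \<open>auto simp: words_def\<close>)
  obtain B where B: "B > 0" "\<And>\<omega>. \<omega> \<in> Sig m \<Longrightarrow> \<bar>f \<omega>\<bar> \<le> B" using UC_bounded[OF f] by auto
  define M where "M = B + \<bar>\<alpha>\<bar>"
  have M: "M > 0" using B by (simp add: M_def)
  define L where "L k = (\<Sum>j<k. l j)" for k
  have Llen: "length (cw W k) = L k" for k by (simp add: length_cw lW L_def)
  have L_ge: "k \<le> L k" for k using length_cw_ge[of W k, OF l1] by (simp add: Llen)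
  have prefL: "pref (L k) ?\<omega> = cw W k" for k using pref_flat[of W k, OF l1] by (simp add: Llen)
  have blk: "\<bar>bsum f (L k) ?\<omega> - L k * \<alpha>\<bar> \<le> (\<Sum>j<k. l j * \<epsilon> j)" for k
  proof (induction k)
    case 0
    show ?case by (simp add: L_def bsum_def)
  next
    case (Suc k)
    have LS: "L (Suc k) = L k + l k" by (simp add: L_def)
    have "pref (L k) ?\<omega> @ pref (l k) ((shift ^^ L k) ?\<omega>) = cw W k @ W k"
      using prefL[of "Suc k"] unfolding LS pref_append cw_Suc .
    then have "pref (l k) ((shift ^^ L k) ?\<omega>) = W k" by (simp add: prefL)
    then have "\<bar>bsum f (l k) ((shift ^^ L k) ?\<omega>) - l k * \<alpha>\<bar> \<le> l k * \<epsilon> k"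
      by (rule blocks[OF shift_pow_Sig[OF \<omega>]])
    moreover have "real (L (Suc k)) * \<alpha> = L k * \<alpha> + l k * \<alpha>" by (simp add: LS algebra_simps)
    ultimately show ?case using Suc unfolding LS bsum_add by simp
  qed
  have rem: "\<bar>bsum f n \<omega>' - n * \<alpha>\<bar> \<le> n * M" if "\<omega>' \<in> Sig m" for n \<omega>'
  proof -
    have "bsum f n \<omega>' - n * \<alpha> = (\<Sum>i<n. f ((shift ^^ i) \<omega>') - \<alpha>)" by (simp add: bsum_def sum_subtractf)
    also have "\<bar>\<dots>\<bar> \<le> (\<Sum>i<n. \<bar>f ((shift ^^ i) \<omega>') - \<alpha>\<bar>)" by (rule sum_abs)
    also have "\<dots> \<le> (\<Sum>i<n. M)"
    proof (rule sum_mono)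
      fix i
      have "\<bar>f ((shift ^^ i) \<omega>')\<bar> \<le> B" by (rule B(2)[OF shift_pow_Sig[OF that]])
      then show "\<bar>f ((shift ^^ i) \<omega>') - \<alpha>\<bar> \<le> M" unfolding M_def by linarith
    qed
    finally show ?thesis by simp
  qed
  have "(\<lambda>n. bsum f n ?\<omega> / n) \<longlonglongrightarrow> \<alpha>"
  proof (rule LIMSEQ_I)
    fix \<eta> :: real assume \<eta>: "\<eta> > 0"
    \<comment> \<open>Late blocks contribute at most \<open>n * \<delta>\<close> and the unfinished
      block about \<open>n * \<delta> * M\<close>, together a quarter of the tolerance; the
      remaining terms are bounded and are beaten by \<open>N\<close>.\<close>
    define \<delta> where "\<delta> = \<eta> / (4 * (1 + M))"
    have \<delta>: "\<delta> > 0" "\<delta> * (1 + M) = \<eta> / 4" using \<eta> M by (auto simp: \<delta>_def field_simps)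
    obtain j0 where "\<forall>j\<ge>j0. norm (\<epsilon> j - 0) < \<delta>" using LIMSEQ_D[OF eps \<delta>(1)] by blast
    then have j0: "\<epsilon> j < \<delta>" if "j \<ge> j0" for j using that by auto
    define D where "D = (\<Sum>j<j0. l j * \<epsilon> j)"
    have D0: "D \<ge> 0" unfolding D_def using eps0 by (intro sum_nonneg) auto
    obtain N :: nat where N: "real N > (D + C * \<eta>) / (\<eta> / 4)" using reals_Archimedean2[of "(D + C * \<eta>) / (\<eta> / 4)"] by blast
    have "norm (bsum f n ?\<omega> / n - \<alpha>) < \<eta>" if n: "n \<ge> max (max N (L j0)) 1" for n
    proof -
      \<comment> \<open>The number of complete blocks among the first \<open>n\<close> symbols. It
        exists because \<open>k\<close> blocks have at least \<open>k\<close> letters.\<close>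
      define k where "k = (GREATEST k. L k \<le> n)"
      have bd: "\<And>k. L k \<le> n \<Longrightarrow> k \<le> n" using L_ge order_trans by blast
      have ex: "L j0 \<le> n" using n by simp
      have Lk: "L k \<le> n" unfolding k_def by (rule GreatestI_nat[of "\<lambda>k. L k \<le> n" j0 n, OF ex bd])
      have kj0: "k \<ge> j0" unfolding k_def by (rule Greatest_le_nat[of "\<lambda>k. L k \<le> n" j0 n, OF ex bd])
      have "\<not> L (Suc k) \<le> n"
      proof
        assume "L (Suc k) \<le> n"
        from Greatest_le_nat[of "\<lambda>k. L k \<le> n" "Suc k" n, OF this bd] have "Suc k \<le> k" unfolding k_def .
        then show False by simp
      qed
      then have nk: "n - L k \<le> l k" by (simp add: L_def)
      have "bsum f n ?\<omega> - n * \<alpha> = (bsum f (L k) ?\<omega> - L k * \<alpha>) + (bsum f (n - L k) ((shift ^^ L k) ?\<omega>) - (n - L k) * \<alpha>)"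
        using bsum_add[of f "L k" "n - L k" ?\<omega>] Lk by (simp add: of_nat_diff algebra_simps)
      then have "\<bar>bsum f n ?\<omega> - n * \<alpha>\<bar> \<le> (\<Sum>j<k. l j * \<epsilon> j) + (n - L k) * M"
        using blk[of k] rem[OF shift_pow_Sig[OF \<omega>], of "n - L k" "L k"] Lk by (simp add: of_nat_diff)
      also have "(\<Sum>j<k. l j * \<epsilon> j) \<le> D + n * \<delta>"
      proof -
        have un: "{..<k} = {..<j0} \<union> {j0..<k}" using kj0 by auto
        have "(\<Sum>j<k. l j * \<epsilon> j) = D + (\<Sum>j\<in>{j0..<k}. l j * \<epsilon> j)"
          unfolding D_def un by (rule sum.union_disjoint) auto
        also have "(\<Sum>j\<in>{j0..<k}. l j * \<epsilon> j) \<le> (\<Sum>j\<in>{j0..<k}. l j * \<delta>)"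
          by (intro sum_mono mult_left_mono) (auto intro: less_imp_le j0)
        also have "\<dots> \<le> (\<Sum>j<k. l j * \<delta>)" using \<delta> by (intro sum_mono2) auto
        also have "\<dots> = L k * \<delta>" by (simp add: L_def sum_distrib_right)
        also have "\<dots> \<le> n * \<delta>" using Lk \<delta> by (intro mult_right_mono) auto
        finally show ?thesis by simp
      qed
      also have "(n - L k) * M \<le> (n + C) * \<delta> * M"
      proof (rule mult_right_mono)
        have "real (n - L k) \<le> l k" using nk by simp
        also have "\<dots> \<le> (k + C) * \<epsilon> k" by (rule slow)
        also have "\<dots> \<le> (n + C) * \<delta>"
          using j0[OF kj0] bd[OF Lk] C eps0 by (intro mult_mono) auto
        finally show "real (n - L k) \<le> (n + C) * \<delta>" .
      qed (use M in simp)
      finally have "\<bar>bsum f n ?\<omega> - n * \<alpha>\<bar> \<le> D + n * \<delta> + (n + C) * \<delta> * M" by simp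
      also have "\<dots> = D + n * (\<delta> * (1 + M)) + C * (\<delta> * M)" by (simp add: algebra_simps)
      also have "\<dots> \<le> D + n * (\<eta> / 4) + C * \<eta>"
      proof -
        have "\<delta> * M \<le> \<delta> * (1 + M)" using \<delta> by (simp add: algebra_simps)
        then have "\<delta> * M \<le> \<eta>" using \<delta> \<eta> by linarith
        then have "C * (\<delta> * M) \<le> C * \<eta>" using C by (intro mult_left_mono) auto
        then show ?thesis unfolding \<delta>(2) by simp
      qed
      also have "\<dots> < n * \<eta>"
      proof -
        have "(D + C * \<eta>) / (\<eta> / 4) < n" using N n by linarith
        then have "D + C * \<eta> < n * (\<eta> / 4)" using \<eta> by (simp add: field_simps)
        moreover have "n * (\<eta> / 4) * 4 = n * \<eta>" by simp
        moreover have "n * (\<eta> / 4) \<ge> 0" using \<eta> by simp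
        ultimately show ?thesis by linarith
      qed
      finally have lt: "\<bar>bsum f n ?\<omega> - n * \<alpha>\<bar> < n * \<eta>" .
      have n0: "real n > 0" using n by simp
      have "bsum f n ?\<omega> / n - \<alpha> = (bsum f n ?\<omega> - n * \<alpha>) / n" using n0 by (simp add: field_simps)
      then show ?thesis using lt n0 by (simp add: abs_divide pos_divide_less_eq mult.commute)
    qed
    then show "\<exists>no. \<forall>n\<ge>no. norm (bsum f n ?\<omega> / n - \<alpha>) < \<eta>" by blast
  qed
  then show ?thesis using \<omega> unfolding level_set_def birk_avg_eq[abs_def] by simp
qed

context ifs
begin

text \<open>The summand 1 in the entropy condition is a surplus gained by each block over
  \<open>s\<close> times its contraction \<open>b\<close>. After \<open>k\<close> blocks the surplus
  is at least \<open>k\<close>, while the slow choice of parameters keeps the cost of the next block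
  below \<open>k + C\<close>. This pays for the index shift in the growth condition of
  \<open>moran_set\<close>; the surplus also makes the entropies diverge.\<close>

lemma lower_bound:
  fixes s \<alpha> :: real
  assumes f: "UC m f" and s: "s \<ge> 0"
    and V: "\<And>e. e > 0 \<Longrightarrow> \<exists>l b V. l \<ge> 1 \<and> V \<subseteq> words m l \<and> V \<noteq> {} \<and> b \<ge> 0 \<and>
      (\<forall>w\<in>V. \<forall>x\<in>{0..1}. Dl T DT w x \<ge> exp (- b)) \<and> ln (real (card V)) \<ge> s * b + 1 \<and>
      (\<forall>\<omega>\<in>Sig m. pref l \<omega> \<in> V \<longrightarrow> \<bar>bsum f l \<omega> - l * \<alpha>\<bar> \<le> l * e)"
  shows "hausdorff_measure s (Pi_map T ` level_set m f \<alpha>) \<noteq> 0"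
proof -
  have "\<exists>l b V. l \<ge> 1 \<and> V \<subseteq> words m l \<and> V \<noteq> {} \<and> b \<ge> 0 \<and>
      (\<forall>w\<in>V. \<forall>x\<in>{0..1}. Dl T DT w x \<ge> exp (- b)) \<and> ln (real (card V)) \<ge> s * b + 1 \<and>
      (\<forall>\<omega>\<in>Sig m. pref l \<omega> \<in> V \<longrightarrow> \<bar>bsum f l \<omega> - l * \<alpha>\<bar> \<le> l * (1 / (k + 1)))" for k :: nat
    by (rule V) simp
  then obtain l b V where lbV: "\<And>k::nat. l k \<ge> 1 \<and> V k \<subseteq> words m (l k) \<and> V k \<noteq> {} \<and> b k \<ge> 0 \<and>
      (\<forall>w\<in>V k. \<forall>x\<in>{0..1}. Dl T DT w x \<ge> exp (- b k)) \<and> ln (real (card (V k))) \<ge> s * b k + 1 \<and>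
      (\<forall>\<omega>\<in>Sig m. pref (l k) \<omega> \<in> V k \<longrightarrow> \<bar>bsum f (l k) \<omega> - l k * \<alpha>\<bar> \<le> l k * (1 / (k + 1)))"
    by metis
  \<comment> \<open>The maximum joins two speed limits: the length of the next block relative to its
    tolerance, needed for the level set, and its cost \<open>s * b\<close>, needed for the growth
    condition.\<close>
  obtain \<kappa> C where \<kappa>: "\<And>k. max (l (\<kappa> k) * (\<kappa> k + 1)) (s * b (\<kappa> k)) \<le> real k + C" "filterlim \<kappa> at_top sequentially" "C \<ge> 0"
    using slow_sequence[of "\<lambda>i. max (l i * (i + 1)) (s * b i)"] by metis
  have sb: "s * b k \<ge> 0" for k using s lbV[of k] by simp
  define a where "a k = ln (real (card (V (\<kappa> k))))" for k
  have a: "a k \<ge> s * b (\<kappa> k) + 1" for k unfolding a_def using lbV[of "\<kappa> k"] by blast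
  show ?thesis
  proof (rule moran_set[where V = "\<lambda>k. V (\<kappa> k)" and b = "\<lambda>k. b (\<kappa> k)" and l = "\<lambda>k. l (\<kappa> k)" and C = C])
    fix k
    show "V (\<kappa> k) \<subseteq> words m (l (\<kappa> k))" "V (\<kappa> k) \<noteq> {}" "l (\<kappa> k) \<ge> 1" using lbV[of "\<kappa> k"] by auto
    then show "finite (V (\<kappa> k))" using finite_subset finite_words by blast
    show "exp (- b (\<kappa> k)) \<le> Dl T DT w x" if "w \<in> V (\<kappa> k)" "x \<in> {0..1}" for w x using lbV[of "\<kappa> k"] that by blast
    have "s * (\<Sum>j<Suc k. b (\<kappa> j)) = (\<Sum>j<k. s * b (\<kappa> j)) + s * b (\<kappa> k)" by (simp add: sum_distrib_left distrib_left)
    also have "(\<Sum>j<k. s * b (\<kappa> j)) \<le> (\<Sum>j<k. a j - 1)" by (rule sum_mono) (use a in \<open>simp add: algebra_simps\<close>)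
    also have "\<dots> = (\<Sum>j<k. a j) - k" by (simp add: sum_subtractf)
    also have "s * b (\<kappa> k) \<le> k + C" using \<kappa>(1)[of k] by simp
    finally show "s * (\<Sum>j<Suc k. b (\<kappa> j)) \<le> (\<Sum>j<k. ln (real (card (V (\<kappa> j))))) + C" unfolding a_def by simp
  next
    have "real k \<le> (\<Sum>j<k. a j)" for k
    proof -
      have "(\<Sum>j<k. 1) \<le> (\<Sum>j<k. a j)"
      proof (rule sum_mono)
        fix j show "1 \<le> a j" using a[of j] sb[of "\<kappa> j"] by linarith
      qed
      then show ?thesis by simp
    qed
    then show "filterlim (\<lambda>k. \<Sum>j<k. ln (real (card (V (\<kappa> j))))) at_top sequentially"
      unfolding a_def by (intro filterlim_at_top_mono[OF filterlim_real_sequentially] always_eventually allI)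
  next
    fix W assume W: "\<And>j. W j \<in> V (\<kappa> j)"
    have "flat W \<in> level_set m f \<alpha>"
    proof (rule flat_level_set[OF f, where l = "\<lambda>k. l (\<kappa> k)" and \<epsilon> = "\<lambda>k. 1 / (real (\<kappa> k) + 1)" and C = C])
      fix j
      show "l (\<kappa> j) \<ge> 1" "W j \<in> words m (l (\<kappa> j))" using lbV[of "\<kappa> j"] W by auto
      show "\<bar>bsum f (l (\<kappa> j)) \<omega> - l (\<kappa> j) * \<alpha>\<bar> \<le> l (\<kappa> j) * (1 / (real (\<kappa> j) + 1))" if "\<omega> \<in> Sig m" "pref (l (\<kappa> j)) \<omega> = W j" for \<omega>
        using lbV[of "\<kappa> j"] that W by (simp add: add.commute)
      have "real (l (\<kappa> j) * (\<kappa> j + 1)) \<le> j + C" using \<kappa>(1)[of j] by simp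
      then show "real (l (\<kappa> j)) \<le> (real j + C) * (1 / (real (\<kappa> j) + 1))" by (simp add: field_simps)
    next
      have "filterlim (\<lambda>k. real (\<kappa> k)) at_top sequentially"
        by (rule filterlim_compose[OF filterlim_real_sequentially \<kappa>(2)])
      then have "filterlim (\<lambda>k. 1 + real (\<kappa> k)) at_top sequentially"
        by (rule filterlim_tendsto_add_at_top[OF tendsto_const])
      then show "(\<lambda>k. 1 / (real (\<kappa> k) + 1)) \<longlonglongrightarrow> 0"
        using tendsto_divide_0[OF tendsto_const filterlim_at_top_imp_at_infinity] by (simp add: add.commute)
    qed (use \<kappa>(3) in auto)
    then show "Pi_map T (flat W) \<in> Pi_map T ` level_set m f \<alpha>" by blast
  qed (rule s)
qed

text \<open>Integrals merely near \<open>\<alpha>\<close> suffice, because the tolerance may improve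
  from block to block; a different measure may serve for each tolerance. In
  \<open>b = l * (ly + 2 * d)\<close> one \<open>d\<close> pays for the distortion, the other for
  the deviation of the averages of \<open>g\<close>.\<close>

lemma hausdorff_lower:
  fixes s \<alpha> :: real
  assumes \<mu>: "\<And>e. e > 0 \<Longrightarrow> \<exists>\<mu>\<in>inv_measures m. \<exists>h::real. (\<forall>n. n * h \<le> Hn m (law m \<mu>) n) \<and>
      \<bar>integral\<^sup>L \<mu> f - \<alpha>\<bar> \<le> e \<and> s * lyap T DT \<mu> < h"
    and f: "UC m f" and s: "s \<ge> 0"
  shows "hausdorff_measure s (Pi_map T ` level_set m f \<alpha>) \<noteq> 0"
proof (rule lower_bound[OF f s])
  fix e :: real assume e: "e > 0"
  from \<mu>[OF half_gt_zero[OF e]] obtain \<mu> h where \<mu>: "\<mu> \<in> inv_measures m"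
    and h: "\<And>n. n * h \<le> Hn m (law m \<mu>) n" and fa: "\<bar>integral\<^sup>L \<mu> f - \<alpha>\<bar> \<le> e / 2" and sh: "s * lyap T DT \<mu> < h" by blast
  define ly where "ly = lyap T DT \<mu>"
  have ly0: "ly \<ge> 0" unfolding ly_def lyap_def
    using g_nonneg inv_measuresD(3)[OF \<mu>] by (intro integral_nonneg_AE AE_I2) auto
  \<comment> \<open>The total loss per symbol is \<open>d * (2 * s + 1)\<close>: twice
    \<open>s * d\<close> from \<open>b\<close> and once \<open>d\<close> from the cardinality. It
    takes at most half of the gap \<open>h - s * ly\<close>; the other half, multiplied by
    \<open>l \<ge> N1\<close>, yields the surplus 1.\<close>
  define d where "d = min (e / 2) ((h - s * ly) / (2 * (2 * s + 1)))"
  have X: "(h - s * ly) / (2 * (2 * s + 1)) > 0" using sh s by (simp add: ly_def)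
  then have d: "d > 0" using e unfolding d_def by simp
  have d2: "d \<le> e / 2" unfolding d_def by (rule min.cobounded1)
  have d3: "d * (2 * s + 1) \<le> (h - s * ly) / 2"
  proof -
    have "d \<le> (h - s * ly) / (2 * (2 * s + 1))" by (simp add: d_def)
    then have "d * (2 * s + 1) \<le> (h - s * ly) / (2 * (2 * s + 1)) * (2 * s + 1)" using s by (intro mult_right_mono) auto
    also have "\<dots> = (h - s * ly) * (2 * s + 1) / (2 * (2 * s + 1))" by (rule times_divide_eq_left)
    also have "\<dots> = (h - s * ly) / 2" by (rule nonzero_mult_divide_mult_cancel_right) (use s in simp)
    finally show ?thesis .
  qed
  obtain N where N: "\<And>n \<omega> x. n \<ge> N \<Longrightarrow> \<omega> \<in> Sig m \<Longrightarrow> x \<in> {0..1} \<Longrightarrow>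
     \<bar>ln (Dl T DT (pref n \<omega>) x) + bsum g n \<omega>\<bar> \<le> n * d"
    using distortion[OF d] unfolding bsum_def by metis
  obtain N1 :: nat where N1: "real N1 > 1 / ((h - s * ly) / 2)" using reals_Archimedean2 by blast
  obtain l V where l: "l \<ge> max N N1" "l \<ge> 1" and V: "V \<subseteq> words m l" "V \<noteq> {}" "ln (real (card V)) \<ge> l * (h - d)"
    and Vf: "\<And>\<omega>. \<omega> \<in> Sig m \<Longrightarrow> pref l \<omega> \<in> V \<Longrightarrow> \<bar>bsum f l \<omega> - l * integral\<^sup>L \<mu> f\<bar> \<le> l * d"
    and Vg: "\<And>\<omega>. \<omega> \<in> Sig m \<Longrightarrow> pref l \<omega> \<in> V \<Longrightarrow> \<bar>bsum g l \<omega> - l * integral\<^sup>L \<mu> g\<bar> \<le> l * d"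
    using typical_words[OF \<mu> m f UC_g h d, of "max N N1"] by metis
  have 1: "exp (- (l * (ly + 2 * d))) \<le> Dl T DT w x" if w: "w \<in> V" "x \<in> {0..1}" for w x
  proof -
    have ww: "w \<in> words m l" using V(1) w by blast
    have \<omega>: "pt w \<in> Sig m" by (rule pt_Sig[OF ww m])
    have pw: "pref l (pt w) = w" using ww by (simp add: words_def)
    have "\<bar>ln (Dl T DT w x) + bsum g l (pt w)\<bar> \<le> l * d" using N[of l "pt w" x] l(1) \<omega> w(2) pw by simp
    moreover have "\<bar>bsum g l (pt w) - l * ly\<bar> \<le> l * d" using Vg[OF \<omega>] pw w(1) by (simp add: ly_def lyap_def)
    moreover have "l * (ly + 2 * d) = l * ly + 2 * (l * d)" by (simp add: algebra_simps)
    ultimately have "- (l * (ly + 2 * d)) \<le> ln (Dl T DT w x)" by linarith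
    then show ?thesis using Dl_pos[of w x] ww w(2) by (simp add: ln_ge_iff words_def)
  qed
  have 2: "s * (l * (ly + 2 * d)) + 1 \<le> ln (real (card V))"
  proof -
    have "1 \<le> N1 * ((h - s * ly) / 2)" using N1 sh by (simp add: ly_def field_simps)
    also have "\<dots> \<le> l * ((h - s * ly) / 2)" using l sh by (intro mult_right_mono) (auto simp: ly_def)
    also have "\<dots> \<le> l * (h - s * ly - d * (2 * s + 1))"
    proof (rule mult_left_mono)
      define X Y where "X = d * (2 * s + 1)" and "Y = h - s * ly"
      have "X \<le> Y / 2" using d3 unfolding X_def Y_def .
      then have "Y / 2 \<le> Y - X" by linarith
      then show "(h - s * ly) / 2 \<le> h - s * ly - d * (2 * s + 1)" unfolding X_def Y_def .
    qed simp
    finally have "s * (l * (ly + 2 * d)) + 1 \<le> l * (h - d)" by (simp add: algebra_simps)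
    then show ?thesis using V(3) by linarith
  qed
  have 3: "\<bar>bsum f l \<omega> - l * \<alpha>\<bar> \<le> l * e" if "\<omega> \<in> Sig m" "pref l \<omega> \<in> V" for \<omega>
  proof -
    have "\<bar>l * integral\<^sup>L \<mu> f - l * \<alpha>\<bar> \<le> l * (e / 2)"
      using mult_left_mono[OF fa, of "real l"] by (simp add: abs_mult flip: right_diff_distrib)
    moreover have "l * d \<le> l * (e / 2)" using d2 by (intro mult_left_mono) auto
    moreover have "l * (e / 2) + l * (e / 2) = l * e" by simp
    ultimately show ?thesis using Vf[OF that] by linarith
  qed
  show "\<exists>l b V. l \<ge> 1 \<and> V \<subseteq> words m l \<and> V \<noteq> {} \<and> b \<ge> 0 \<and>
      (\<forall>w\<in>V. \<forall>x\<in>{0..1}. Dl T DT w x \<ge> exp (- b)) \<and> ln (real (card V)) \<ge> s * b + 1 \<and>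
      (\<forall>\<omega>\<in>Sig m. pref l \<omega> \<in> V \<longrightarrow> \<bar>bsum f l \<omega> - l * \<alpha>\<bar> \<le> l * e)"
    by (rule exI[of _ l], rule exI[of _ "l * (ly + 2 * d)"], rule exI[of _ V])
      (use l(2) V 1 2 3 ly0 d in auto)
qed

end

section \<open>Limits of empirical measures\<close>

text \<open>A finite family of weighted orbits that differ within their first \<open>n\<close>
  symbols, so that the weights themselves carry the entropy of the family.\<close>

locale empirical =
  fixes m n :: nat and W :: "'w set" and P :: "'w \<Rightarrow> real" and x :: "'w \<Rightarrow> nat \<Rightarrow> nat"
  assumes m: "m \<ge> 1" and n: "n \<ge> 1" and fin: "finite W" and Pnn: "\<And>w. w \<in> W \<Longrightarrow> 0 \<le> P w"
    and Psum: "(\<Sum>w\<in>W. P w) = 1" and xS: "\<And>w. w \<in> W \<Longrightarrow> x w \<in> Sig m"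
    and inj: "inj_on (\<lambda>w. pref n (x w)) W"
begin

definition A :: "nat \<Rightarrow> nat list \<Rightarrow> real" where
  "A i v = (\<Sum>w\<in>W. P w * (if pref (length v) ((shift ^^ i) (x w)) = v then 1 else 0))"

text \<open>Cylinder weights of the average over \<open>n\<close> shifts of the weighted point
  masses at the \<open>x w\<close>, as in the Krylov-Bogolyubov construction; \<open>A i\<close>
  belongs to the \<open>i\<close>-th shift alone.\<close>

definition q :: "nat list \<Rightarrow> real" where
  "q v = (\<Sum>i<n. 1 / n * A i v)"

definition J :: "((nat \<Rightarrow> nat) \<Rightarrow> real) \<Rightarrow> real" where
  "J \<phi> = (\<Sum>w\<in>W. P w * bsum \<phi> n (x w)) / n"

lemma sx: "w \<in> W \<Longrightarrow> (shift ^^ i) (x w) \<in> Sig m"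
  by (rule shift_pow_Sig[OF xS])

lemma A_nn: "0 \<le> A i v"
  unfolding A_def by (intro sum_nonneg mult_nonneg_nonneg) (auto simp: Pnn)

lemma A_le: "A i v \<le> 1"
proof -
  have "A i v \<le> (\<Sum>w\<in>W. P w * 1)" unfolding A_def by (intro sum_mono mult_left_mono) (auto simp: Pnn)
  then show ?thesis using Psum by simp
qed

lemma q_nn: "0 \<le> q v"
  unfolding q_def by (intro sum_nonneg mult_nonneg_nonneg A_nn) auto

lemma q_le: "q v \<le> 1"
proof -
  have "q v \<le> (\<Sum>i<n. 1 / n * 1)" unfolding q_def by (intro sum_mono mult_left_mono A_le) auto
  then show ?thesis using n by simp
qed

lemma q_nil: "q [] = 1"
  using n Psum by (simp add: q_def A_def pref_def)

lemma A_right: "(\<Sum>a\<in>{1..m}. A i (v @ [a])) = A i v"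
proof -
  have "(\<Sum>a\<in>{1..m}. A i (v @ [a])) = (\<Sum>w\<in>W. \<Sum>a\<in>{1..m}. P w * (if pref (length (v @ [a])) ((shift ^^ i) (x w)) = v @ [a] then 1 else 0))"
    unfolding A_def by (rule sum.swap)
  also have "\<dots> = A i v" unfolding A_def
  proof (intro sum.cong refl)
    fix w assume w: "w \<in> W"
    let ?y = "(shift ^^ i) (x w)"
    have y: "?y (length v) \<in> {1..m}" using sx[OF w, of i] unfolding Sig_def by blast
    have "(\<Sum>a\<in>{1..m}. P w * (if pref (length (v @ [a])) ?y = v @ [a] then 1 else 0)) =
       (\<Sum>a\<in>{1..m}. if a = ?y (length v) then P w * (if pref (length v) ?y = v then 1 else 0) else 0)"
      by (intro sum.cong refl) (auto simp: pref_Suc_right)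
    also have "\<dots> = P w * (if pref (length v) ?y = v then 1 else 0)"
      by (subst sum.delta) (use y in auto)
    finally show "(\<Sum>a\<in>{1..m}. P w * (if pref (length (v @ [a])) ?y = v @ [a] then 1 else 0)) = P w * (if pref (length v) ?y = v then 1 else 0)" .
  qed
  finally show ?thesis .
qed

lemma A_left: "(\<Sum>a\<in>{1..m}. A i (a # v)) = A (Suc i) v"
proof -
  have "(\<Sum>a\<in>{1..m}. A i (a # v)) = (\<Sum>w\<in>W. \<Sum>a\<in>{1..m}. P w * (if pref (length (a # v)) ((shift ^^ i) (x w)) = a # v then 1 else 0))"
    unfolding A_def by (rule sum.swap)
  also have "\<dots> = A (Suc i) v" unfolding A_def
  proof (intro sum.cong refl)
    fix w assume w: "w \<in> W"
    let ?y = "(shift ^^ i) (x w)"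
    have y: "?y 0 \<in> {1..m}" using sx[OF w, of i] unfolding Sig_def by blast
    have "(\<Sum>a\<in>{1..m}. P w * (if pref (length (a # v)) ?y = a # v then 1 else 0)) =
       (\<Sum>a\<in>{1..m}. if a = ?y 0 then P w * (if pref (length v) (shift ?y) = v then 1 else 0) else 0)"
      by (intro sum.cong refl) (auto simp: pref_Suc)
    also have "\<dots> = P w * (if pref (length v) (shift ?y) = v then 1 else 0)"
      by (subst sum.delta) (use y in auto)
    finally show "(\<Sum>a\<in>{1..m}. P w * (if pref (length (a # v)) ?y = a # v then 1 else 0)) = P w * (if pref (length v) ((shift ^^ Suc i) (x w)) = v then 1 else 0)"
      by simp
  qed
  finally show ?thesis .
qed

lemma q_right: "(\<Sum>a\<in>{1..m}. q (v @ [a])) = q v"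
proof -
  have "(\<Sum>a\<in>{1..m}. q (v @ [a])) = (\<Sum>i<n. \<Sum>a\<in>{1..m}. 1 / n * A i (v @ [a]))"
    unfolding q_def by (rule sum.swap)
  also have "\<dots> = q v" unfolding q_def sum_distrib_left[symmetric] A_right ..
  finally show ?thesis .
qed

text \<open>Prepending a letter moves the observation one step in time, so the difference telescopes
  to \<open>A n v - A 0 v\<close>, divided by \<open>n\<close>.\<close>

lemma q_left: "\<bar>(\<Sum>a\<in>{1..m}. q (a # v)) - q v\<bar> \<le> 1 / n"
proof -
  have "(\<Sum>a\<in>{1..m}. q (a # v)) = (\<Sum>i<n. \<Sum>a\<in>{1..m}. 1 / n * A i (a # v))"
    unfolding q_def by (rule sum.swap)
  also have "\<dots> = (\<Sum>i<n. 1 / n * A (Suc i) v)" unfolding sum_distrib_left[symmetric] A_left ..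
  finally have "(\<Sum>a\<in>{1..m}. q (a # v)) - q v = 1 / n * (\<Sum>i<n. A (Suc i) v - A i v)"
    unfolding q_def by (simp add: sum_distrib_left sum_subtractf right_diff_distrib)
  also have "\<dots> = 1 / n * (A n v - A 0 v)" by (subst sum_lessThan_telescope) simp
  finally have "\<bar>(\<Sum>a\<in>{1..m}. q (a # v)) - q v\<bar> = 1 / n * \<bar>A n v - A 0 v\<bar>" by (simp add: abs_mult)
  also have "\<dots> \<le> 1 / n * 1"
    by (rule mult_left_mono) (use A_nn[of n v] A_le[of n v] A_nn[of 0 v] A_le[of 0 v] in auto)
  finally show ?thesis by simp
qed

lemma q_bad:
  assumes "\<not> set v \<subseteq> {1..m}"
  shows "q v = 0"
proof -
  have "pref (length v) ((shift ^^ i) (x w)) \<noteq> v" if "w \<in> W" for i w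
    using pref_in_words[OF sx[OF that], of "length v" i] assms by (auto simp: words_def)
  then have "A i v = 0" for i unfolding A_def by (intro sum.neutral) auto
  then show ?thesis by (simp add: q_def)
qed

lemma J_cyl_sum:
  assumes "\<And>\<omega> \<omega>'. \<omega> \<in> Sig m \<Longrightarrow> \<omega>' \<in> Sig m \<Longrightarrow> pref K \<omega> = pref K \<omega>' \<Longrightarrow> \<bar>\<phi> \<omega> - \<phi> \<omega>'\<bar> \<le> e"
  shows "\<bar>J \<phi> - cyl_sum m q \<phi> K\<bar> \<le> e"
proof -
  let ?y = "\<lambda>w i. (shift ^^ i) (x w)"
  have Av: "(\<Sum>v\<in>words m K. A i v * \<phi> (pt v)) = (\<Sum>w\<in>W. P w * \<phi> (pt (pref K (?y w i))))" for i
  proof -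
    have "(\<Sum>v\<in>words m K. A i v * \<phi> (pt v)) = (\<Sum>v\<in>words m K. \<Sum>w\<in>W. if v = pref K (?y w i) then P w * \<phi> (pt v) else 0)"
      unfolding A_def sum_distrib_right by (intro sum.cong refl) (auto simp: words_def)
    also have "\<dots> = (\<Sum>w\<in>W. \<Sum>v\<in>words m K. if v = pref K (?y w i) then P w * \<phi> (pt v) else 0)" by (rule sum.swap)
    also have "\<dots> = (\<Sum>w\<in>W. P w * \<phi> (pt (pref K (?y w i))))"
    proof (intro sum.cong refl)
      fix w assume "w \<in> W"
      then have "pref K (?y w i) \<in> words m K" by (intro pref_in_words sx)
      then show "(\<Sum>v\<in>words m K. if v = pref K (?y w i) then P w * \<phi> (pt v) else 0) = P w * \<phi> (pt (pref K (?y w i)))"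
        by simp
    qed
    finally show ?thesis .
  qed
  have "cyl_sum m q \<phi> K = (\<Sum>v\<in>words m K. \<Sum>i<n. 1 / n * (A i v * \<phi> (pt v)))"
    unfolding cyl_sum_def q_def by (simp add: sum_distrib_right)
  also have "\<dots> = (\<Sum>i<n. \<Sum>v\<in>words m K. 1 / n * (A i v * \<phi> (pt v)))" by (rule sum.swap)
  also have "\<dots> = (\<Sum>i<n. 1 / n * (\<Sum>w\<in>W. P w * \<phi> (pt (pref K (?y w i)))))"
    unfolding sum_distrib_left[symmetric] Av ..
  finally have c: "cyl_sum m q \<phi> K = (\<Sum>i<n. 1 / n * (\<Sum>w\<in>W. P w * \<phi> (pt (pref K (?y w i)))))" .
  have "J \<phi> = (\<Sum>w\<in>W. \<Sum>i<n. 1 / n * (P w * \<phi> (?y w i)))"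
    by (simp add: J_def bsum_def sum_distrib_left sum_divide_distrib)
  also have "\<dots> = (\<Sum>i<n. \<Sum>w\<in>W. 1 / n * (P w * \<phi> (?y w i)))" by (rule sum.swap)
  also have "\<dots> = (\<Sum>i<n. 1 / n * (\<Sum>w\<in>W. P w * \<phi> (?y w i)))" unfolding sum_distrib_left[symmetric] ..
  finally have d: "J \<phi> - cyl_sum m q \<phi> K = (\<Sum>i<n. 1 / n * (\<Sum>w\<in>W. P w * (\<phi> (?y w i) - \<phi> (pt (pref K (?y w i))))))"
    unfolding c by (simp add: sum_subtractf right_diff_distrib)
  have "\<bar>J \<phi> - cyl_sum m q \<phi> K\<bar> \<le> (\<Sum>i<n. \<bar>1 / n * (\<Sum>w\<in>W. P w * (\<phi> (?y w i) - \<phi> (pt (pref K (?y w i)))))\<bar>)"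
    unfolding d by (rule sum_abs)
  also have "\<dots> \<le> (\<Sum>i<n. 1 / n * e)"
  proof (rule sum_mono)
    fix i
    have "\<bar>\<Sum>w\<in>W. P w * (\<phi> (?y w i) - \<phi> (pt (pref K (?y w i))))\<bar> \<le> (\<Sum>w\<in>W. \<bar>P w * (\<phi> (?y w i) - \<phi> (pt (pref K (?y w i))))\<bar>)"
      by (rule sum_abs)
    also have "\<dots> \<le> (\<Sum>w\<in>W. P w * e)"
    proof (rule sum_mono)
      fix w assume w: "w \<in> W"
      have "\<bar>\<phi> (?y w i) - \<phi> (pt (pref K (?y w i)))\<bar> \<le> e"
        by (rule assms[OF sx[OF w] pt_Sig[OF pref_in_words[OF sx[OF w]] m]]) simp
      then show "\<bar>P w * (\<phi> (?y w i) - \<phi> (pt (pref K (?y w i))))\<bar> \<le> P w * e"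
        using Pnn[OF w] by (simp add: abs_mult mult_left_mono)
    qed
    also have "\<dots> = e" using Psum by (simp flip: sum_distrib_right)
    finally show "\<bar>1 / n * (\<Sum>w\<in>W. P w * (\<phi> (?y w i) - \<phi> (pt (pref K (?y w i)))))\<bar> \<le> 1 / n * e"
      using n by (simp add: abs_mult divide_right_mono)
  qed
  also have "\<dots> = e" using n by simp
  finally show ?thesis .
qed

section \<open>Entropy of the weights against entropy of the empirical law\<close>

definition M :: "'w measure" where
  "M = point_measure W (\<lambda>w. ennreal (P w))"

lemma space_M: "space M = W"
  by (simp add: M_def space_point_measure)

lemma prob_M: "prob_space M"
proof (rule prob_spaceI)
  show "emeasure M (space M) = 1"
    using Psum Pnn by (simp add: M_def space_point_measure emeasure_point_measure_finite[OF fin] sum_ennreal)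
qed

lemma measure_M: "B \<subseteq> W \<Longrightarrow> measure M B = (\<Sum>w\<in>B. P w)"
proof -
  assume B: "B \<subseteq> W"
  have "emeasure M B = ennreal (\<Sum>w\<in>B. P w)"
    using B Pnn by (subst sum_ennreal[symmetric]) (auto simp: M_def emeasure_point_measure_finite[OF fin])
  moreover have "0 \<le> (\<Sum>w\<in>B. P w)" using B Pnn by (intro sum_nonneg) auto
  ultimately show ?thesis by (simp add: measure_def)
qed

lemma simple_M: "simple_function M X"
  unfolding simple_function_def space_M using fin by (auto simp: M_def sets_point_measure)

abbreviation H :: "nat list \<Rightarrow> real" where
  "H is \<equiv> Hx M (\<lambda>w. map (\<lambda>i. x w i) is)"

lemma H_nonneg: "0 \<le> H is"
  by (rule Hx_nonneg[OF prob_M])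

text \<open>By \<open>inj\<close> the first \<open>n\<close> symbols reveal the word, so no entropy
  is lost in observing them.\<close>

lemma H_full: "H [0..<n] = (\<Sum>w\<in>W. eta (P w))"
proof -
  have "H [0..<n] = (\<Sum>v\<in>(\<lambda>w. pref n (x w)) ` W. eta (measure M ((\<lambda>w. pref n (x w)) -` {v} \<inter> W)))"
    by (simp add: Hx_def space_M pref_def)
  also have "\<dots> = (\<Sum>w\<in>W. eta (measure M ((\<lambda>w. pref n (x w)) -` {pref n (x w)} \<inter> W)))"
    by (rule sum.reindex_cong[OF inj]) auto
  also have "\<dots> = (\<Sum>w\<in>W. eta (P w))"
  proof (intro sum.cong refl arg_cong[where f = eta])
    fix w assume w: "w \<in> W"
    then have "(\<lambda>w. pref n (x w)) -` {pref n (x w)} \<inter> W = {w}" using inj by (auto dest: inj_onD)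
    then show "measure M ((\<lambda>w. pref n (x w)) -` {pref n (x w)} \<inter> W) = P w" using w by (simp add: measure_M)
  qed
  finally show ?thesis .
qed

lemma map_block: "map (\<lambda>j. x w j) [i..<i + K] = pref K ((shift ^^ i) (x w))"
  by (auto simp: list_eq_iff_nth_eq shift_pow add.commute)

lemma H_block: "H [i..<i + K] = (\<Sum>v\<in>words m K. eta (A i v))"
proof -
  have "H [i..<i + K] = (\<Sum>v\<in>words m K. eta (measure M ((\<lambda>w. map (\<lambda>j. x w j) [i..<i + K]) -` {v} \<inter> space M)))"
    by (rule Hx_superset) (use sx in \<open>auto simp: space_M map_block pref_in_words\<close>)
  also have "\<dots> = (\<Sum>v\<in>words m K. eta (A i v))"
  proof (intro sum.cong refl arg_cong[where f = eta])
    fix v assume "v \<in> words m K"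
    then have l: "length v = K" by (simp add: words_def)
    have "A i v = (\<Sum>w\<in>W. if pref K ((shift ^^ i) (x w)) = v then P w else 0)"
      unfolding A_def l by (intro sum.cong) auto
    also have "\<dots> = (\<Sum>w\<in>{w \<in> W. pref K ((shift ^^ i) (x w)) = v}. P w)"
      by (rule sum.inter_filter[OF fin, symmetric])
    also have "\<dots> = measure M {w \<in> W. pref K ((shift ^^ i) (x w)) = v}" by (rule measure_M[symmetric]) auto
    also have "{w \<in> W. pref K ((shift ^^ i) (x w)) = v} = (\<lambda>w. map (\<lambda>j. x w j) [i..<i + K]) -` {v} \<inter> space M"
      by (auto simp: space_M map_block)
    finally show "measure M ((\<lambda>w. map (\<lambda>j. x w j) [i..<i + K]) -` {v} \<inter> space M) = A i v" by simp
  qed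
  finally show ?thesis .
qed

lemma H_initial: "H [0..<j] \<le> j * ln m"
proof -
  have sub: "(\<lambda>w. map (\<lambda>i. x w i) [0..<j]) ` space M \<subseteq> words m j"
    using sx[of _ 0] map_block[of _ 0 j] by (auto simp: space_M intro: pref_in_words)
  have "H [0..<j] \<le> ln (card ((\<lambda>w. map (\<lambda>i. x w i) [0..<j]) ` space M))"
    by (rule Hx_le_ln_card[OF prob_M simple_M])
  also have "\<dots> \<le> ln (m ^ j)"
  proof (rule ln_mono)
    have "card ((\<lambda>w. map (\<lambda>i. x w i) [0..<j]) ` space M) \<le> card (words m j)" by (rule card_mono[OF _ sub]) simp
    then have "card ((\<lambda>w. map (\<lambda>i. x w i) [0..<j]) ` space M) \<le> m ^ j" by (simp only: card_words)
    then show "real (card ((\<lambda>w. map (\<lambda>i. x w i) [0..<j]) ` space M)) \<le> real (m ^ j)" by (simp only: of_nat_le_iff)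
    have "W \<noteq> {}" using Psum by auto
    then show "0 < real (card ((\<lambda>w. map (\<lambda>i. x w i) [0..<j]) ` space M))" using fin by (simp add: space_M card_gt_0_iff)
  qed
  also have "\<dots> = j * ln m" using m by (simp add: ln_realpow)
  finally show ?thesis .
qed

text \<open>Misiurewicz's argument: for each phase \<open>j < K\<close> the word of length \<open>n\<close> is cut into blocks of
  length \<open>K\<close> starting at the positions congruent to \<open>j\<close>; summing over the phases, every position
  starts exactly one block.\<close>

lemma H_phase:
  assumes "j < K"
  shows "H [0..<t] \<le> K * ln m + (\<Sum>i | i < t \<and> i mod K = j. H [i..<i + K])"
proof -
  \<comment> \<open>\<open>b\<close> is where the next block of phase \<open>j\<close> begins; the
    blocks already counted may overshoot \<open>t\<close>, which costs nothing because entropy grows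
    with the observed segment.\<close>
  have "\<exists>b\<ge>t. b mod K = j \<and> H [0..<b] \<le> j * ln m + (\<Sum>i | i < t \<and> i mod K = j. H [i..<i + K])"
  proof (induction t)
    case 0
    show ?case by (intro exI[of _ j]) (use H_initial assms in auto)
  next
    case (Suc t)
    then obtain b where b: "b \<ge> t" "b mod K = j" "H [0..<b] \<le> j * ln m + (\<Sum>i | i < t \<and> i mod K = j. H [i..<i + K])" by blast
    show ?case
    proof (cases "b = t")
      case False
      have "(\<Sum>i | i < t \<and> i mod K = j. H [i..<i + K]) \<le> (\<Sum>i | i < Suc t \<and> i mod K = j. H [i..<i + K])"
        by (rule sum_mono2) (auto simp: H_nonneg)
      then show ?thesis using b False by (intro exI[of _ b]) linarith
    next
      case True
      have set: "{i. i < Suc t \<and> i mod K = j} = insert t {i. i < t \<and> i mod K = j}" using b True by (auto simp: less_Suc_eq)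
      have s: "(\<Sum>i | i < Suc t \<and> i mod K = j. H [i..<i + K]) = H [t..<t + K] + (\<Sum>i | i < t \<and> i mod K = j. H [i..<i + K])"
        unfolding set by (subst sum.insert) auto
      have "[0..<t + K] = [0..<t] @ [t..<t + K]" by (rule upt_add_eq_append) simp
      then have "H [0..<t + K] = H ([0..<t] @ [t..<t + K])" by simp
      also have "\<dots> \<le> H [0..<t] + H [t..<t + K]" by (rule Hx_map_append_le[OF prob_M simple_M])
      finally show ?thesis unfolding s using b True assms by (intro exI[of _ "t + K"]) auto
    qed
  qed
  then obtain b where b: "b \<ge> t" "H [0..<b] \<le> j * ln m + (\<Sum>i | i < t \<and> i mod K = j. H [i..<i + K])" by blast
  have "H [0..<t] \<le> H [0..<b]"
    by (rule Hx_mono[OF prob_M simple_M]) (use b(1) in \<open>auto simp: map_eq_conv\<close>)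
  moreover have "j * ln m \<le> K * ln m" using assms m by (intro mult_right_mono) auto
  ultimately show ?thesis using b(2) by linarith
qed

text \<open>The inequality of \<open>H_phase\<close> is summed over the \<open>K\<close> phases, and
  concavity of \<open>eta\<close> moves the average over time inside. The boundary term does not
  depend on \<open>n\<close>.\<close>

lemma entropy_q:
  assumes K: "K \<ge> 1"
  shows "K * (\<Sum>w\<in>W. eta (P w)) \<le> n * Hn m q K + K * (K * ln m)"
proof -
  have "K * H [0..<n] = (\<Sum>j<K. H [0..<n])" by simp
  also have "\<dots> \<le> (\<Sum>j<K. K * ln m + (\<Sum>i | i < n \<and> i mod K = j. H [i..<i + K]))"
    by (rule sum_mono) (use H_phase in auto)
  also have "\<dots> = K * (K * ln m) + (\<Sum>j<K. \<Sum>i | i < n \<and> i mod K = j. H [i..<i + K])"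
    by (simp add: sum.distrib)
  also have "(\<Sum>j<K. \<Sum>i | i < n \<and> i mod K = j. H [i..<i + K]) = (\<Sum>i<n. H [i..<i + K])"
  proof -
    have "(\<Sum>j\<in>{..<K}. \<Sum>i\<in>{i \<in> {..<n}. i mod K = j}. H [i..<i + K]) = (\<Sum>i\<in>{..<n}. H [i..<i + K])"
      by (rule sum.group) (use K in auto)
    then show ?thesis by simp
  qed
  also have "\<dots> = n * (\<Sum>i<n. 1 / n * H [i..<i + K])" using n by (simp add: sum_distrib_left)
  also have "(\<Sum>i<n. 1 / n * H [i..<i + K]) \<le> Hn m q K"
  proof -
    have "(\<Sum>i<n. 1 / n * H [i..<i + K]) = (\<Sum>v\<in>words m K. \<Sum>i<n. 1 / n * eta (A i v))"
      unfolding H_block sum_distrib_left by (rule sum.swap)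
    also have "\<dots> \<le> (\<Sum>v\<in>words m K. eta (\<Sum>i<n. 1 / n * A i v))"
      by (intro sum_mono eta_jensen) (use n A_nn in auto)
    finally show ?thesis by (simp add: Hn_def q_def)
  qed
  finally show ?thesis using H_full by (simp add: mult_left_mono)
qed

end

text \<open>The entropy clause speaks of lower bounds \<open>c k\<close> per symbol, because
  estimates of the weights supply bounds and not limits. For fixed block length \<open>K\<close> the
  boundary term vanishes as the orbits get longer; letting \<open>K\<close> vary afterwards gives
  the entropy of the limit.\<close>

lemma empirical_limit:
  fixes n :: "nat \<Rightarrow> nat" and W :: "nat \<Rightarrow> 'w set"
  assumes emp: "\<And>k. empirical m (n k) (W k) (P k) (x k)" and nk: "\<And>k. n k \<ge> k"
  shows "\<exists>r \<mu>. strict_mono r \<and> \<mu> \<in> inv_measures m \<and>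
    (\<forall>\<phi>. UC m \<phi> \<longrightarrow> (\<lambda>k. empirical.J (n (r k)) (W (r k)) (P (r k)) (x (r k)) \<phi>) \<longlonglongrightarrow> integral\<^sup>L \<mu> \<phi>) \<and>
    (\<forall>(c :: nat \<Rightarrow> real) C. c \<longlonglongrightarrow> C \<longrightarrow> (\<forall>k. n (r k) * c k \<le> (\<Sum>w\<in>W (r k). eta (P (r k) w))) \<longrightarrow> C \<le> ks_entropy \<mu>)"
proof -
  define q where "q k = empirical.q (n k) (W k) (P k) (x k)" for k
  note E = emp
  have m: "m \<ge> 1" by (rule empirical.m[OF emp])
  have q01: "0 \<le> q k w" "q k w \<le> 1" for k w unfolding q_def by (rule empirical.q_nn[OF E] empirical.q_le[OF E])+
  obtain r p where r: "strict_mono r" and p: "\<And>w. (\<lambda>k. q (r k) w) \<longlonglongrightarrow> p w"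
    using laws_compact[of q] q01 by blast
  have rk: "n (r k) \<ge> k" for k using nk[of "r k"] seq_suble[OF r, of k] by linarith
  have n_inf: "filterlim (\<lambda>k. real (n (r k))) at_top sequentially"
    by (rule filterlim_at_top_mono[OF filterlim_real_sequentially]) (use rk in \<open>auto intro: always_eventually\<close>)
  have inv0: "(\<lambda>k. 1 / real (n (r k))) \<longlonglongrightarrow> 0"
    by (rule tendsto_divide_0[OF tendsto_const filterlim_at_top_imp_at_infinity[OF n_inf]])
  have "is_law m p"
  proof (rule limit_is_law[OF p, where c = "\<lambda>k. 1 / real (n (r k))"])
    fix k w
    show "0 \<le> q (r k) w" by (rule q01)
    show "q (r k) [] = 1" unfolding q_def by (rule empirical.q_nil[OF E])
    show "(\<Sum>a = 1..m. q (r k) (w @ [a])) = q (r k) w" unfolding q_def by (rule empirical.q_right[OF E])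
    show "\<bar>(\<Sum>a = 1..m. q (r k) (a # w)) - q (r k) w\<bar> \<le> 1 / real (n (r k))" unfolding q_def by (rule empirical.q_left[OF E])
    show "q (r k) w = 0" if "\<not> set w \<subseteq> {1..m}" using that unfolding q_def by (rule empirical.q_bad[OF E])
  qed (rule inv0)
  then obtain \<mu> where \<mu>: "\<mu> \<in> inv_measures m" "law m \<mu> = p" using law_exists by blast
  show ?thesis
  proof (rule exI[of _ r], rule exI[of _ \<mu>], intro conjI allI impI r \<mu>(1))
    fix \<phi> assume \<phi>: "UC m \<phi>"
    show "(\<lambda>k. empirical.J (n (r k)) (W (r k)) (P (r k)) (x (r k)) \<phi>) \<longlonglongrightarrow> integral\<^sup>L \<mu> \<phi>"
    proof (rule integral_limit[OF \<mu>(1) \<phi> m, where q = "\<lambda>k. q (r k)"])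
      show "(\<lambda>k. q (r k) w) \<longlonglongrightarrow> law m \<mu> w" for w unfolding \<mu>(2) by (rule p)
      show "\<bar>empirical.J (n (r k)) (W (r k)) (P (r k)) (x (r k)) \<phi> - cyl_sum m (q (r k)) \<phi> K\<bar> \<le> e"
        if "\<And>\<omega> \<omega>'. \<omega> \<in> Sig m \<Longrightarrow> \<omega>' \<in> Sig m \<Longrightarrow> pref K \<omega> = pref K \<omega>' \<Longrightarrow> \<bar>\<phi> \<omega> - \<phi> \<omega>'\<bar> \<le> e" for K e k
        unfolding q_def by (rule empirical.J_cyl_sum[OF E that])
    qed
  next
    fix c :: "nat \<Rightarrow> real" and C :: real assume c: "c \<longlonglongrightarrow> C" and le: "\<forall>k. n (r k) * c k \<le> (\<Sum>w\<in>W (r k). eta (P (r k) w))"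
    show "C \<le> ks_entropy \<mu>"
    proof (rule ks_entropy_ge[OF \<mu>(1)])
      fix K :: nat assume K: "K \<ge> 1"
      have "K * c k \<le> Hn m (q (r k)) K + K * (K * ln m) * (1 / n (r k))" for k
      proof -
        have n0: "real (n (r k)) > 0" using empirical.n[OF E, of "r k"] by simp
        have "n (r k) * (K * c k) = K * (n (r k) * c k)" by simp
        also have "\<dots> \<le> K * (\<Sum>w\<in>W (r k). eta (P (r k) w))" using le by (intro mult_left_mono) simp_all
        also have "\<dots> \<le> n (r k) * Hn m (q (r k)) K + K * (K * ln m)"
          unfolding q_def by (rule empirical.entropy_q[OF E K])
        also have "\<dots> = n (r k) * (Hn m (q (r k)) K + K * (K * ln m) * (1 / n (r k)))" using n0 by (simp add: field_simps)
        finally show ?thesis using n0 by simp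
      qed
      moreover have "(\<lambda>k. Hn m (q (r k)) K + K * (K * ln m) * (1 / n (r k))) \<longlonglongrightarrow> Hn m p K + K * (K * ln m) * 0"
        by (intro tendsto_add tendsto_mult tendsto_const inv0 Hn_limit[OF p]) (rule q01)+
      moreover have "(\<lambda>k. K * c k) \<longlonglongrightarrow> K * C" by (intro tendsto_intros c)
      ultimately have "K * C \<le> Hn m p K + K * (K * ln m) * 0"
        by (intro LIMSEQ_le[of "\<lambda>k. K * c k" "K * C"]) auto
      then show "K * C \<le> Hn m (law m \<mu>) K" unfolding \<mu>(2) by simp
    qed
  qed
qed

section \<open>Hausdorff measure and dimension\<close>

lemma ennreal_eq_0I:
  fixes x :: ennreal
  assumes "\<And>e::real. e > 0 \<Longrightarrow> x \<le> ennreal e"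
  shows "x = 0"
proof -
  have "x \<le> 0"
  proof (rule ennreal_le_epsilon)
    fix e :: real assume "0 < e"
    then show "x \<le> 0 + ennreal e" using assms[of e] by simp
  qed
  then show ?thesis by simp
qed

lemma hausdorff_pre_finite_cover:
  assumes W: "finite W" and E: "E \<subseteq> (\<Union>w\<in>W. I w)" and I: "\<And>w. w \<in> W \<Longrightarrow> bounded (I w) \<and> diameter (I w) \<le> \<delta>" and \<delta>: "0 \<le> \<delta>"
  shows "hausdorff_pre s \<delta> E \<le> ennreal (\<Sum>w\<in>W. diameter (I w) powr s)"
proof -
  obtain h where h: "bij_betw h {..<card W} W" using bij_betw_from_nat_into_finite[OF W] by blast
  \<comment> \<open>The finite family is padded with empty sets, which are free of cost because
    their diameter is 0 and \<open>0 powr s = 0\<close>.\<close>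
  define U where "U i = (if i < card W then I (h i) else {})" for i
  have hW: "h i \<in> W" if "i < card W" for i using h that by (auto simp: bij_betw_def)
  have Wh: "W = h ` {..<card W}" using h by (simp add: bij_betw_def)
  have "E \<subseteq> (\<Union>i. U i)"
  proof
    fix e assume "e \<in> E"
    then obtain w where w: "w \<in> W" "e \<in> I w" using E by blast
    then obtain i where "i < card W" "w = h i" using Wh by auto
    then show "e \<in> (\<Union>i. U i)" using w by (auto simp: U_def intro!: exI[of _ i])
  qed
  moreover have "bounded (U i) \<and> diameter (U i) \<le> \<delta>" for i
    using I[OF hW] \<delta> by (auto simp: U_def)
  ultimately have "hausdorff_pre s \<delta> E \<le> (\<Sum>i. ennreal (diameter (U i) powr s))"
    unfolding hausdorff_pre_def by (intro INF_lower) auto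
  also have "\<dots> = (\<Sum>i<card W. ennreal (diameter (U i) powr s))"
    by (rule suminf_finite) (auto simp: U_def diameter_def)
  also have "\<dots> = (\<Sum>i<card W. ennreal (diameter (I (h i)) powr s))"
    by (intro sum.cong refl) (simp add: U_def)
  also have "\<dots> = (\<Sum>w\<in>W. ennreal (diameter (I w) powr s))"
    by (rule sum.reindex_bij_betw[OF h])
  also have "\<dots> = ennreal (\<Sum>w\<in>W. diameter (I w) powr s)" by (rule sum_ennreal) simp
  finally show ?thesis .
qed

text \<open>The \<open>N\<close>-th set receives the budget \<open>e / 2 ^ (N + 1)\<close>, and the
  double sequence of covers is enumerated by pairs.\<close>

lemma hausdorff_pre_UN_zero:
  assumes "\<And>N::nat. hausdorff_pre s \<delta> (E N) = 0"
  shows "hausdorff_pre s \<delta> (\<Union>N. E N) = 0"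
proof -
  have "hausdorff_pre s \<delta> (\<Union>N. E N) \<le> ennreal e" if e: "e > 0" for e :: real
  proof -
    define \<eta> :: "nat \<Rightarrow> real" where "\<eta> N = e * (1/2)^(Suc N)" for N
    have \<eta>: "\<eta> N > 0" for N using e by (simp add: \<eta>_def)
    have "\<exists>U. E N \<subseteq> (\<Union>i. U i) \<and> (\<forall>i. bounded (U i) \<and> diameter (U i) \<le> \<delta>) \<and> (\<Sum>i. ennreal (diameter (U i) powr s)) < ennreal (\<eta> N)" for N
    proof -
      have "hausdorff_pre s \<delta> (E N) < ennreal (\<eta> N)" unfolding assms using \<eta>[of N] by simp
      then show ?thesis unfolding hausdorff_pre_def INF_less_iff by blast
    qed
    then obtain U where U: "\<And>N. E N \<subseteq> (\<Union>i. U N i)" "\<And>N i. bounded (U N i) \<and> diameter (U N i) \<le> \<delta>"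
      and Us: "\<And>N. (\<Sum>i. ennreal (diameter (U N i) powr s)) < ennreal (\<eta> N)" by metis
    define V where "V k = U (fst (prod_decode k)) (snd (prod_decode k))" for k
    have "(\<Union>N. E N) \<subseteq> (\<Union>k. V k)"
    proof
      fix y assume "y \<in> (\<Union>N. E N)"
      then obtain N i where "y \<in> U N i" using U(1) by blast
      then have "y \<in> V (prod_encode (N, i))" by (simp add: V_def)
      then show "y \<in> (\<Union>k. V k)" by blast
    qed
    moreover have "bounded (V k) \<and> diameter (V k) \<le> \<delta>" for k unfolding V_def by (rule U(2))
    ultimately have "hausdorff_pre s \<delta> (\<Union>N. E N) \<le> (\<Sum>k. ennreal (diameter (V k) powr s))"
      unfolding hausdorff_pre_def by (intro INF_lower) auto
    also have "\<dots> = (\<Sum>k. (\<lambda>(N, i). ennreal (diameter (U N i) powr s)) (prod_decode k))"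
      by (simp add: V_def case_prod_beta)
    also have "\<dots> = (\<Sum>N. \<Sum>i. ennreal (diameter (U N i) powr s))"
      by (rule suminf_ennreal_2dimen) simp
    also have "\<dots> \<le> (\<Sum>N. ennreal (\<eta> N))" by (intro suminf_le less_imp_le[OF Us]) auto
    also have "\<dots> = ennreal e"
    proof (rule suminf_ennreal_eq)
      show "0 \<le> \<eta> N" for N using \<eta>[of N] by simp
      have "(\<lambda>N. e * (1/2)^(Suc N)) sums (e * 1)" by (rule sums_mult[OF power_half_series])
      then show "\<eta> sums e" unfolding \<eta>_def by simp
    qed
    finally show ?thesis by simp
  qed
  then show ?thesis by (rule ennreal_eq_0I)
qed

lemma hausdorff_measure_zeroI:
  assumes "\<And>\<delta>. \<delta> > 0 \<Longrightarrow> hausdorff_pre s \<delta> E = 0"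
  shows "hausdorff_measure s E = 0"
proof -
  have "hausdorff_measure s E \<le> 0" unfolding hausdorff_measure_def by (rule SUP_least) (use assms in simp)
  then show ?thesis by simp
qed

lemma hausdorff_measure_mono:
  assumes "E \<subseteq> F"
  shows "hausdorff_measure s E \<le> hausdorff_measure s F"
proof -
  have "hausdorff_pre s \<delta> E \<le> hausdorff_pre s \<delta> F" for \<delta>
    unfolding hausdorff_pre_def by (rule INF_superset_mono) (use assms in auto)
  then show ?thesis unfolding hausdorff_measure_def by (intro SUP_mono) blast
qed

lemma diameter_Icc: "a \<le> b \<Longrightarrow> diameter {a..b::real} = b - a"
  by simp

text \<open>This makes the set whose infimum is the dimension nonempty. At exponent 2 a grid
  suffices: \<open>N + 1\<close> intervals of length \<open>1 / N\<close> cost at most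
  \<open>2 / N\<close>.\<close>

lemma hausdorff_measure_2:
  assumes "E \<subseteq> {0..1}"
  shows "hausdorff_measure 2 E = 0"
proof (rule hausdorff_measure_zeroI)
  fix \<delta> :: real assume \<delta>: "\<delta> > 0"
  have "hausdorff_pre 2 \<delta> E \<le> ennreal e" if e: "e > 0" for e :: real
  proof -
    obtain N0 :: nat where N0: "real N0 > 1 / min \<delta> (e / 2)" using reals_Archimedean2[of "1 / min \<delta> (e / 2)"] by blast
    define N where "N = Suc N0"
    have N0': "real N > 0" by (simp add: N_def)
    have q: "min \<delta> (e / 2) > 0" using \<delta> e by simp
    have "1 / min \<delta> (e / 2) < N" using N0 by (simp add: N_def)
    then have "1 < N * min \<delta> (e / 2)" using q by (simp only: pos_divide_less_eq)
    then have "1 / N \<le> min \<delta> (e / 2)" using N0' by (simp only: pos_divide_le_eq mult.commute less_imp_le)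
    note N = N0' this
    let ?I = "\<lambda>i::nat. {i / N..(i + 1) / N}"
    have dI: "diameter (?I i) = 1 / N" for i
      using N(1) by (subst diameter_Icc) (auto simp: divide_right_mono diff_divide_distrib[symmetric] add.commute)
    have "E \<subseteq> (\<Union>i\<in>{..N}. ?I i)"
    proof
      fix y assume "y \<in> E"
      then have y: "0 \<le> y" "y \<le> 1" using assms by auto
      define i where "i = nat \<lfloor>y * N\<rfloor>"
      have "0 \<le> y * N" using y N by simp
      then have i: "real i \<le> y * N" "y * N < real i + 1" unfolding i_def by linarith+
      have "y * N \<le> 1 * real N" using y N by (intro mult_right_mono) auto
      then have "real i \<le> N" using i by linarith
      then have "i \<in> {..N}" by simp
      moreover have "y \<in> ?I i" using i N(1) by (simp add: field_simps)
      ultimately show "y \<in> (\<Union>i\<in>{..N}. ?I i)" by blast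
    qed
    then have *: "hausdorff_pre 2 \<delta> E \<le> ennreal (\<Sum>i\<le>N. diameter (?I i) powr 2)"
      by (rule hausdorff_pre_finite_cover[rotated]) (use dI N \<delta> in auto)
    have "(\<Sum>i\<le>N. diameter (?I i) powr 2) = (N + 1) * (1 / N)^2" unfolding dI using N(1) by (simp add: powr_numeral)
    also have "\<dots> \<le> (2 * real N) * (1 / N)^2" by (intro mult_right_mono) (simp_all add: N_def)
    also have "\<dots> = 2 * (1 / N)" using N(1) by (simp add: power2_eq_square)
    also have "\<dots> \<le> e" using N(2) by simp
    finally have "(\<Sum>i\<le>N. diameter (?I i) powr 2) \<le> e" .
    then show ?thesis by (rule order_trans[OF * ennreal_leI])
  qed
  then show "hausdorff_pre 2 \<delta> E = 0" by (rule ennreal_eq_0I)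
qed

lemma hdim_le: "0 \<le> s \<Longrightarrow> hausdorff_measure s E = 0 \<Longrightarrow> hdim E \<le> s"
  unfolding hdim_def by (rule cInf_lower) (auto intro!: bdd_belowI[of _ 0])

lemma hdim_ge:
  assumes "E \<subseteq> {0..1}" "\<And>s. 0 \<le> s \<Longrightarrow> s < t \<Longrightarrow> hausdorff_measure s E \<noteq> 0"
  shows "t \<le> hdim E"
  unfolding hdim_def
proof (rule cInf_greatest)
  show "{s. 0 \<le> s \<and> hausdorff_measure s E = 0} \<noteq> {}" using hausdorff_measure_2[OF assms(1)] by force
  fix s assume "s \<in> {s. 0 \<le> s \<and> hausdorff_measure s E = 0}"
  then show "t \<le> s" using assms(2)[of s] by force
qed

lemma hdim_mono:
  assumes "E \<subseteq> F" "F \<subseteq> {0..1}"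
  shows "hdim E \<le> hdim F"
  unfolding hdim_def
proof (rule cInf_superset_mono)
  show "{s. 0 \<le> s \<and> hausdorff_measure s F = 0} \<noteq> {}" using hausdorff_measure_2[OF assms(2)] by force
  show "{s. 0 \<le> s \<and> hausdorff_measure s F = 0} \<subseteq> {s. 0 \<le> s \<and> hausdorff_measure s E = 0}"
  proof
    fix s assume "s \<in> {s. 0 \<le> s \<and> hausdorff_measure s F = 0}"
    then show "s \<in> {s. 0 \<le> s \<and> hausdorff_measure s E = 0}"
      using hausdorff_measure_mono[OF assms(1), of s] by simp
  qed
  show "bdd_below {s. 0 \<le> s \<and> hausdorff_measure s E = 0}" by (auto intro!: bdd_belowI[of _ 0])
qed

section \<open>Upper bounds for the dimension of level sets\<close>

context ifs
begin

definition len :: "nat list \<Rightarrow> real" where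
  "len w = Tl T w 1 - Tl T w 0"

definition near :: "((nat \<Rightarrow> nat) \<Rightarrow> real) \<Rightarrow> real \<Rightarrow> real \<Rightarrow> nat \<Rightarrow> nat list set" where
  "near f \<alpha> e n = {w \<in> words m n. \<exists>\<omega>\<in>Sig m. pref n \<omega> = w \<and> \<bar>bsum f n \<omega> - n * \<alpha>\<bar> \<le> n * e}"

lemma len_pos: "w \<in> words m n \<Longrightarrow> 0 < len w"
  unfolding len_def using Tl_strict_mono[of w 0 1] by (simp add: words_def)

text \<open>For weights \<open>len w powr s / Z\<close> the entropy is \<open>ln Z\<close> plus
  \<open>s\<close> times the mean of \<open>- ln (len w)\<close>. If \<open>Z > 1\<close>, the first
  term is positive, and distortion turns the second into \<open>s\<close> times the mean Birkhoff
  sum of \<open>g\<close>. A limit measure would have entropy at least \<open>s\<close> times its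
  exponent, against the strict inequality \<open>no\<close>.\<close>

lemma cover_sums:
  assumes f: "UC m f" and s: "s \<ge> 0"
    and no: "\<And>\<mu>. \<mu> \<in> inv_measures m \<Longrightarrow> integral\<^sup>L \<mu> f = \<alpha> \<Longrightarrow> ks_entropy \<mu> < s * lyap T DT \<mu>"
  shows "\<exists>e>0. \<exists>N. \<forall>n\<ge>N. (\<Sum>w\<in>near f \<alpha> e n. len w powr s) \<le> 1"
proof (rule ccontr)
  assume "\<not> ?thesis"
  then have neg: "\<exists>n\<ge>N. (\<Sum>w\<in>near f \<alpha> e n. len w powr s) > 1" if "e > 0" for e N
    using that by (meson not_le)
  have "\<exists>N. \<forall>n\<ge>N. \<forall>\<omega>\<in>Sig m. \<forall>x\<in>{0..1}. \<bar>ln (Dl T DT (pref n \<omega>) x) + bsum g n \<omega>\<bar> \<le> n * (1 / (real k + 1))" for k :: nat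
  proof -
    have "1 / (real k + 1) > 0" by simp
    from distortion[OF this] show ?thesis unfolding bsum_def by metis
  qed
  then obtain N where N: "\<And>k n \<omega> x. n \<ge> N k \<Longrightarrow> \<omega> \<in> Sig m \<Longrightarrow> x \<in> {0..1} \<Longrightarrow>
      \<bar>ln (Dl T DT (pref n \<omega>) x) + bsum g n \<omega>\<bar> \<le> n * (1 / (real k + 1))" by metis
  \<comment> \<open>\<open>Suc k\<close> makes the lengths positive and unbounded;
    \<open>N k\<close> makes the distortion error per symbol at most \<open>1 / (k + 1)\<close>, the
    same as the tolerance for \<open>f\<close>. Both vanish in the limit.\<close>
  have "\<exists>n. n \<ge> max (N k) (Suc k) \<and> (\<Sum>w\<in>near f \<alpha> (1 / (real k + 1)) n. len w powr s) > 1" for k :: nat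
    using neg[of "1 / (real k + 1)" "max (N k) (Suc k)"] by auto
  then obtain n where n: "\<And>k. n k \<ge> max (N k) (Suc k)"
    and Z1: "\<And>k. (\<Sum>w\<in>near f \<alpha> (1 / (real k + 1)) (n k). len w powr s) > 1" by metis
  define W where "W k = near f \<alpha> (1 / (real k + 1)) (n k)" for k
  define Z where "Z k = (\<Sum>w\<in>W k. len w powr s)" for k
  have Z: "Z k > 1" for k using Z1 by (simp add: Z_def W_def)
  define P where "P k w = len w powr s / Z k" for k w
  have fW: "finite (W k)" for k unfolding W_def near_def by (rule finite_subset[OF _ finite_words]) auto
  have Ww: "w \<in> words m (n k)" if "w \<in> W k" for w k using that by (simp add: W_def near_def)
  define Q where "Q k w \<omega> \<longleftrightarrow> \<omega> \<in> Sig m \<and> pref (n k) \<omega> = w \<and> \<bar>bsum f (n k) \<omega> - n k * \<alpha>\<bar> \<le> n k * (1 / (real k + 1))" for k w \<omega>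
  define x where "x k w = (SOME \<omega>. Q k w \<omega>)" for k w
  have x: "x k w \<in> Sig m \<and> pref (n k) (x k w) = w \<and> \<bar>bsum f (n k) (x k w) - n k * \<alpha>\<bar> \<le> n k * (1 / (real k + 1))"
    if "w \<in> W k" for k w
  proof -
    have "\<exists>\<omega>. Q k w \<omega>" using that by (auto simp: W_def near_def Q_def)
    then have "Q k w (x k w)" unfolding x_def by (rule someI_ex)
    then show ?thesis by (simp add: Q_def)
  qed
  have Z0: "0 < Z k" for k by (rule less_trans[OF zero_less_one Z])
  have Pnn: "0 \<le> P k w" for k w unfolding P_def by (rule divide_nonneg_pos[OF powr_ge_zero Z0])
  have Psum: "(\<Sum>w\<in>W k. P k w) = 1" for k
  proof -
    have "(\<Sum>w\<in>W k. P k w) = Z k / Z k" unfolding P_def sum_divide_distrib[symmetric] by (simp only: Z_def)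
    then show ?thesis using Z0[of k] by simp
  qed
  have emp: "empirical m (n k) (W k) (P k) (x k)" for k
  proof (rule empirical.intro)
    show "1 \<le> n k" using n[of k] by simp
    show "inj_on (\<lambda>w. pref (n k) (x k w)) (W k)"
    proof (rule inj_onI)
      fix u v assume "u \<in> W k" "v \<in> W k" "pref (n k) (x k u) = pref (n k) (x k v)"
      then show "u = v" using x[OF \<open>u \<in> W k\<close>] x[OF \<open>v \<in> W k\<close>] by simp
    qed
    show "x k w \<in> Sig m" if "w \<in> W k" for w using x[OF that] by blast
  qed (rule m fW Pnn Psum)+
  have nk: "n k \<ge> k" for k using n[of k] by simp
  have nk1: "real (n k) > 0" for k using n[of k] by simp
  obtain r \<mu> where r: "strict_mono r" and \<mu>: "\<mu> \<in> inv_measures m"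
    and J': "\<forall>\<phi>. UC m \<phi> \<longrightarrow> (\<lambda>k. empirical.J (n (r k)) (W (r k)) (P (r k)) (x (r k)) \<phi>) \<longlonglongrightarrow> integral\<^sup>L \<mu> \<phi>"
    and ent: "\<forall>(c :: nat \<Rightarrow> real) C. c \<longlonglongrightarrow> C \<longrightarrow> (\<forall>k. n (r k) * c k \<le> (\<Sum>w\<in>W (r k). eta (P (r k) w))) \<longrightarrow> C \<le> ks_entropy \<mu>"
    using empirical_limit[OF emp nk] by blast
  have J: "(\<lambda>k. empirical.J (n (r k)) (W (r k)) (P (r k)) (x (r k)) \<phi>) \<longlonglongrightarrow> integral\<^sup>L \<mu> \<phi>" if "UC m \<phi>" for \<phi>
    using J' that by blast
  have Jdef: "empirical.J (n k) (W k) (P k) (x k) \<phi> = (\<Sum>w\<in>W k. P k w * bsum \<phi> (n k) (x k w)) / n k" for k \<phi>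
    by (rule empirical.J_def[OF emp])
  have rk: "r k \<ge> k" for k by (rule seq_suble[OF r])
  have inv0: "(\<lambda>k. 1 / (real (r k) + 1)) \<longlonglongrightarrow> 0"
  proof (rule tendsto_sandwich[of "\<lambda>_. 0" _ _ "\<lambda>k. 1 / (real k + 1)"])
    show "\<forall>\<^sub>F k in sequentially. 1 / (real (r k) + 1) \<le> 1 / (real k + 1)"
      using rk by (intro always_eventually allI divide_left_mono) auto
    show "(\<lambda>k. 1 / (real k + 1)) \<longlonglongrightarrow> 0" using LIMSEQ_inverse_real_of_nat by (simp add: inverse_eq_divide add.commute)
  qed auto
  have fa: "integral\<^sup>L \<mu> f = \<alpha>"
  proof -
    have "\<bar>empirical.J (n k) (W k) (P k) (x k) f - \<alpha>\<bar> \<le> 1 / (real k + 1)" for k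
    proof -
      have "(\<Sum>w\<in>W k. P k w * bsum f (n k) (x k w)) - n k * \<alpha> = (\<Sum>w\<in>W k. P k w * (bsum f (n k) (x k w) - n k * \<alpha>))"
        by (simp add: right_diff_distrib sum_subtractf sum_distrib_right[symmetric] Psum)
      then have "\<bar>(\<Sum>w\<in>W k. P k w * bsum f (n k) (x k w)) - n k * \<alpha>\<bar> \<le> (\<Sum>w\<in>W k. \<bar>P k w * (bsum f (n k) (x k w) - n k * \<alpha>)\<bar>)"
        by (simp only: sum_abs)
      also have "\<dots> \<le> (\<Sum>w\<in>W k. P k w * (n k * (1 / (real k + 1))))"
      proof (rule sum_mono)
        fix w assume "w \<in> W k"
        then have "\<bar>bsum f (n k) (x k w) - n k * \<alpha>\<bar> \<le> n k * (1 / (real k + 1))" using x by blast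
        then show "\<bar>P k w * (bsum f (n k) (x k w) - n k * \<alpha>)\<bar> \<le> P k w * (n k * (1 / (real k + 1)))"
          using Pnn[of k w] unfolding abs_mult by (simp only: abs_of_nonneg mult_left_mono)
      qed
      also have "\<dots> = n k * (1 / (real k + 1))" unfolding sum_distrib_right[symmetric] Psum by simp
      finally have le: "\<bar>(\<Sum>w\<in>W k. P k w * bsum f (n k) (x k w)) - n k * \<alpha>\<bar> \<le> n k * (1 / (real k + 1))" .
      have "empirical.J (n k) (W k) (P k) (x k) f - \<alpha> = ((\<Sum>w\<in>W k. P k w * bsum f (n k) (x k w)) - n k * \<alpha>) / n k"
        unfolding Jdef using nk1[of k] by (simp add: diff_divide_distrib)
      then have "\<bar>empirical.J (n k) (W k) (P k) (x k) f - \<alpha>\<bar> = \<bar>(\<Sum>w\<in>W k. P k w * bsum f (n k) (x k w)) - n k * \<alpha>\<bar> / n k"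
        using nk1[of k] by (simp add: abs_divide)
      also have "\<dots> \<le> n k * (1 / (real k + 1)) / n k" by (rule divide_right_mono[OF le]) simp
      finally show ?thesis using nk1[of k] by simp
    qed
    then have "(\<lambda>k. empirical.J (n (r k)) (W (r k)) (P (r k)) (x (r k)) f - \<alpha>) \<longlonglongrightarrow> 0"
      by (intro Lim_null_comparison[OF _ inv0] always_eventually) auto
    then have "(\<lambda>k. empirical.J (n (r k)) (W (r k)) (P (r k)) (x (r k)) f) \<longlonglongrightarrow> \<alpha>" by (rule Lim_null[THEN iffD2])
    then show ?thesis using J[OF f] LIMSEQ_unique by blast
  qed
  have "s * integral\<^sup>L \<mu> g - s * 0 \<le> ks_entropy \<mu>"
  proof (rule ent[rule_format])
    show "(\<lambda>k. s * empirical.J (n (r k)) (W (r k)) (P (r k)) (x (r k)) g - s * (1 / (real (r k) + 1))) \<longlonglongrightarrow> s * integral\<^sup>L \<mu> g - s * 0"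
      by (intro tendsto_diff tendsto_mult tendsto_const J[OF UC_g] inv0)
    have "n k * (s * empirical.J (n k) (W k) (P k) (x k) g - s * (1 / (real k + 1))) \<le> (\<Sum>w\<in>W k. eta (P k w))" for k
    proof -
      have "n k * (s * empirical.J (n k) (W k) (P k) (x k) g - s * (1 / (real k + 1))) =
          s * (\<Sum>w\<in>W k. P k w * bsum g (n k) (x k w)) - s * (n k * (1 / (real k + 1))) * (\<Sum>w\<in>W k. P k w)"
        unfolding Jdef using nk1[of k] Psum[of k] by (simp add: right_diff_distrib)
      also have "\<dots> = (\<Sum>w\<in>W k. P k w * (s * (bsum g (n k) (x k w) - n k * (1 / (real k + 1)))))"
        by (simp add: sum_distrib_left sum_subtractf algebra_simps sum_divide_distrib)
      also have "\<dots> \<le> (\<Sum>w\<in>W k. eta (P k w))"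
      proof (rule sum_mono)
        fix w assume w: "w \<in> W k"
        have lw: "len w > 0" by (rule len_pos[OF Ww[OF w]])
        have sw: "set w \<subseteq> {1..m}" using Ww[OF w] by (simp add: words_def)
        obtain z where z: "z \<in> {0..1}" "len w = Dl T DT w z" unfolding len_def using interval_length[OF sw] by blast
        have "\<bar>ln (len w) + bsum g (n k) (x k w)\<bar> \<le> n k * (1 / (real k + 1))"
          using N[of k "n k" "x k w" z] n[of k] x[OF w] z by simp
        then have "bsum g (n k) (x k w) - n k * (1 / (real k + 1)) \<le> - ln (len w)" by linarith
        then have "s * (bsum g (n k) (x k w) - n k * (1 / (real k + 1))) \<le> s * (- ln (len w))" using s by (rule mult_left_mono)
        also have "\<dots> \<le> - ln (P k w)"
        proof -
          \<comment> \<open>Normalisation can only lower the weights, as \<open>Z k > 1\<close>;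
            this is where the assumption on large sums enters.\<close>
          have "ln (P k w) = s * ln (len w) - ln (Z k)" using lw Z[of k] by (simp add: P_def ln_div ln_powr)
          moreover have "ln (Z k) \<ge> 0" using Z[of k] by simp
          ultimately show ?thesis by simp
        qed
        finally have "P k w * (s * (bsum g (n k) (x k w) - n k * (1 / (real k + 1)))) \<le> P k w * (- ln (P k w))"
          using Pnn by (rule mult_left_mono)
        then show "P k w * (s * (bsum g (n k) (x k w) - n k * (1 / (real k + 1)))) \<le> eta (P k w)" by (simp add: eta_def)
      qed
      finally show ?thesis .
    qed
    then show "n (r k) * (s * empirical.J (n (r k)) (W (r k)) (P (r k)) (x (r k)) g - s * (1 / (real (r k) + 1))) \<le> (\<Sum>w\<in>W (r k). eta (P (r k) w))" for k
      by blast
  qed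
  then have "s * lyap T DT \<mu> \<le> ks_entropy \<mu>" by (simp add: lyap_def)
  then show False using no[OF \<mu> fa] by simp
qed

text \<open>The level set is a countable union of sets \<open>X N\<close> on which the averages stay
  within \<open>e\<close> of \<open>\<alpha>\<close> from time \<open>N\<close> on, and each is
  covered at any single late level. Sums at exponent \<open>s\<close> are merely bounded; the excess
  \<open>t - s\<close> together with shrinking lengths makes them small.\<close>

lemma hausdorff_upper:
  assumes f: "UC m f" and s: "s \<ge> 0" and t: "t > s"
    and no: "\<And>\<mu>. \<mu> \<in> inv_measures m \<Longrightarrow> integral\<^sup>L \<mu> f = \<alpha> \<Longrightarrow> ks_entropy \<mu> < s * lyap T DT \<mu>"
  shows "hausdorff_measure t (Pi_map T ` level_set m f \<alpha>) = 0"
proof -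
  obtain e N0 where e: "e > 0" and N0: "\<And>n. n \<ge> N0 \<Longrightarrow> (\<Sum>w\<in>near f \<alpha> e n. len w powr s) \<le> 1"
    using cover_sums[OF f s no] by blast
  define X where "X N = {\<omega> \<in> Sig m. \<forall>n\<ge>N. \<bar>bsum f n \<omega> - n * \<alpha>\<bar> \<le> n * e}" for N
  have sub: "Pi_map T ` level_set m f \<alpha> \<subseteq> (\<Union>N. Pi_map T ` X N)"
  proof
    fix y assume "y \<in> Pi_map T ` level_set m f \<alpha>"
    then obtain \<omega> where \<omega>: "\<omega> \<in> Sig m" "(\<lambda>n. bsum f n \<omega> / n) \<longlonglongrightarrow> \<alpha>" "y = Pi_map T \<omega>"
      unfolding level_set_def birk_avg_eq[abs_def] by auto
    obtain N where N: "\<And>n. n \<ge> N \<Longrightarrow> norm (bsum f n \<omega> / n - \<alpha>) < e" using LIMSEQ_D[OF \<omega>(2) e] by blast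
    have "\<bar>bsum f n \<omega> - n * \<alpha>\<bar> \<le> n * e" if "n \<ge> max N 1" for n
    proof -
      have n0: "real n > 0" using that by simp
      have "bsum f n \<omega> - n * \<alpha> = n * (bsum f n \<omega> / n - \<alpha>)" using n0 by (simp add: right_diff_distrib)
      then have "\<bar>bsum f n \<omega> - n * \<alpha>\<bar> = n * \<bar>bsum f n \<omega> / n - \<alpha>\<bar>" by (simp add: abs_mult)
      also have "\<dots> \<le> n * e" using N[of n] that by (intro mult_left_mono) auto
      finally show ?thesis .
    qed
    then have "\<omega> \<in> X (max N 1)" using \<omega>(1) unfolding X_def by blast
    then show "y \<in> (\<Union>N. Pi_map T ` X N)" using \<omega>(3) by blast
  qed
  have "hausdorff_measure t (\<Union>N. Pi_map T ` X N) = 0"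
  proof (rule hausdorff_measure_zeroI)
    fix \<delta> :: real assume \<delta>: "\<delta> > 0"
    show "hausdorff_pre t \<delta> (\<Union>N. Pi_map T ` X N) = 0"
    proof (rule hausdorff_pre_UN_zero)
      fix N
      have "hausdorff_pre t \<delta> (Pi_map T ` X N) \<le> ennreal \<epsilon>" if \<epsilon>: "\<epsilon> > 0" for \<epsilon> :: real
      proof -
        \<comment> \<open>Lengths below \<open>d\<close> are admissible for \<open>\<delta>\<close>
          and have \<open>(t - s)\<close>-th power at most \<open>\<epsilon>\<close>.\<close>
        define d where "d = min \<delta> (\<epsilon> powr (1 / (t - s)))"
        have d: "d > 0" using \<delta> \<epsilon> by (simp add: d_def)
        obtain K where K: "\<And>n w x y. n \<ge> K \<Longrightarrow> w \<in> words m n \<Longrightarrow> x \<in> {0..1} \<Longrightarrow> y \<in> {0..1} \<Longrightarrow> \<bar>Tl T w x - Tl T w y\<bar> < d"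
          using Tl_small[OF d] by metis
        define n where "n = max (max N N0) K"
        have n: "n \<ge> N" "n \<ge> N0" "n \<ge> K" by (auto simp: n_def)
        let ?W = "near f \<alpha> e n"
        let ?I = "\<lambda>w. {Tl T w 0..Tl T w 1}"
        have Ww: "w \<in> words m n" if "w \<in> ?W" for w using that by (simp add: near_def)
        have fW: "finite ?W" unfolding near_def by (rule finite_subset[OF _ finite_words]) auto
        have dI: "diameter (?I w) = len w" if "w \<in> ?W" for w
          using len_pos[OF Ww[OF that]] unfolding len_def by (subst diameter_Icc) auto
        have ld: "len w < d" if "w \<in> ?W" for w
          using K[OF n(3) Ww[OF that], of 1 0] unfolding len_def by auto
        have cov: "Pi_map T ` X N \<subseteq> (\<Union>w\<in>?W. ?I w)"
        proof
          fix y assume "y \<in> Pi_map T ` X N"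
          then obtain \<omega> where \<omega>: "\<omega> \<in> X N" "y = Pi_map T \<omega>" by blast
          then have S: "\<omega> \<in> Sig m" and b: "\<bar>bsum f n \<omega> - n * \<alpha>\<bar> \<le> n * e" using n(1) by (auto simp: X_def)
          have "pref n \<omega> \<in> ?W" using S b pref_in_words[OF S] by (auto simp: near_def)
          then show "y \<in> (\<Union>w\<in>?W. ?I w)" using Pi_interval[OF S, of n] \<omega>(2) by blast
        qed
        have *: "hausdorff_pre t \<delta> (Pi_map T ` X N) \<le> ennreal (\<Sum>w\<in>?W. diameter (?I w) powr t)"
          by (rule hausdorff_pre_finite_cover[OF fW cov]) (use dI ld \<delta> in \<open>auto simp: d_def less_imp_le\<close>)
        have "(\<Sum>w\<in>?W. diameter (?I w) powr t) \<le> (\<Sum>w\<in>?W. \<epsilon> * len w powr s)"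
        proof (rule sum_mono)
          fix w assume w: "w \<in> ?W"
          have l0: "0 < len w" by (rule len_pos[OF Ww[OF w]])
          have "len w powr t = len w powr (t - s) * len w powr s" by (simp flip: powr_add)
          also have "len w powr (t - s) \<le> (\<epsilon> powr (1 / (t - s))) powr (t - s)"
            using ld[OF w] l0 t by (intro powr_mono2) (auto simp: d_def)
          also have "\<dots> = \<epsilon>" using t \<epsilon> by (simp add: powr_powr)
          finally show "diameter (?I w) powr t \<le> \<epsilon> * len w powr s" unfolding dI[OF w] by (simp add: mult_right_mono)
        qed
        also have "\<dots> = \<epsilon> * (\<Sum>w\<in>?W. len w powr s)" by (simp add: sum_distrib_left)
        also have "\<dots> \<le> \<epsilon> * 1" using N0[OF n(2)] \<epsilon> by (intro mult_left_mono) auto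
        finally have "(\<Sum>w\<in>?W. diameter (?I w) powr t) \<le> \<epsilon>" by simp
        then show ?thesis by (rule order_trans[OF * ennreal_leI])
      qed
      then show "hausdorff_pre t \<delta> (Pi_map T ` X N) = 0" by (rule ennreal_eq_0I)
    qed
  qed
  then show ?thesis using hausdorff_measure_mono[OF sub, of t] by simp
qed

end

section \<open>Invariant measures: mixtures, limits and vanishing Lyapunov exponent\<close>

lemma cyl_sum_tendsto:
  assumes \<mu>: "\<mu> \<in> inv_measures m" and \<phi>: "UC m \<phi>" and m: "m \<ge> 1"
  shows "(\<lambda>K. cyl_sum m (law m \<mu>) \<phi> K) \<longlonglongrightarrow> integral\<^sup>L \<mu> \<phi>"
proof (rule LIMSEQ_I)
  fix e :: real assume e: "e > 0"
  from UC_obtain[OF \<phi> half_gt_zero[OF e]] obtain K where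
    K: "\<And>\<omega> \<omega>'. \<omega> \<in> Sig m \<Longrightarrow> \<omega>' \<in> Sig m \<Longrightarrow> pref K \<omega> = pref K \<omega>' \<Longrightarrow> \<bar>\<phi> \<omega> - \<phi> \<omega>'\<bar> < e / 2" by auto
  have "norm (cyl_sum m (law m \<mu>) \<phi> L - integral\<^sup>L \<mu> \<phi>) < e" if L: "L \<ge> K" for L
  proof -
    have "\<bar>integral\<^sup>L \<mu> \<phi> - cyl_sum m (law m \<mu>) \<phi> L\<bar> \<le> e / 2"
    proof (rule integral_cyl_sum[OF \<mu> \<phi> m])
      fix \<omega> \<omega>' assume w: "\<omega> \<in> Sig m" "\<omega>' \<in> Sig m" "pref L \<omega> = pref L \<omega>'"
      then have "pref K \<omega> = pref K \<omega>'" using L by (auto simp: pref_eq_iff)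
      from K[OF w(1,2) this] show "\<bar>\<phi> \<omega> - \<phi> \<omega>'\<bar> \<le> e / 2" by simp
    qed
    then show ?thesis using e by (simp add: abs_minus_commute)
  qed
  then show "\<exists>no. \<forall>n\<ge>no. norm (cyl_sum m (law m \<mu>) \<phi> n - integral\<^sup>L \<mu> \<phi>) < e" by blast
qed

text \<open>The mixture is formed on laws and realised by \<open>law_exists\<close>; its integrals
  follow from the linearity of cylinder sums. Concavity of \<open>eta\<close> bounds its cylinder
  entropies below, and the nonnegative share of \<open>\<nu>\<close> is dropped.\<close>

lemma mixture:
  assumes \<mu>: "\<mu> \<in> inv_measures m" and \<nu>: "\<nu> \<in> inv_measures m" and t: "0 \<le> t" "t \<le> 1"
  shows "\<exists>\<rho>\<in>inv_measures m. (\<forall>\<phi>. UC m \<phi> \<longrightarrow> integral\<^sup>L \<rho> \<phi> = t * integral\<^sup>L \<mu> \<phi> + (1 - t) * integral\<^sup>L \<nu> \<phi>) \<and>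
     (\<forall>n. t * Hn m (law m \<mu>) n \<le> Hn m (law m \<rho>) n)"
proof -
  define p where "p w = t * law m \<mu> w + (1 - t) * law m \<nu> w" for w
  have l: "is_law m (law m \<mu>)" "is_law m (law m \<nu>)" using law_is_law \<mu> \<nu> by auto
  have m: "m \<ge> 1" by (rule is_law_m[OF l(1)])
  have "is_law m p" unfolding is_law_def
  proof (intro conjI allI impI)
    fix w
    show "0 \<le> p w" using t law_range(1)[OF \<mu>, of w] law_range(1)[OF \<nu>, of w] by (simp add: p_def)
    show "p [] = 1" using l by (simp add: is_law_def p_def)
    have "(\<Sum>a\<in>{1..m}. p (w @ [a])) = t * (\<Sum>a\<in>{1..m}. law m \<mu> (w @ [a])) + (1 - t) * (\<Sum>a\<in>{1..m}. law m \<nu> (w @ [a]))"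
      unfolding p_def by (simp only: sum.distrib sum_distrib_left)
    then show "(\<Sum>a\<in>{1..m}. p (w @ [a])) = p w" using l unfolding is_law_def p_def by metis
    have "(\<Sum>a\<in>{1..m}. p (a # w)) = t * (\<Sum>a\<in>{1..m}. law m \<mu> (a # w)) + (1 - t) * (\<Sum>a\<in>{1..m}. law m \<nu> (a # w))"
      unfolding p_def by (simp only: sum.distrib sum_distrib_left)
    then show "(\<Sum>a\<in>{1..m}. p (a # w)) = p w" using l unfolding is_law_def p_def by metis
    assume "\<not> set w \<subseteq> {1..m}"
    then show "p w = 0" using l by (simp add: is_law_def p_def)
  qed
  then obtain \<rho> where \<rho>: "\<rho> \<in> inv_measures m" "law m \<rho> = p" using law_exists by blast
  have "integral\<^sup>L \<rho> \<phi> = t * integral\<^sup>L \<mu> \<phi> + (1 - t) * integral\<^sup>L \<nu> \<phi>" if \<phi>: "UC m \<phi>" for \<phi>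
  proof -
    have "cyl_sum m p \<phi> K = t * cyl_sum m (law m \<mu>) \<phi> K + (1 - t) * cyl_sum m (law m \<nu>) \<phi> K" for K
      unfolding cyl_sum_def p_def by (simp add: sum_distrib_left sum.distrib[symmetric] algebra_simps)
    then have "(\<lambda>K. cyl_sum m p \<phi> K) \<longlonglongrightarrow> t * integral\<^sup>L \<mu> \<phi> + (1 - t) * integral\<^sup>L \<nu> \<phi>"
      using cyl_sum_tendsto[OF \<mu> \<phi> m] cyl_sum_tendsto[OF \<nu> \<phi> m] by (simp add: tendsto_intros)
    then show ?thesis using cyl_sum_tendsto[OF \<rho>(1) \<phi> m] LIMSEQ_unique unfolding \<rho>(2) by blast
  qed
  moreover have "t * Hn m (law m \<mu>) n \<le> Hn m (law m \<rho>) n" for n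
    unfolding \<rho>(2) Hn_def sum_distrib_left
  proof (rule sum_mono)
    fix w
    define u where "u i = (if i then t else 1 - t)" for i
    define x where "x i = (if i then law m \<mu> w else law m \<nu> w)" for i
    have "(\<Sum>i\<in>UNIV. u i * eta (x i)) \<le> eta (\<Sum>i\<in>UNIV. u i * x i)"
      by (rule eta_jensen) (use t law_range[OF \<mu>] law_range[OF \<nu>] in \<open>auto simp: u_def x_def UNIV_bool\<close>)
    then have "t * eta (law m \<mu> w) + (1 - t) * eta (law m \<nu> w) \<le> eta (p w)"
      by (simp add: UNIV_bool u_def x_def p_def add.commute)
    moreover have "0 \<le> (1 - t) * eta (law m \<nu> w)"
      using t law_range[OF \<nu>, of w] by (intro mult_nonneg_nonneg eta_nonneg) auto
    ultimately show "t * eta (law m \<mu> w) \<le> eta (p w)" by linarith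
  qed
  ultimately show ?thesis using \<rho>(1) by blast
qed

lemma inv_measure_limit:
  fixes \<alpha> :: real
  assumes \<mu>: "\<And>k. \<mu> k \<in> inv_measures m" and f: "UC m f" and lim: "(\<lambda>k. integral\<^sup>L (\<mu> k) f) \<longlonglongrightarrow> \<alpha>"
  shows "\<exists>\<nu>\<in>inv_measures m. integral\<^sup>L \<nu> f = \<alpha>"
proof -
  define q where "q k = law m (\<mu> k)" for k
  have l: "is_law m (q k)" for k unfolding q_def by (rule law_is_law[OF \<mu>])
  have m: "m \<ge> 1" by (rule is_law_m[OF l])
  have q01: "0 \<le> q k w" "q k w \<le> 1" for k w unfolding q_def by (rule law_range[OF \<mu>])+
  obtain r p where r: "strict_mono r" and p: "\<And>w. (\<lambda>k. q (r k) w) \<longlonglongrightarrow> p w"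
    using laws_compact[of q] q01 by blast
  have "is_law m p"
    by (rule limit_is_law[OF p, where c = "\<lambda>_. 0"]) (use l in \<open>simp_all add: is_law_def\<close>)
  then obtain \<nu> where \<nu>: "\<nu> \<in> inv_measures m" "law m \<nu> = p" using law_exists by blast
  have "(\<lambda>k. integral\<^sup>L (\<mu> (r k)) f) \<longlonglongrightarrow> integral\<^sup>L \<nu> f"
  proof (rule integral_limit[OF \<nu>(1) f m, where q = "\<lambda>k. q (r k)"])
    show "(\<lambda>k. q (r k) w) \<longlonglongrightarrow> law m \<nu> w" for w unfolding \<nu>(2) by (rule p)
    show "\<bar>integral\<^sup>L (\<mu> (r k)) f - cyl_sum m (q (r k)) f K\<bar> \<le> e"
      if "\<And>\<omega> \<omega>'. \<omega> \<in> Sig m \<Longrightarrow> \<omega>' \<in> Sig m \<Longrightarrow> pref K \<omega> = pref K \<omega>' \<Longrightarrow> \<bar>f \<omega> - f \<omega>'\<bar> \<le> e" for K e k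
      unfolding q_def by (rule integral_cyl_sum[OF \<mu> f m that])
  qed
  moreover have "(\<lambda>k. integral\<^sup>L (\<mu> (r k)) f) \<longlonglongrightarrow> \<alpha>"
    using LIMSEQ_subseq_LIMSEQ[OF lim r] by (simp add: comp_def)
  ultimately show ?thesis using LIMSEQ_unique \<nu>(1) by blast
qed

section \<open>Point masses and attainable integrals\<close>

lemma const_Sig: "i \<in> {1..m} \<Longrightarrow> (\<lambda>_. i) \<in> Sig m"
  by (simp add: Sig_def)

text \<open>Besides providing the measures to mix with, this makes the set of ergodic integrals
  nonempty, so that its infimum and supremum are meaningful.\<close>

lemma dirac_erg:
  assumes i: "i \<in> {1..m}"
  shows "return (SigM m) (\<lambda>_. i) \<in> erg_measures m"
proof -
  let ?\<mu> = "return (SigM m) (\<lambda>_. i)"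
  have sp: "(\<lambda>_. i) \<in> space (SigM m)" using const_Sig[OF i] by simp
  interpret prob_space ?\<mu> by (rule prob_space_return[OF sp])
  have sh: "shift (\<lambda>_. i) = (\<lambda>_. i)" by (simp add: shift_def)
  have "?\<mu> \<in> inv_measures m" unfolding inv_measures_def
  proof (intro CollectI conjI ballI)
    show "prob_space ?\<mu>" by (rule prob_space_return[OF sp])
    fix A assume A: "A \<in> sets ?\<mu>"
    then have "shift -` A \<inter> Sig m \<in> sets (SigM m)" using measurable_sets[OF measurable_shift, of A m] by simp
    then show "emeasure ?\<mu> (shift -` A \<inter> space ?\<mu>) = emeasure ?\<mu> A"
      using A const_Sig[OF i] by (simp add: emeasure_return indicator_def sh)
  qed simp
  moreover have "measure ?\<mu> A = 0 \<or> measure ?\<mu> A = 1" if "A \<in> sets ?\<mu>" for A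
    using that by (simp add: measure_return indicator_def)
  ultimately show ?thesis unfolding erg_measures_def by blast
qed

lemma integral_dirac:
  assumes i: "i \<in> {1..m}" and m: "m \<ge> 1" and \<phi>: "UC m \<phi>"
  shows "integral\<^sup>L (return (SigM m) (\<lambda>_. i)) \<phi> = \<phi> (\<lambda>_. i)"
  by (rule integral_return) (use const_Sig[OF i] UC_measurable[OF \<phi> m refl] in auto)

lemma erg_inv: "\<mu> \<in> erg_measures m \<Longrightarrow> \<mu> \<in> inv_measures m"
  by (simp add: erg_measures_def)

lemma integral_bound:
  assumes \<mu>: "\<mu> \<in> inv_measures m" and f: "UC m f" and m: "m \<ge> 1"
    and B: "\<And>\<omega>. \<omega> \<in> Sig m \<Longrightarrow> \<bar>f \<omega>\<bar> \<le> B"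
  shows "\<bar>integral\<^sup>L \<mu> f\<bar> \<le> B"
proof -
  note D = inv_measuresD[OF \<mu>]
  interpret prob_space \<mu> by (rule D(1))
  have "\<bar>integral\<^sup>L \<mu> f\<bar> \<le> (\<integral>\<omega>. \<bar>f \<omega>\<bar> \<partial>\<mu>)" by (rule integral_abs_bound)
  also have "\<dots> \<le> (\<integral>\<omega>. B \<partial>\<mu>)"
    by (rule integral_mono) (use UC_integrable[OF f m D(2,1)] B D(3) in auto)
  also have "\<dots> = B" using prob_space by simp
  finally show ?thesis .
qed

text \<open>The ergodic extremes are only approached. Either one of two nearly extremal measures
  already has integral close to \<open>\<alpha>\<close>, or \<open>\<alpha>\<close> lies strictly
  between and a mixture hits it; compactness removes the remaining error.\<close>

lemma exists_measure_with_integral: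
  assumes f: "UC m f" and m: "m \<ge> 1"
    and \<alpha>: "\<alpha> \<in> {Inf {integral\<^sup>L \<mu> f | \<mu>. \<mu> \<in> erg_measures m} .. Sup {integral\<^sup>L \<mu> f | \<mu>. \<mu> \<in> erg_measures m}}"
  shows "\<exists>\<nu>\<in>inv_measures m. integral\<^sup>L \<nu> f = \<alpha>"
proof -
  let ?S = "{integral\<^sup>L \<mu> f | \<mu>. \<mu> \<in> erg_measures m}"
  have ne: "?S \<noteq> {}" using dirac_erg[of 1 m] m by auto
  obtain B where B: "\<And>\<omega>. \<omega> \<in> Sig m \<Longrightarrow> \<bar>f \<omega>\<bar> \<le> B" using UC_bounded[OF f] by auto
  have bd: "\<bar>y\<bar> \<le> B" if "y \<in> ?S" for y using that integral_bound[OF erg_inv f m B] by auto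
  have bb: "bdd_below ?S" by (rule bdd_belowI[of _ "- B"]) (use bd in force)
  have ba: "bdd_above ?S" by (rule bdd_aboveI[of _ B]) (use bd in force)
  have ex: "\<exists>\<nu>\<in>inv_measures m. \<bar>integral\<^sup>L \<nu> f - \<alpha>\<bar> \<le> 1 / (real k + 1)" for k :: nat
  proof -
    have e: "1 / (real k + 1) > 0" by simp
    have "Inf ?S < \<alpha> + 1 / (real k + 1)" using \<alpha> e unfolding atLeastAtMost_iff by linarith
    then obtain \<mu> where \<mu>: "\<mu> \<in> inv_measures m" "integral\<^sup>L \<mu> f < \<alpha> + 1 / (real k + 1)"
      unfolding cInf_less_iff[OF ne bb] using erg_inv by blast
    have "\<alpha> - 1 / (real k + 1) < Sup ?S" using \<alpha> e unfolding atLeastAtMost_iff by linarith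
    then obtain \<nu> where \<nu>: "\<nu> \<in> inv_measures m" "\<alpha> - 1 / (real k + 1) < integral\<^sup>L \<nu> f"
      unfolding less_cSup_iff[OF ne ba] using erg_inv by blast
    show ?thesis
    proof (cases "integral\<^sup>L \<mu> f < \<alpha> \<and> \<alpha> < integral\<^sup>L \<nu> f")
      case False
      then have "\<bar>integral\<^sup>L \<mu> f - \<alpha>\<bar> \<le> 1 / (real k + 1) \<or> \<bar>integral\<^sup>L \<nu> f - \<alpha>\<bar> \<le> 1 / (real k + 1)"
        using \<mu>(2) \<nu>(2) by linarith
      then show ?thesis using \<mu>(1) \<nu>(1) by blast
    next
      case True
      define a b where "a = integral\<^sup>L \<mu> f" and "b = integral\<^sup>L \<nu> f"
      have ab: "a < \<alpha>" "\<alpha> < b" using True by (simp_all add: a_def b_def)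
      define t where "t = (b - \<alpha>) / (b - a)"
      have t: "0 \<le> t" "t \<le> 1" using ab by (simp_all add: t_def)
      have "t * (b - a) = b - \<alpha>" using ab by (simp add: t_def)
      then have eq: "t * a + (1 - t) * b = \<alpha>" by (simp add: algebra_simps)
      obtain \<rho> where "\<rho> \<in> inv_measures m" "integral\<^sup>L \<rho> f = t * a + (1 - t) * b"
        using mixture[OF \<mu>(1) \<nu>(1) t] f unfolding a_def b_def by blast
      then show ?thesis using eq by (intro bexI[of _ \<rho>]) auto
    qed
  qed
  define \<mu> where "\<mu> k = (SOME \<nu>. \<nu> \<in> inv_measures m \<and> \<bar>integral\<^sup>L \<nu> f - \<alpha>\<bar> \<le> 1 / (real k + 1))" for k
  have \<mu>: "\<mu> k \<in> inv_measures m \<and> \<bar>integral\<^sup>L (\<mu> k) f - \<alpha>\<bar> \<le> 1 / (real k + 1)" for k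
  proof -
    have "\<exists>\<nu>. \<nu> \<in> inv_measures m \<and> \<bar>integral\<^sup>L \<nu> f - \<alpha>\<bar> \<le> 1 / (real k + 1)" using ex[of k] by blast
    then show ?thesis unfolding \<mu>_def by (rule someI_ex)
  qed
  have z: "(\<lambda>k. 1 / (real k + 1)) \<longlonglongrightarrow> 0" using LIMSEQ_inverse_real_of_nat by (simp add: inverse_eq_divide add.commute)
  have "(\<lambda>k. integral\<^sup>L (\<mu> k) f - \<alpha>) \<longlonglongrightarrow> 0"
  proof (rule Lim_null_comparison[OF _ z])
    show "\<forall>\<^sub>F k in sequentially. norm (integral\<^sup>L (\<mu> k) f - \<alpha>) \<le> 1 / (real k + 1)"
      unfolding real_norm_def by (intro always_eventually allI conjunct2[OF \<mu>])
  qed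
  then have "(\<lambda>k. integral\<^sup>L (\<mu> k) f) \<longlonglongrightarrow> \<alpha>" by (rule Lim_null[THEN iffD2])
  from inv_measure_limit[OF conjunct1[OF \<mu>] f this] show ?thesis .
qed

lemma Hn_ge_ks:
  assumes "\<mu> \<in> inv_measures m"
  shows "n * ks_entropy \<mu> \<le> Hn m (law m \<mu>) n"
proof (cases "n = 0")
  case True
  have "law m \<mu> [] = 1" using law_is_law[OF assms] by (simp add: is_law_def)
  then show ?thesis using True by (simp add: Hn_def)
next
  case False
  then show ?thesis using ks_entropy_cylinders(2)[OF assms, of n] by (simp add: field_simps)
qed

context ifs
begin

section \<open>Measures of zero Lyapunov exponent\<close>

lemma fixed_point: "i \<in> {1..m} \<Longrightarrow> T i (Pi_map T (\<lambda>_. i)) = Pi_map T (\<lambda>_. i)"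
  using Pi_shift[OF const_Sig, of i] by (simp add: shift_def)

text \<open>Both maps are increasing, so a common fixed point makes their images overlap in an open
  interval: around it, or on one side of it if it is an endpoint of the unit interval. This
  contradicts disjointness.\<close>

lemma fixed_points_distinct:
  assumes ij: "i \<in> {1..m}" "j \<in> {1..m}" and eq: "Pi_map T (\<lambda>_. i) = Pi_map T (\<lambda>_. j)"
  shows "i = j"
proof (rule ccontr)
  assume ne: "i \<noteq> j"
  define x where "x = Pi_map T (\<lambda>_. i)"
  have x01: "x \<in> {0..1}" unfolding x_def by (rule Pi_in[OF const_Sig[OF ij(1)]])
  have fx: "T i x = x" "T j x = x" using fixed_point[OF ij(1)] fixed_point[OF ij(2)] eq by (simp_all add: x_def)
  have mono: "T k a < T k b" if "k \<in> {1..m}" "0 \<le> a" "a < b" "b \<le> 1" for k a b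
    using Tl_strict_mono[of "[k]" a b] that by simp
  have "\<exists>y. T i 0 < y \<and> y < T i 1 \<and> T j 0 < y \<and> y < T j 1"
  proof -
    consider "x = 0" | "x = 1" | "0 < x" "x < 1" using x01 by fastforce
    then show ?thesis
    proof cases
      case 1
      then have "T i 0 = 0" "T j 0 = 0" "0 < T i 1" "0 < T j 1"
        using fx mono[OF ij(1), of 0 1] mono[OF ij(2), of 0 1] by auto
      then show ?thesis by (intro exI[of _ "min (T i 1) (T j 1) / 2"]) auto
    next
      case 2
      then have "T i 1 = 1" "T j 1 = 1" "T i 0 < 1" "T j 0 < 1"
        using fx mono[OF ij(1), of 0 1] mono[OF ij(2), of 0 1] by auto
      then show ?thesis by (intro exI[of _ "(max (T i 0) (T j 0) + 1) / 2"]) auto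
    next
      case 3
      then show ?thesis
        using fx mono[OF ij(1), of 0 x] mono[OF ij(1), of x 1] mono[OF ij(2), of 0 x] mono[OF ij(2), of x 1]
        by (intro exI[of _ x]) auto
    qed
  qed
  then obtain y where y: "T i 0 < y" "y < T i 1" "T j 0 < y" "y < T j 1" by blast
  obtain u where u: "u \<in> {0<..<1}" "T i u = y" using Tl_open_image[of "[i]" y] ij y by auto
  obtain v where v: "v \<in> {0<..<1}" "T j v = y" using Tl_open_image[of "[j]" y] ij y by auto
  show False using Tl_disjoint[of "[i]" "[j]" u v] ij ne u v by auto
qed

text \<open>\<open>g = 0\<close> at time \<open>k\<close> means derivative 1 at the projection of
  the sequence shifted \<open>Suc k\<close> times, so that projection is the fixed point of the map
  \<open>\<omega> k\<close>. Applying this map, the projection at time \<open>k\<close> is the same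
  fixed point. Comparing consecutive times, neighbouring letters share a fixed point and are
  equal.\<close>

lemma zero_orbit_const:
  assumes contr: "\<And>i x. i \<in> {1..m} \<Longrightarrow> x \<in> {0..1} \<Longrightarrow> x \<noteq> Pi_map T (\<lambda>_. i) \<Longrightarrow> DT i x < 1"
    and \<omega>: "\<omega> \<in> Sig m" and z: "\<And>k. g ((shift ^^ k) \<omega>) = 0"
  shows "\<omega> = (\<lambda>_. \<omega> 0)" "DT (\<omega> 0) (Pi_map T (\<lambda>_. \<omega> 0)) = 1"
proof -
  let ?x = "\<lambda>i. Pi_map T (\<lambda>_. i)"
  have a: "\<omega> k \<in> {1..m}" for k using \<omega> unfolding Sig_def by blast
  have S: "(shift ^^ k) \<omega> \<in> Sig m" for k by (rule shift_pow_Sig[OF \<omega>])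
  have hd: "((shift ^^ k) \<omega>) 0 = \<omega> k" for k by (simp add: shift_pow)
  have one: "DT (\<omega> k) (Pi_map T ((shift ^^ Suc k) \<omega>)) = 1" for k
  proof -
    have p: "DT (\<omega> k) (Pi_map T ((shift ^^ Suc k) \<omega>)) > 0" by (rule pos[OF a Pi_in[OF S]])
    have "ln (DT (\<omega> k) (Pi_map T ((shift ^^ Suc k) \<omega>))) = 0"
      using z[of k] unfolding gpot_def hd by simp
    then show ?thesis using p by simp
  qed
  have P1: "Pi_map T ((shift ^^ Suc k) \<omega>) = ?x (\<omega> k)" for k
  proof (rule ccontr)
    assume "Pi_map T ((shift ^^ Suc k) \<omega>) \<noteq> ?x (\<omega> k)"
    from contr[OF a Pi_in[OF S] this] show False using one[of k] by simp
  qed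
  have P0: "Pi_map T ((shift ^^ k) \<omega>) = ?x (\<omega> k)" for k
  proof -
    have "Pi_map T ((shift ^^ k) \<omega>) = T (\<omega> k) (Pi_map T ((shift ^^ Suc k) \<omega>))"
      using Pi_shift[OF S, of k] unfolding hd by simp
    then show ?thesis unfolding P1 fixed_point[OF a] .
  qed
  have "\<omega> (Suc k) = \<omega> k" for k
  proof (rule fixed_points_distinct[OF a a])
    show "?x (\<omega> (Suc k)) = ?x (\<omega> k)" using P0[of "Suc k"] P1[of k] by simp
  qed
  then have c: "\<omega> k = \<omega> 0" for k by (induction k) auto
  then show "\<omega> = (\<lambda>_. \<omega> 0)" by auto
  show "DT (\<omega> 0) (?x (\<omega> 0)) = 1" using one[of 0] P1[of 0] by simp
qed

text \<open>By invariance the integral of \<open>g\<close> along every iterate vanishes; as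
  \<open>g\<close> is nonnegative, almost every orbit has \<open>g = 0\<close> at all times, and
  such an orbit is a constant sequence at an indifferent letter.\<close>

lemma zero_lyap:
  assumes contr: "\<And>i x. i \<in> {1..m} \<Longrightarrow> x \<in> {0..1} \<Longrightarrow> x \<noteq> Pi_map T (\<lambda>_. i) \<Longrightarrow> DT i x < 1"
    and \<mu>: "\<mu> \<in> inv_measures m" and f: "UC m f" and z: "lyap T DT \<mu> = 0"
    and ab: "\<And>i. i \<in> {1..m} \<Longrightarrow> DT i (Pi_map T (\<lambda>_. i)) = 1 \<Longrightarrow> a \<le> f (\<lambda>_. i) \<and> f (\<lambda>_. i) \<le> b"
  shows "a \<le> integral\<^sup>L \<mu> f \<and> integral\<^sup>L \<mu> f \<le> b"
proof -
  note D = inv_measuresD[OF \<mu>]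
  interpret prob_space \<mu> by (rule D(1))
  have "AE \<omega> in \<mu>. g ((shift ^^ k) \<omega>) = 0" for k
  proof -
    have "(\<integral>\<omega>. g ((shift ^^ k) \<omega>) \<partial>\<mu>) = 0" using integral_shift[OF \<mu> UC_g m, of k] z by (simp add: lyap_def)
    moreover have "integrable \<mu> (\<lambda>\<omega>. g ((shift ^^ k) \<omega>))" by (rule UC_integrable[OF UC_shift[OF UC_g] m D(2,1)])
    moreover have "AE \<omega> in \<mu>. 0 \<le> g ((shift ^^ k) \<omega>)"
      by (rule AE_I2) (use g_nonneg shift_pow_Sig D(3) in auto)
    ultimately show ?thesis using integral_nonneg_eq_0_iff_AE by blast
  qed
  then have "AE \<omega> in \<mu>. \<forall>k. g ((shift ^^ k) \<omega>) = 0" by (simp add: AE_all_countable)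
  moreover have "AE \<omega> in \<mu>. \<omega> \<in> Sig m" by (rule AE_I2) (simp add: D(3))
  ultimately have AEf: "AE \<omega> in \<mu>. a \<le> f \<omega> \<and> f \<omega> \<le> b"
  proof eventually_elim
    case (elim \<omega>)
    note c = zero_orbit_const[OF contr elim(2), OF _ _ _ elim(1)[rule_format]]
    have i: "\<omega> 0 \<in> {1..m}" using elim(2) unfolding Sig_def by blast
    have "\<omega> = (\<lambda>_. \<omega> 0)" "DT (\<omega> 0) (Pi_map T (\<lambda>_. \<omega> 0)) = 1" by (rule c; assumption)+
    then show ?case using ab[OF i] by metis
  qed
  have fi: "integrable \<mu> f" by (rule UC_integrable[OF f m D(2,1)])
  have "(\<integral>\<omega>. a \<partial>\<mu>) \<le> integral\<^sup>L \<mu> f"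
  proof (rule integral_mono_AE[OF _ fi])
    show "AE \<omega> in \<mu>. a \<le> f \<omega>" using AEf by eventually_elim simp
  qed simp
  moreover have "integral\<^sup>L \<mu> f \<le> (\<integral>\<omega>. b \<partial>\<mu>)"
  proof (rule integral_mono_AE[OF fi])
    show "AE \<omega> in \<mu>. f \<omega> \<le> b" using AEf by eventually_elim simp
  qed simp
  ultimately show ?thesis using prob_space by simp
qed

section \<open>Dimension of the level sets\<close>

lemma lyap_nonneg: "\<mu> \<in> inv_measures m \<Longrightarrow> 0 \<le> lyap T DT \<mu>"
  unfolding lyap_def using g_nonneg inv_measuresD(3)[of \<mu> m] by (intro integral_nonneg_AE AE_I2) auto

lemma Pi_image: "Pi_map T ` X \<subseteq> {0..1}" if "X \<subseteq> Sig m"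
  using that Pi_in by blast

lemma level_Sig: "level_set m f \<alpha> \<subseteq> Sig m"
  by (auto simp: level_set_def)

lemma hdim_level_ge:
  assumes f: "UC m f" and \<mu>: "\<mu> \<in> inv_measures m" and l: "lyap T DT \<mu> > 0"
  shows "ks_entropy \<mu> / lyap T DT \<mu> \<le> hdim (Pi_map T ` level_set m f (integral\<^sup>L \<mu> f))"
proof (rule hdim_ge[OF Pi_image[OF level_Sig]])
  fix s :: real assume s: "0 \<le> s" "s < ks_entropy \<mu> / lyap T DT \<mu>"
  have sl: "s * lyap T DT \<mu> < ks_entropy \<mu>" using s l by (simp add: pos_less_divide_eq)
  show "hausdorff_measure s (Pi_map T ` level_set m f (integral\<^sup>L \<mu> f)) \<noteq> 0"
  proof (intro hausdorff_lower[OF _ f s(1)])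
    fix e :: real assume "e > 0"
    with sl show "\<exists>\<nu>\<in>inv_measures m. \<exists>h::real. (\<forall>n. n * h \<le> Hn m (law m \<nu>) n) \<and>
        \<bar>integral\<^sup>L \<nu> f - integral\<^sup>L \<mu> f\<bar> \<le> e \<and> s * lyap T DT \<nu> < h"
      by (intro bexI[OF _ \<mu>] exI[of _ "ks_entropy \<mu>"] conjI allI Hn_ge_ks[OF \<mu>]) auto
  qed
qed

text \<open>Existence of a measure with integral \<open>\<alpha>\<close> makes the supremum one over
  a nonempty set of nonnegative numbers, as both bounds require.\<close>

lemma hdim_level_eq:
  assumes f: "UC m f" and ne: "\<exists>\<mu>\<in>inv_measures m. integral\<^sup>L \<mu> f = \<alpha>"
    and l: "\<And>\<mu>. \<mu> \<in> inv_measures m \<Longrightarrow> integral\<^sup>L \<mu> f = \<alpha> \<Longrightarrow> lyap T DT \<mu> > 0"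
  shows "hdim (Pi_map T ` level_set m f \<alpha>) =
    Sup {ks_entropy \<mu> / lyap T DT \<mu> | \<mu>. \<mu> \<in> inv_measures m \<and> integral\<^sup>L \<mu> f = \<alpha>}"
proof -
  let ?R = "{ks_entropy \<mu> / lyap T DT \<mu> | \<mu>. \<mu> \<in> inv_measures m \<and> integral\<^sup>L \<mu> f = \<alpha>}"
  let ?h = "hdim (Pi_map T ` level_set m f \<alpha>)"
  have ub: "y \<le> ?h" if "y \<in> ?R" for y using that hdim_level_ge[OF f] l by blast
  \<comment> \<open>Boundedness of the quotients is itself a consequence of the lower bound: the
    dimension is an upper bound.\<close>
  have ba: "bdd_above ?R" using ub by (rule bdd_aboveI)
  have R: "?R \<noteq> {}" using ne by blast
  have "Sup ?R \<le> ?h" by (rule cSup_least[OF R ub])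
  moreover have "?h \<le> Sup ?R"
  proof (rule dense_ge)
    fix t assume t: "Sup ?R < t"
    \<comment> \<open>An exponent strictly between: above the supremum it gives the strict
      inequality on measures, below \<open>t\<close> it leaves the excess needed for the
      cover.\<close>
    define s where "s = (Sup ?R + t) / 2"
    obtain \<mu>0 where \<mu>0: "\<mu>0 \<in> inv_measures m" "integral\<^sup>L \<mu>0 f = \<alpha>" using ne by blast
    have "0 \<le> ks_entropy \<mu>0 / lyap T DT \<mu>0" using ks_entropy_nonneg[OF \<mu>0(1)] l[OF \<mu>0] by simp
    also have "\<dots> \<le> Sup ?R" by (rule cSup_upper[OF _ ba]) (use \<mu>0 in blast)
    finally have s: "0 \<le> s" "Sup ?R < s" "s < t" "0 \<le> t" using t by (auto simp: s_def)
    show "?h \<le> t"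
    proof (rule hdim_le[OF s(4)], rule hausdorff_upper[OF f s(1) s(3)])
      fix \<mu> assume \<mu>: "\<mu> \<in> inv_measures m" "integral\<^sup>L \<mu> f = \<alpha>"
      have "ks_entropy \<mu> / lyap T DT \<mu> \<le> Sup ?R" by (rule cSup_upper[OF _ ba]) (use \<mu> in blast)
      then have "ks_entropy \<mu> / lyap T DT \<mu> < s" using s(2) by simp
      then show "ks_entropy \<mu> < s * lyap T DT \<mu>" using l[OF \<mu>] by (simp add: pos_divide_less_eq)
    qed
  qed
  ultimately show ?thesis by simp
qed

text \<open>\<open>t\<close> must be positive, since the mixture would otherwise lose all of its
  entropy and exponent. If the exact parameter is 0 or too small, it is raised to \<open>d\<close>,
  which moves the mean by at most \<open>e\<close>.\<close>

lemma convex_parameter: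
  fixes \<alpha> \<beta> \<gamma> e :: real
  assumes "(\<beta> \<le> \<alpha> \<and> \<alpha> \<le> \<gamma>) \<or> (\<gamma> \<le> \<alpha> \<and> \<alpha> \<le> \<beta>)" "e > 0"
  shows "\<exists>t. 0 < t \<and> t \<le> 1 \<and> \<bar>t * \<beta> + (1 - t) * \<gamma> - \<alpha>\<bar> \<le> e"
proof (cases "\<beta> = \<gamma>")
  case True
  then show ?thesis using assms by (intro exI[of _ 1]) auto
next
  case False
  define t0 where "t0 = (\<gamma> - \<alpha>) / (\<gamma> - \<beta>)"
  have t0: "0 \<le> t0" "t0 \<le> 1" using assms(1) False by (auto simp: t0_def field_simps zero_le_divide_iff divide_le_eq)
  have eq: "t0 * \<beta> + (1 - t0) * \<gamma> = \<alpha>"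
  proof -
    have "t0 * (\<gamma> - \<beta>) = \<gamma> - \<alpha>" using False by (simp add: t0_def)
    then show ?thesis by (simp add: algebra_simps)
  qed
  define d where "d = min 1 (e / (\<bar>\<beta> - \<gamma>\<bar> + 1))"
  have d: "0 < d" "d \<le> 1" using assms(2) by (auto simp: d_def)
  have db: "d * \<bar>\<beta> - \<gamma>\<bar> \<le> e"
  proof -
    have "d * \<bar>\<beta> - \<gamma>\<bar> \<le> e / (\<bar>\<beta> - \<gamma>\<bar> + 1) * (\<bar>\<beta> - \<gamma>\<bar> + 1)"
      using assms(2) d by (intro mult_mono) (auto simp: d_def)
    then show ?thesis by simp
  qed
  define t where "t = max t0 d"
  have "t * \<beta> + (1 - t) * \<gamma> - \<alpha> = (t - t0) * (\<beta> - \<gamma>)" using eq by (simp add: algebra_simps)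
  then have "\<bar>t * \<beta> + (1 - t) * \<gamma> - \<alpha>\<bar> = (t - t0) * \<bar>\<beta> - \<gamma>\<bar>" by (simp add: abs_mult t_def)
  also have "\<dots> \<le> d * \<bar>\<beta> - \<gamma>\<bar>" using t0 d by (intro mult_right_mono) (auto simp: t_def)
  also note db
  finally show ?thesis using t0 d by (intro exI[of _ t]) (auto simp: t_def)
qed

text \<open>A point mass at an indifferent fixed point has exponent 0, so mixing multiplies the
  exponent by \<open>t\<close> and keeps at least the fraction \<open>t\<close> of the entropy; the
  inequality \<open>s * lyap < h\<close> survives for every \<open>t > 0\<close>.\<close>

lemma hdim_level_indifferent:
  assumes f: "UC m f"
    and approx: "\<And>e. e > 0 \<Longrightarrow> \<exists>\<mu>\<in>inv_measures m. lyap T DT \<mu> > 0 \<and> ks_entropy \<mu> / lyap T DT \<mu> \<ge> hdim (Pi_map T ` Sig m) - e"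
    and i: "i \<in> {1..m}" "DT i (Pi_map T (\<lambda>_. i)) = 1" and j: "j \<in> {1..m}" "DT j (Pi_map T (\<lambda>_. j)) = 1"
    and \<alpha>: "f (\<lambda>_. i) \<le> \<alpha>" "\<alpha> \<le> f (\<lambda>_. j)"
  shows "hdim (Pi_map T ` level_set m f \<alpha>) = hdim (Pi_map T ` Sig m)"
proof (rule antisym)
  show "hdim (Pi_map T ` level_set m f \<alpha>) \<le> hdim (Pi_map T ` Sig m)"
    by (rule hdim_mono[OF image_mono[OF level_Sig] Pi_image[OF subset_refl]])
  show "hdim (Pi_map T ` Sig m) \<le> hdim (Pi_map T ` level_set m f \<alpha>)"
  proof (rule hdim_ge[OF Pi_image[OF level_Sig]])
    fix s assume s: "0 \<le> s" "s < hdim (Pi_map T ` Sig m)"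
    define \<epsilon> where "\<epsilon> = (hdim (Pi_map T ` Sig m) - s) / 2"
    have \<epsilon>: "\<epsilon> > 0" "hdim (Pi_map T ` Sig m) - \<epsilon> > s" using s(2) by (auto simp: \<epsilon>_def field_simps)
    obtain \<mu> where \<mu>: "\<mu> \<in> inv_measures m" "lyap T DT \<mu> > 0" "ks_entropy \<mu> / lyap T DT \<mu> \<ge> hdim (Pi_map T ` Sig m) - \<epsilon>"
      using approx[OF \<epsilon>(1)] by blast
    have "s < ks_entropy \<mu> / lyap T DT \<mu>" using \<mu>(3) \<epsilon>(2) by linarith
    then have sl: "s * lyap T DT \<mu> < ks_entropy \<mu>" using \<mu>(2) by (simp add: pos_less_divide_eq)
    show "hausdorff_measure s (Pi_map T ` level_set m f \<alpha>) \<noteq> 0"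
    proof (rule hausdorff_lower[OF _ f s(1)])
      fix e :: real assume e: "e > 0"
      \<comment> \<open>The fixed point is taken on the side of \<open>\<alpha>\<close> opposite to
        the integral of \<open>\<mu>\<close>, so that a convex combination can reach
        \<open>\<alpha>\<close>.\<close>
      obtain l where l: "l \<in> {1..m}" "DT l (Pi_map T (\<lambda>_. l)) = 1"
        and between: "(integral\<^sup>L \<mu> f \<le> \<alpha> \<and> \<alpha> \<le> f (\<lambda>_. l)) \<or> (f (\<lambda>_. l) \<le> \<alpha> \<and> \<alpha> \<le> integral\<^sup>L \<mu> f)"
        using i j \<alpha> by (cases "integral\<^sup>L \<mu> f \<le> \<alpha>") (blast, force)
      obtain t where t: "0 < t" "t \<le> 1" "\<bar>t * integral\<^sup>L \<mu> f + (1 - t) * f (\<lambda>_. l) - \<alpha>\<bar> \<le> e"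
        using convex_parameter[OF between e] by blast
      let ?\<delta> = "return (SigM m) (\<lambda>_. l)"
      have \<delta>: "?\<delta> \<in> inv_measures m" by (rule erg_inv[OF dirac_erg[OF l(1)]])
      obtain \<rho> where \<rho>: "\<rho> \<in> inv_measures m"
        and int: "\<forall>\<phi>. UC m \<phi> \<longrightarrow> integral\<^sup>L \<rho> \<phi> = t * integral\<^sup>L \<mu> \<phi> + (1 - t) * integral\<^sup>L ?\<delta> \<phi>"
        and H: "\<forall>n. t * Hn m (law m \<mu>) n \<le> Hn m (law m \<rho>) n"
        using mixture[OF \<mu>(1) \<delta> less_imp_le[OF t(1)] t(2)] by blast
      have "integral\<^sup>L ?\<delta> g = 0"
        unfolding integral_dirac[OF l(1) m UC_g] using l(2) by (simp add: gpot_def shift_def)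
      then have lr: "lyap T DT \<rho> = t * lyap T DT \<mu>" using int UC_g by (simp add: lyap_def)
      have "n * (t * ks_entropy \<mu>) \<le> Hn m (law m \<rho>) n" for n
      proof -
        have "n * (t * ks_entropy \<mu>) = t * (n * ks_entropy \<mu>)" by simp
        also have "\<dots> \<le> t * Hn m (law m \<mu>) n" using Hn_ge_ks[OF \<mu>(1)] t by (intro mult_left_mono) auto
        also have "\<dots> \<le> Hn m (law m \<rho>) n" using H by blast
        finally show ?thesis .
      qed
      moreover have "\<bar>integral\<^sup>L \<rho> f - \<alpha>\<bar> \<le> e" using int f t(3) integral_dirac[OF l(1) m f] by simp
      moreover have "s * lyap T DT \<rho> < t * ks_entropy \<mu>"
        unfolding lr using mult_strict_left_mono[OF sl t(1)] by (simp add: algebra_simps)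
      ultimately show "\<exists>\<mu>\<in>inv_measures m. \<exists>h::real. (\<forall>n. n * h \<le> Hn m (law m \<mu>) n) \<and> \<bar>integral\<^sup>L \<mu> f - \<alpha>\<bar> \<le> e \<and> s * lyap T DT \<mu> < h"
        using \<rho> by blast
    qed
  qed
qed

end

theorem theorem2:
  fixes m :: nat and T DT :: "nat \<Rightarrow> real \<Rightarrow> real" and f :: "(nat \<Rightarrow> nat) \<Rightarrow> real"
  assumes m: "m \<ge> 1"
    and maps: "\<forall>i\<in>{1..m}. T i ` {0..1} \<subseteq> {0..1}"
    and deriv: "\<forall>i\<in>{1..m}. \<forall>x\<in>{0..1}. (T i has_real_derivative DT i x) (at x within {0..1})"
    and C1: "\<forall>i\<in>{1..m}. continuous_on {0..1} (DT i)"
    and pos: "\<forall>i\<in>{1..m}. \<forall>x\<in>{0..1}. DT i x > 0"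
    and disj: "\<forall>i\<in>{1..m}. \<forall>j\<in>{1..m}. i \<noteq> j \<longrightarrow> T i ` {0<..<1} \<inter> T j ` {0<..<1} = {}"
    and diam: "\<forall>\<epsilon>>0. \<exists>N. \<forall>n\<ge>N. \<forall>\<omega>\<in>Sig m. diameter (compn T \<omega> n ` {0..1}) < \<epsilon>"
    and fixpt: "\<forall>i\<in>{1..m}. T i (Pi_map T (\<lambda>_. i)) = Pi_map T (\<lambda>_. i)"
    and fixder: "\<forall>i\<in>{1..m}. DT i (Pi_map T (\<lambda>_. i)) \<le> 1"
    and contr: "\<forall>i\<in>{1..m}. \<forall>x\<in>{0..1}. x \<noteq> Pi_map T (\<lambda>_. i) \<longrightarrow> 0 < DT i x \<and> DT i x < 1"
    and Ine: "{i\<in>{1..m}. DT i (Pi_map T (\<lambda>_. i)) = 1} \<noteq> {}"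
    and approx: "\<forall>\<epsilon>>0. \<exists>\<mu>\<in>inv_measures m. lyap T DT \<mu> > 0 \<and>
                   ks_entropy \<mu> / lyap T DT \<mu> \<ge> hdim (Pi_map T ` Sig m) - \<epsilon>"
    and fcont: "continuous_on (Sig m) f"
  shows "(\<forall>\<alpha>\<in>{Inf {integral\<^sup>L \<mu> f | \<mu>. \<mu> \<in> erg_measures m} ..
                  Sup {integral\<^sup>L \<mu> f | \<mu>. \<mu> \<in> erg_measures m}}
               - {Min ((\<lambda>i. f (\<lambda>_. i)) ` {i\<in>{1..m}. DT i (Pi_map T (\<lambda>_. i)) = 1}) ..
                  Max ((\<lambda>i. f (\<lambda>_. i)) ` {i\<in>{1..m}. DT i (Pi_map T (\<lambda>_. i)) = 1})}.
            hdim (Pi_map T ` level_set m f \<alpha>) =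
              Sup {ks_entropy \<mu> / lyap T DT \<mu> | \<mu>. \<mu> \<in> inv_measures m \<and> integral\<^sup>L \<mu> f = \<alpha>})
       \<and> (\<forall>\<alpha>\<in>{Min ((\<lambda>i. f (\<lambda>_. i)) ` {i\<in>{1..m}. DT i (Pi_map T (\<lambda>_. i)) = 1}) ..
                  Max ((\<lambda>i. f (\<lambda>_. i)) ` {i\<in>{1..m}. DT i (Pi_map T (\<lambda>_. i)) = 1})}.
            hdim (Pi_map T ` level_set m f \<alpha>) = hdim (Pi_map T ` Sig m))"
proof -
  let ?I = "{i\<in>{1..m}. DT i (Pi_map T (\<lambda>_. i)) = 1}"
  let ?F = "(\<lambda>i. f (\<lambda>_. i)) ` ?I"
  have le1: "DT i x \<le> 1" if "i \<in> {1..m}" "x \<in> {0..1}" for i x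
  proof (cases "x = Pi_map T (\<lambda>_. i)")
    case True
    then show ?thesis using fixder that by blast
  next
    case False
    then have "DT i x < 1" using contr that by blast
    then show ?thesis by simp
  qed
  interpret ifs m T DT
  proof (rule ifs.intro)
    show "T i x \<in> {0..1}" if "i \<in> {1..m}" "x \<in> {0..1}" for i x using maps that by blast
    show "T i ` {0<..<1} \<inter> T j ` {0<..<1} = {}" if "i \<in> {1..m}" "j \<in> {1..m}" "i \<noteq> j" for i j
      using disj that by blast
    show "\<exists>N. \<forall>n\<ge>N. \<forall>\<omega>\<in>Sig m. diameter (compn T \<omega> n ` {0..1}) < \<epsilon>" if "\<epsilon> > 0" for \<epsilon>
      using diam that by blast
  qed (use m deriv C1 pos le1 in blast)+
  have f: "UC m f" by (rule UC_continuous[OF fcont])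
  have finF: "finite ?F" "?F \<noteq> {}" using Ine by auto
  have contr': "DT i x < 1" if "i \<in> {1..m}" "x \<in> {0..1}" "x \<noteq> Pi_map T (\<lambda>_. i)" for i x
    using contr that by blast
  have part1: "hdim (Pi_map T ` level_set m f \<alpha>) =
      Sup {ks_entropy \<mu> / lyap T DT \<mu> | \<mu>. \<mu> \<in> inv_measures m \<and> integral\<^sup>L \<mu> f = \<alpha>}"
    if \<alpha>: "\<alpha> \<in> {Inf {integral\<^sup>L \<mu> f | \<mu>. \<mu> \<in> erg_measures m} .. Sup {integral\<^sup>L \<mu> f | \<mu>. \<mu> \<in> erg_measures m}} - {Min ?F .. Max ?F}" for \<alpha>
  proof (rule hdim_level_eq[OF f])
    show "\<exists>\<mu>\<in>inv_measures m. integral\<^sup>L \<mu> f = \<alpha>"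
      by (rule exists_measure_with_integral[OF f m]) (use \<alpha> in blast)
    fix \<mu> assume \<mu>: "\<mu> \<in> inv_measures m" "integral\<^sup>L \<mu> f = \<alpha>"
    have "lyap T DT \<mu> \<noteq> 0"
    proof
      assume z: "lyap T DT \<mu> = 0"
      have bounds: "Min ?F \<le> f (\<lambda>_. i) \<and> f (\<lambda>_. i) \<le> Max ?F" if "i \<in> {1..m}" "DT i (Pi_map T (\<lambda>_. i)) = 1" for i
      proof -
        have mem: "f (\<lambda>_. i) \<in> ?F" by (rule imageI) (use that in simp)
        show ?thesis by (rule conjI[OF Min_le[OF finF(1) mem] Max_ge[OF finF(1) mem]])
      qed
      from zero_lyap[where f = f and a = "Min ?F" and b = "Max ?F", OF contr' \<mu>(1) f z bounds]
      have "\<alpha> \<in> {Min ?F .. Max ?F}" unfolding \<mu>(2) atLeastAtMost_iff .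
      then show False by (rule DiffD2[OF \<alpha>])
    qed
    then show "lyap T DT \<mu> > 0" using lyap_nonneg[OF \<mu>(1)] by simp
  qed
  have part2: "hdim (Pi_map T ` level_set m f \<alpha>) = hdim (Pi_map T ` Sig m)" if \<alpha>: "\<alpha> \<in> {Min ?F .. Max ?F}" for \<alpha>
  proof -
    from Min_in[OF finF] obtain i where i: "Min ?F = f (\<lambda>_. i)" "i \<in> ?I" by (rule imageE)
    from Max_in[OF finF] obtain j where j: "Max ?F = f (\<lambda>_. j)" "j \<in> ?I" by (rule imageE)
    show ?thesis
    proof (rule hdim_level_indifferent[OF f])
      show "\<exists>\<mu>\<in>inv_measures m. lyap T DT \<mu> > 0 \<and> ks_entropy \<mu> / lyap T DT \<mu> \<ge> hdim (Pi_map T ` Sig m) - e" if "e > 0" for e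
        using approx that by blast
      show "i \<in> {1..m}" "DT i (Pi_map T (\<lambda>_. i)) = 1" "j \<in> {1..m}" "DT j (Pi_map T (\<lambda>_. j)) = 1" using i(2) j(2) by simp_all
      show "f (\<lambda>_. i) \<le> \<alpha>" unfolding i(1)[symmetric] by (rule atLeastAtMost_iff[THEN iffD1, OF \<alpha>, THEN conjunct1])
      show "\<alpha> \<le> f (\<lambda>_. j)" unfolding j(1)[symmetric] by (rule atLeastAtMost_iff[THEN iffD1, OF \<alpha>, THEN conjunct2])
    qed
  qed
  show ?thesis by (intro conjI ballI part1 part2)
qed

end
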